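(* Let $U:\mathbb{R}^d\to\mathbb{R}$ satisfy (A1), (A2), (A3) of the context, with constants $L,K,\mathcal{R}$, and let $T\in(0,\infty)$ satisfy $$LT^2\le\min\left(\frac{K}{L},\frac14,\frac1{256\,L\mathcal{R}^2}\right).$$ Let $\pi$ be the transition kernel of exact HMC with duration $T$, and let $\rho(x,y)=f(|x-y|)$ with $f(r)=\int_0^r\exp(-a\min(s,R_1))\,ds$, $a=T^{-1}$, $R_1=\frac52(\mathcal{R}+T)$. Then for any $n\in\mathbb{N}$ and any probability measures $\nu,\eta$ on $\mathbb{R}^d$, $$\mathcal{W}_\rho(\nu\pi^n,\eta\pi^n)\le e^{-cn}\,\mathcal{W}_\rho(\nu,\eta)\qquad\text{and}\qquad \mathcal{W}^1(\nu\pi^n,\eta\pi^n)\le Me^{-cn}\,\mathcal{W}^1(\nu,\eta),$$ where $$c=\frac1{10}\min\left(1,\ \frac12KT^2\Big(1+\frac{\mathcal{R}}{T}\Big)e^{-\mathcal{R}/(2T)}\right)e^{-2\mathcal{R}/T},\qquad M=\exp\Big(\frac52\Big(1+\frac{\mathcal{R}}{T}\Big)\Big).$$ In particular, for a given constant $\epsilon\in(0,\infty)$, the $L^1$ Wasserstein distance $\Delta(n)=\mathcal{W}^1(\nu\pi^n,\mu)$ satisfies $\Delta(n)\le\epsilon$ provided $$n\ge\frac1c\left(\frac52+\frac{5\mathcal{R}}{2T}+\log\frac{\Delta(0)}{\epsilon}\right).$$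
   Context: Assumptions on $U$: $U\in C^4(\mathbb{R}^d)$ with $\int_{\mathbb{R}^d}e^{-U(x)}dx<\infty$, and (A1) $U$ has a local minimum at $0$ and $U(0)=0$; (A2) $U$ has bounded second, third and fourth derivatives; $L=\sup\|\nabla^2U\|$; (A3) there are constants $\mathcal{R}\in[0,\infty)$, $K\in(0,\infty)$ such that $(x-y)\cdot(\nabla U(x)-\nabla U(y))\ge K|x-y|^2$ for all $x,y\in\mathbb{R}^d$ with $|x-y|\ge\mathcal{R}$. $|\cdot|$ is the Euclidean norm. If $\mathcal{R}=0$, then $1/\mathcal{R}^2$ is read as $+\infty$. $\mu$ is the probability measure on $\mathbb{R}^d$ with density proportional to $e^{-U}$; it is invariant for exact HMC. Exact HMC: $(q_t(x,v),p_t(x,v))$ solves $\frac{d}{dt}q_t=p_t$, $\frac{d}{dt}p_t=-\nabla U(q_t)$, $(q_0,p_0)=(x,v)$, and $\pi(x,B)=P[q_T(x,\xi)\in B]$ with $\xi\sim N(0,I_d)$. Kantorovich distances: $\mathcal{W}_\rho(\nu,\eta)=\inf_{\gamma}\int\rho(x,y)\,\gamma(dx\,dy)$ and $\mathcal{W}^1(\nu,\eta)=\inf_\gamma\int|x-y|\,\gamma(dx\,dy)$, the infima being over all couplings $\gamma$ of $\nu$ and $\eta$. $\nu\pi^n$ is the law after $n$ steps of the chain with initial law $\nu$. *)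

theory Defs
  imports "HOL-Probability.Probability"
begin

section \<open>Derivatives and the assumptions on the potential\<close>

text \<open>
  The derivative as a map into bounded linear maps, so that it can be iterated.  The norm on
  iterated spaces of bounded linear maps is the operator norm of the corresponding multilinear
  form; in particular \<open>norm (D2 U x)\<close> is the operator norm of the Hessian of \<open>U\<close> at \<open>x\<close>.
\<close>

definition fderiv ::
  "('a::real_normed_vector \<Rightarrow> 'b::real_normed_vector) \<Rightarrow> 'a \<Rightarrow> 'a \<Rightarrow>\<^sub>L 'b" where
  "fderiv f x = Blinfun (frechet_derivative f (at x))"

definition D2 :: "('a::euclidean_space \<Rightarrow> real) \<Rightarrow> 'a \<Rightarrow> 'a \<Rightarrow>\<^sub>L 'a \<Rightarrow>\<^sub>L real" where
  "D2 U = fderiv (fderiv U)"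

definition D3 :: "('a::euclidean_space \<Rightarrow> real) \<Rightarrow> 'a \<Rightarrow> 'a \<Rightarrow>\<^sub>L 'a \<Rightarrow>\<^sub>L 'a \<Rightarrow>\<^sub>L real" where
  "D3 U = fderiv (D2 U)"

definition D4 :: "('a::euclidean_space \<Rightarrow> real) \<Rightarrow> 'a \<Rightarrow> 'a \<Rightarrow>\<^sub>L 'a \<Rightarrow>\<^sub>L 'a \<Rightarrow>\<^sub>L 'a \<Rightarrow>\<^sub>L real" where
  "D4 U = fderiv (D3 U)"

definition C4 :: "('a::euclidean_space \<Rightarrow> real) \<Rightarrow> bool" where
  "C4 U \<longleftrightarrow> (\<forall>x. U differentiable (at x)) \<and> (\<forall>x. fderiv U differentiable (at x)) \<and>
     (\<forall>x. D2 U differentiable (at x)) \<and> (\<forall>x. D3 U differentiable (at x)) \<and>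
     continuous_on UNIV (D4 U)"

definition gradient :: "('a::euclidean_space \<Rightarrow> real) \<Rightarrow> 'a \<Rightarrow> 'a" where
  "gradient U x = (THE g. GDERIV U x :> g)"

definition assumption_A1 :: "('a::euclidean_space \<Rightarrow> real) \<Rightarrow> bool" where
  "assumption_A1 U \<longleftrightarrow> (\<forall>\<^sub>F x in nhds 0. U 0 \<le> U x) \<and> U 0 = 0"

definition assumption_A2 :: "('a::euclidean_space \<Rightarrow> real) \<Rightarrow> real \<Rightarrow> bool" where
  "assumption_A2 U L \<longleftrightarrow>
     bounded (range (D2 U)) \<and> bounded (range (D3 U)) \<and> bounded (range (D4 U)) \<and>
     L = (SUP x. norm (D2 U x))"

definition assumption_A3 :: "('a::euclidean_space \<Rightarrow> real) \<Rightarrow> real \<Rightarrow> real \<Rightarrow> bool" where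
  "assumption_A3 U K R \<longleftrightarrow> 0 < K \<and> 0 \<le> R \<and>
     (\<forall>x y. norm (x - y) \<ge> R \<longrightarrow>
        (x - y) \<bullet> (gradient U x - gradient U y) \<ge> K * (norm (x - y))\<^sup>2)"

section \<open>Exact Hamiltonian Monte Carlo\<close>

definition hamiltonian_solution ::
  "('a::euclidean_space \<Rightarrow> real) \<Rightarrow> real \<Rightarrow> 'a \<Rightarrow> 'a \<Rightarrow> (real \<Rightarrow> 'a) \<Rightarrow> (real \<Rightarrow> 'a) \<Rightarrow> bool" where
  "hamiltonian_solution U T x v q p \<longleftrightarrow> q 0 = x \<and> p 0 = v \<and>
     (\<forall>t\<in>{0..T}. (q has_vector_derivative p t) (at t within {0..T}) \<and>
                 (p has_vector_derivative - gradient U (q t)) (at t within {0..T}))"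

text \<open>
  The position \<open>q\<^sub>T(x,v)\<close>.  The description is proper as soon as the gradient of \<open>U\<close> is
  globally Lipschitz, hence under \<^const>\<open>assumption_A2\<close>.
\<close>

definition hmc_position :: "('a::euclidean_space \<Rightarrow> real) \<Rightarrow> real \<Rightarrow> 'a \<Rightarrow> 'a \<Rightarrow> 'a" where
  "hmc_position U T x v = (THE y. \<exists>q p. hamiltonian_solution U T x v q p \<and> q T = y)"

definition std_gaussian :: "'a::euclidean_space measure" where
  "std_gaussian = density lborel
     (\<lambda>v. ennreal ((2 * pi) powr (- real DIM('a) / 2) * exp (- (norm v)\<^sup>2 / 2)))"

definition hmc_kernel :: "('a::euclidean_space \<Rightarrow> real) \<Rightarrow> real \<Rightarrow> 'a \<Rightarrow> 'a measure" where
  "hmc_kernel U T x = distr std_gaussian borel (\<lambda>v. hmc_position U T x v)"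

definition chain_law :: "('a \<Rightarrow> 'a measure) \<Rightarrow> 'a measure \<Rightarrow> nat \<Rightarrow> 'a measure" where
  "chain_law \<pi> \<nu> n = ((\<lambda>\<nu>'. \<nu>' \<bind> \<pi>) ^^ n) \<nu>"

definition gibbs_measure :: "('a::euclidean_space \<Rightarrow> real) \<Rightarrow> 'a measure" where
  "gibbs_measure U = density lborel
     (\<lambda>x. ennreal (exp (- U x) / (LINT y|lborel. exp (- U y))))"

section \<open>Kantorovich distances\<close>

definition couplings ::
  "'a::euclidean_space measure \<Rightarrow> 'a measure \<Rightarrow> ('a \<times> 'a) measure set" where
  "couplings \<nu> \<eta> = {\<gamma>. prob_space \<gamma> \<and> sets \<gamma> = sets (borel \<Otimes>\<^sub>M borel) \<and>
     distr \<gamma> borel fst = \<nu> \<and> distr \<gamma> borel snd = \<eta>}"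

text \<open>The values are extended nonnegative reals, since no moment condition is imposed.\<close>

definition kantorovich ::
  "('a::euclidean_space \<Rightarrow> 'a \<Rightarrow> real) \<Rightarrow> 'a measure \<Rightarrow> 'a measure \<Rightarrow> ennreal" where
  "kantorovich \<rho> \<nu> \<eta> =
     (INF \<gamma>\<in>couplings \<nu> \<eta>. \<integral>\<^sup>+ z. ennreal (\<rho> (fst z) (snd z)) \<partial>\<gamma>)"

definition wasserstein1 :: "'a::euclidean_space measure \<Rightarrow> 'a measure \<Rightarrow> ennreal" where
  "wasserstein1 = kantorovich (\<lambda>x y. norm (x - y))"

text \<open>
  The logarithm with \<open>log 0 = -\<infinity>\<close> and \<open>log \<infinity> = \<infinity>\<close>; the real \<^const>\<open>ln\<close> is \<open>0\<close> at \<open>0\<close>.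
\<close>

definition eln :: "ennreal \<Rightarrow> ereal" where
  "eln x = (if x = 0 then - \<infinity> else if x = \<infinity> then \<infinity> else ereal (ln (enn2real x)))"

end

theory Submission
  imports Defs
begin

text \<open>
Write \<open>\<Phi> r\<close> for the integral of \<open>exp (- min s R\<^sub>1 / T)\<close> over \<open>0 \<le> s \<le> r\<close>, so that
\<open>\<rho> x y = \<Phi> |x - y|\<close>.  One HMC step from \<open>x\<close> and one from \<open>y\<close> may use initial velocities
\<open>\<xi>\<close> and \<open>\<eta>\<close> that depend on each other, as long as each of them is standard Gaussian.  The heart of the
proof is a choice of such a pair for which the expectation of \<open>\<Phi>\<close> of the new distance is at most
\<open>(1 - c) \<Phi> |x - y|\<close> (lemma \<open>drift\<close>).  Integrating over an arbitrary coupling of \<open>\<nu>\<close> and \<open>\<eta>\<close> and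
iterating gives the contraction in \<open>\<W>\<^sub>\<rho>\<close>.  Because \<open>exp (- R\<^sub>1 / T) r \<le> \<Phi> r \<le> r\<close>, it carries over to the
\<open>L\<^sup>1\<close> distance with the factor \<open>M = exp (R\<^sub>1 / T)\<close>, and the last claim is the case \<open>\<eta> = \<mu>\<close> of an
invariant measure.

Over the short time \<open>T\<close> trajectories are nearly straight: the difference \<open>z\<close> of two positions satisfies
\<open>z'' = - (\<nabla>U(q) - \<nabla>U(q'))\<close>, so \<open>z\<close> differs from free flight by at most \<open>L t\<^sup>2 / 2\<close> times the supremum
of \<open>|z|\<close>, and \<open>L T\<^sup>2 \<le> 1/4\<close> makes this small.  Let \<open>r = |x - y|\<close>.

If \<open>r \<ge> 7 R / 6\<close>, both velocities are equal.  The distance of the trajectories stays above \<open>6 r / 7 \<ge> R\<close>,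
where strong convexity holds, and a second order differential inequality for \<open>|z|\<^sup>2\<close> gives a contraction by
\<open>1 - K T\<^sup>2 / 4\<close>.  Concavity of \<open>\<Phi>\<close> turns this into a contraction of \<open>\<Phi>\<close>, weakest at \<open>r = R\<^sub>1\<close>.

If \<open>r < 7 R / 6\<close>, convexity is of no help and the noise is used.  With \<open>\<eta> = \<xi> + \<gamma> (x - y)\<close>,
\<open>\<gamma> = min (1/T) (1/(4R))\<close>, the particles fly towards each other and the distance shrinks by about
\<open>\<gamma> T r\<close>.  Two Gaussians whose means are \<open>\<gamma> r \<le> 7/24\<close> apart overlap so much that this can be arranged
except on an event of small probability.  On that event the velocity is reflected in the hyperplane
orthogonal to \<open>x - y\<close>, which keeps both laws Gaussian.  Then the distance may grow, but \<open>\<Phi>\<close> is bounded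
up to a linear tail of slope \<open>exp (- R\<^sub>1 / T)\<close>, so the expected loss is smaller than the expected gain.

That \<open>\<mu>\<close> is invariant follows from conservation of energy and of phase volume.  Phase volume is treated without
Jacobians: the symplectic Euler scheme is a composition of shears, hence preserves Lebesgue measure, and it converges
pointwise to the Hamiltonian flow.  Fatou's lemma then yields that the law after one step gives each open set at most the
mass it has under \<open>\<mu>\<close>, and for two probability measures such an inequality forces equality.
\<close>

section \<open>The gradient of the potential\<close>

lemma gderiv_gradient:
  fixes U :: "'a::euclidean_space \<Rightarrow> real"
  assumes "U differentiable (at x)"
  shows "GDERIV U x :> gradient U x"
proof -
  let ?D = "frechet_derivative U (at x)"
  define g where "g = (\<Sum>b\<in>Basis. ?D b *\<^sub>R b)"
  have D: "(U has_derivative ?D) (at x)" using assms by (simp add: frechet_derivative_works)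
  then have lin: "linear ?D" by (rule has_derivative_linear)
  have "?D h = h \<bullet> g" for h
  proof -
    have "?D h = ?D (\<Sum>b\<in>Basis. (h \<bullet> b) *\<^sub>R b)" by (simp add: euclidean_representation)
    also have "\<dots> = (\<Sum>b\<in>Basis. (h \<bullet> b) * ?D b)"
      by (simp add: linear_sum[OF lin] linear_cmul[OF lin])
    finally show ?thesis by (simp add: g_def inner_sum_right mult.commute)
  qed
  then have "?D = (\<lambda>h. h \<bullet> g)" by (simp add: fun_eq_iff)
  with D have g: "GDERIV U x :> g" by (simp add: gderiv_def)
  show ?thesis
    unfolding gradient_def
  proof (rule theI)
    show "GDERIV U x :> g" by (rule g)
    fix g' assume "GDERIV U x :> g'"
    with g have "(\<lambda>h. h \<bullet> g') = (\<lambda>h. h \<bullet> g)"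
      unfolding gderiv_def by (rule has_derivative_unique[rotated])
    then have "h \<bullet> g' = h \<bullet> g" for h by (rule fun_cong)
    then show "g' = g" using vector_eq_ldot[of g' g] by blast
  qed
qed

lemma fderiv_has_derivative:
  assumes "f differentiable (at x)"
  shows "(f has_derivative blinfun_apply (fderiv f x)) (at x)"
proof -
  have D: "(f has_derivative frechet_derivative f (at x)) (at x)"
    using assms by (simp add: frechet_derivative_works)
  then have "blinfun_apply (fderiv f x) = frechet_derivative f (at x)"
    unfolding fderiv_def by (intro bounded_linear_Blinfun_apply has_derivative_bounded_linear)
  with D show ?thesis by simp
qed

text \<open>
The mean value inequality applied to the derivative of \<open>U\<close>, whose own derivative has norm at most \<open>L\<close>; testing the
functional \<open>D U x - D U y\<close> on the vector \<open>\<nabla>U x - \<nabla>U y\<close> transfers the bound to gradients.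
\<close>

lemma gradient_lipschitz:
  fixes U :: "'a::euclidean_space \<Rightarrow> real"
  assumes C4: "C4 U" and A2: "assumption_A2 U L"
  shows "norm (gradient U x - gradient U y) \<le> L * norm (x - y)"
proof -
  have bdd: "bdd_above (range (\<lambda>x. norm (D2 U x)))" and L: "L = (SUP x. norm (D2 U x))"
    using A2 unfolding assumption_A2_def by (auto simp: bounded_iff bdd_above_def)
  have D2_le: "norm (D2 U z) \<le> L" for z
    unfolding L using bdd by (intro cSUP_upper) auto
  have dU: "U differentiable (at z)" and dfU: "fderiv U differentiable (at z)" for z
    using C4 by (auto simp: C4_def)
  have apply_fderiv: "blinfun_apply (fderiv U z) h = h \<bullet> gradient U z" for z h
  proof -
    have "blinfun_apply (fderiv U z) = (\<lambda>h. h \<bullet> gradient U z)"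
      using fderiv_has_derivative[OF dU] gderiv_gradient[OF dU]
      unfolding gderiv_def by (rule has_derivative_unique)
    then show ?thesis by simp
  qed
  have lip: "norm (fderiv U x - fderiv U y) \<le> L * norm (x - y)"
  proof (rule differentiable_bound[where S = UNIV and f' = "\<lambda>z. blinfun_apply (D2 U z)"])
    show "(fderiv U has_derivative blinfun_apply (D2 U z)) (at z within UNIV)" for z
      unfolding D2_def using fderiv_has_derivative[OF dfU] by simp
    show "onorm (blinfun_apply (D2 U z)) \<le> L" for z
      using D2_le[of z] by (simp add: norm_blinfun.rep_eq)
  qed auto
  define w where "w = gradient U x - gradient U y"
  have "(norm w)\<^sup>2 = blinfun_apply (fderiv U x - fderiv U y) w"
    by (simp add: blinfun.diff_left apply_fderiv inner_diff_right[symmetric] w_def power2_norm_eq_inner)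
  also have "\<dots> \<le> norm (fderiv U x - fderiv U y) * norm w"
    using norm_blinfun[of "fderiv U x - fderiv U y" w] by simp
  also have "\<dots> \<le> L * norm (x - y) * norm w"
    using lip by (intro mult_right_mono) auto
  finally have le: "norm w * norm w \<le> L * norm (x - y) * norm w" by (simp add: power2_eq_square)
  have "0 \<le> L" using order_trans[OF norm_ge_zero D2_le] .
  then show ?thesis
    using le unfolding w_def[symmetric] by (cases "w = 0") auto
qed

text \<open>
Comparing the monotonicity and the Lipschitz bound at one pair of points at distance \<open>R + 1\<close>.  In particular \<open>L\<close>
is positive.
\<close>

lemma convexity_constant_le_lipschitz_constant:
  fixes U :: "'a::euclidean_space \<Rightarrow> real"
  assumes A3: "assumption_A3 U K R"
    and lip: "\<And>x y. norm (gradient U x - gradient U y) \<le> L * norm (x - y)"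
  shows "K \<le> L"
proof -
  obtain b :: 'a where b: "b \<in> Basis" using nonempty_Basis by blast
  define z where "z = (R + 1) *\<^sub>R b"
  have R: "0 \<le> R" using A3 by (simp add: assumption_A3_def)
  then have nz: "norm z = R + 1" using b by (simp add: z_def)
  have "K * (norm (z - 0))\<^sup>2 \<le> (z - 0) \<bullet> (gradient U z - gradient U 0)"
  proof -
    have "R \<le> norm (z - 0)" using nz by simp
    then show ?thesis using A3 unfolding assumption_A3_def by blast
  qed
  also have "\<dots> \<le> norm z * norm (gradient U z - gradient U 0)"
    using norm_cauchy_schwarz[of z "gradient U z - gradient U 0"] by simp
  also have "\<dots> \<le> norm z * (L * norm (z - 0))" by (intro mult_left_mono lip) simp
  finally have "K * (norm z)\<^sup>2 \<le> L * (norm z)\<^sup>2" by (simp add: power2_eq_square mult_ac)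
  then show ?thesis using nz R by (simp add: mult_le_cancel_right)
qed

section \<open>Comparison of functions through their derivatives\<close>

lemma continuous_on_of_has_vector_derivative:
  "(\<And>t. t \<in> S \<Longrightarrow> (f has_vector_derivative f' t) (at t within S)) \<Longrightarrow> continuous_on S f"
  by (auto simp: continuous_on_eq_continuous_within intro: has_vector_derivative_continuous)

lemma increment_le_of_deriv_le:
  fixes f g :: "real \<Rightarrow> real"
  assumes "a \<le> b"
    and f: "\<And>t. t \<in> {a..b} \<Longrightarrow> (f has_vector_derivative f' t) (at t within {a..b})"
    and g: "\<And>t. t \<in> {a..b} \<Longrightarrow> (g has_vector_derivative g' t) (at t within {a..b})"
    and le: "\<And>t. t \<in> {a..b} \<Longrightarrow> f' t \<le> g' t"
  shows "f b - f a \<le> g b - g a"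
proof -
  have "((\<lambda>t. f t - g t) has_derivative (\<lambda>h. h * (f' t - g' t))) (at t within {a..b})"
    if "a \<le> t" "t \<le> b" for t
    using has_vector_derivative_diff[OF f g, of t] that
    by (simp add: has_vector_derivative_def)
  from mvt_very_simple[OF \<open>a \<le> b\<close> this]
  obtain t where "t \<in> {a..b}" "(f b - g b) - (f a - g a) = (b - a) * (f' t - g' t)"
    by blast
  moreover have "(b - a) * (f' t - g' t) \<le> 0" if "t \<in> {a..b}" for t
    using le[OF that] \<open>a \<le> b\<close> by (simp add: mult_nonneg_nonpos)
  ultimately show ?thesis by fastforce
qed

lemma norm_increment_le_of_deriv_le:
  fixes f :: "real \<Rightarrow> 'b::real_normed_vector" and \<phi> :: "real \<Rightarrow> real"
  assumes "a \<le> b"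
    and f: "\<And>t. t \<in> {a..b} \<Longrightarrow> (f has_vector_derivative f' t) (at t within {a..b})"
    and \<phi>: "\<And>t. t \<in> {a..b} \<Longrightarrow> (\<phi> has_vector_derivative \<phi>' t) (at t within {a..b})"
    and le: "\<And>t. t \<in> {a..b} \<Longrightarrow> norm (f' t) \<le> \<phi>' t"
  shows "norm (f b - f a) \<le> \<phi> b - \<phi> a"
proof (cases "a = b")
  case False
  with assms(1) have "a < b" by simp
  then show ?thesis
  proof (rule differentiable_bound_general)
    show "continuous_on {a..b} f" "continuous_on {a..b} \<phi>"
      using continuous_on_of_has_vector_derivative[of "{a..b}" f f', OF f]
        continuous_on_of_has_vector_derivative[of "{a..b}" \<phi> \<phi>', OF \<phi>] by blast+
  next
    fix t assume t: "a < t" "t < b"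
    then have eq: "at t within {a..b} = at t"
      by (simp add: at_within_Icc_at)
    show "(f has_vector_derivative f' t) (at t)" "(\<phi> has_vector_derivative \<phi>' t) (at t)"
      "norm (f' t) \<le> \<phi>' t"
      using f[of t] \<phi>[of t] le[of t] t eq by auto
  qed
qed simp

lemma hamiltonian_solution_subinterval:
  assumes "hamiltonian_solution U T x v q p" "0 \<le> S" "S \<le> T"
  shows "hamiltonian_solution U S x v q p"
proof -
  have "(f has_vector_derivative D) (at t within {0..S})"
    if "(f has_vector_derivative D) (at t within {0..T})" for f :: "real \<Rightarrow> 'a" and D t
    using that by (rule has_vector_derivative_within_subset) (use assms in auto)
  then show ?thesis using assms unfolding hamiltonian_solution_def by auto
qed

section \<open>Hamiltonian trajectories over a short time\<close>

locale lipschitz_force =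
  fixes U :: "'a::euclidean_space \<Rightarrow> real" and L T :: real
  assumes gderiv: "\<And>x. GDERIV U x :> gradient U x"
    and lip: "\<And>x y. norm (gradient U x - gradient U y) \<le> L * norm (x - y)"
    and L_pos: "0 < L" and T_pos: "0 < T" and LT: "L * T\<^sup>2 \<le> 1 / 4"
begin

lemma gradient_continuous: "continuous_on A (gradient U)"
proof -
  have "L-lipschitz_on UNIV (gradient U)"
    using L_pos lip by (auto simp: lipschitz_on_def dist_norm)
  then have "continuous_on UNIV (gradient U)"
    by (rule lipschitz_on_continuous_on)
  then show ?thesis by (rule continuous_on_subset) simp
qed

text \<open>
Duhamel's formula as an estimate: the force difference is at most \<open>L S\<close>, so integrating once bounds the deviation of
the velocity difference from its initial value, and integrating twice the deviation of the position difference from free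
flight.
\<close>

lemma solution_difference_bound:
  assumes h: "hamiltonian_solution U T x v q p" and h': "hamiltonian_solution U T x' v' q' p'"
    and S: "\<And>s. s \<in> {0..T} \<Longrightarrow> norm (q s - q' s) \<le> S"
    and t: "t \<in> {0..T}"
  shows "norm ((p t - p' t) - (v - v')) \<le> L * S * t"
    and "norm ((q t - q' t) - ((x - x') + t *\<^sub>R (v - v'))) \<le> L * S * t\<^sup>2 / 2"
proof -
  have d: "((\<lambda>s. q s - q' s) has_vector_derivative p s - p' s) (at s within {0..r})"
    "((\<lambda>s. p s - p' s) has_vector_derivative - (gradient U (q s) - gradient U (q' s))) (at s within {0..r})"
    if "s \<in> {0..r}" "r \<le> T" for s r
  proof -
    have "(q has_vector_derivative p s) (at s within {0..r})"
      "(p has_vector_derivative - gradient U (q s)) (at s within {0..r})"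
      "(q' has_vector_derivative p' s) (at s within {0..r})"
      "(p' has_vector_derivative - gradient U (q' s)) (at s within {0..r})"
      using that hamiltonian_solution_subinterval[OF h, of r] hamiltonian_solution_subinterval[OF h', of r]
      by (auto simp: hamiltonian_solution_def)
    then show "((\<lambda>s. q s - q' s) has_vector_derivative p s - p' s) (at s within {0..r})"
      "((\<lambda>s. p s - p' s) has_vector_derivative - (gradient U (q s) - gradient U (q' s))) (at s within {0..r})"
      by (auto intro!: derivative_eq_intros)
  qed
  have init: "q 0 = x" "p 0 = v" "q' 0 = x'" "p' 0 = v'"
    using h h' by (auto simp: hamiltonian_solution_def)
  have P: "norm ((p r - p' r) - (v - v')) \<le> L * S * r" if r: "r \<in> {0..T}" for r
  proof -
    have "norm ((p r - p' r) - (p 0 - p' 0)) \<le> L * S * r - L * S * 0"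
    proof (rule norm_increment_le_of_deriv_le[where \<phi>' = "\<lambda>_. L * S"])
      fix s assume s: "s \<in> {0..r}"
      show "((\<lambda>s. p s - p' s) has_vector_derivative - (gradient U (q s) - gradient U (q' s))) (at s within {0..r})"
        using d(2) s r by auto
      have "norm (- (gradient U (q s) - gradient U (q' s))) \<le> L * norm (q s - q' s)"
        unfolding norm_minus_cancel by (rule lip)
      also have "\<dots> \<le> L * S"
        using S[of s] s r L_pos by (intro mult_left_mono) auto
      finally show "norm (- (gradient U (q s) - gradient U (q' s))) \<le> L * S" .
      show "((*) (L * S) has_vector_derivative L * S) (at s within {0..r})"
        by (auto intro!: derivative_eq_intros simp: has_vector_derivative_def)
    qed (use r in auto)
    then show ?thesis by (simp add: init)
  qed
  show "norm ((p t - p' t) - (v - v')) \<le> L * S * t" by (rule P[OF t])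
  have "norm ((q t - q' t - t *\<^sub>R (v - v')) - (q 0 - q' 0 - 0 *\<^sub>R (v - v'))) \<le> L * S * t\<^sup>2 / 2 - L * S * 0\<^sup>2 / 2"
  proof (rule norm_increment_le_of_deriv_le[where \<phi>' = "\<lambda>s. L * S * s"])
    fix s assume s: "s \<in> {0..t}"
    show "((\<lambda>s. q s - q' s - s *\<^sub>R (v - v')) has_vector_derivative (p s - p' s) - (v - v')) (at s within {0..t})"
    proof -
      have 1: "((\<lambda>s. s *\<^sub>R (v - v')) has_vector_derivative (v - v')) (at s within {0..t})"
        by (auto intro!: derivative_eq_intros simp: has_vector_derivative_def)
      have 2: "((\<lambda>s. q s - q' s) has_vector_derivative p s - p' s) (at s within {0..t})"
        by (rule d(1)) (use s t in auto)
      show ?thesis by (rule has_vector_derivative_diff[OF 2 1])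
    qed
    show "norm ((p s - p' s) - (v - v')) \<le> L * S * s"
      using P s t by auto
    have "((\<lambda>s. L * S * s\<^sup>2 / 2) has_real_derivative L * S * s) (at s within {0..t})"
      by (auto intro!: derivative_eq_intros)
    then show "((\<lambda>s. L * S * s\<^sup>2 / 2) has_vector_derivative L * S * s) (at s within {0..t})"
      by (simp add: has_real_derivative_iff_has_vector_derivative)
  qed (use t in auto)
  then show "norm ((q t - q' t) - ((x - x') + t *\<^sub>R (v - v'))) \<le> L * S * t\<^sup>2 / 2"
    by (simp add: init algebra_simps)
qed

lemma solution_continuous:
  assumes "hamiltonian_solution U T x v q p"
  shows "continuous_on {0..T} q" "continuous_on {0..T} p"
proof -
  have q: "(q has_vector_derivative p t) (at t within {0..T})" if "t \<in> {0..T}" for t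
    using assms that unfolding hamiltonian_solution_def by blast
  have p: "(p has_vector_derivative - gradient U (q t)) (at t within {0..T})" if "t \<in> {0..T}" for t
    using assms that unfolding hamiltonian_solution_def by blast
  show "continuous_on {0..T} q"
    by (rule continuous_on_of_has_vector_derivative[where f' = p]) (rule q)
  show "continuous_on {0..T} p"
    by (rule continuous_on_of_has_vector_derivative[where f' = "\<lambda>t. - gradient U (q t)"]) (rule p)
qed

text \<open>
At a time where the distance is maximal, \<open>solution_difference_bound\<close> bounds it by the distance in free flight plus one eighth
of itself.
\<close>

lemma solution_distance_bound:
  assumes h: "hamiltonian_solution U T x v q p" and h': "hamiltonian_solution U T x' v' q' p'"
    and t: "t \<in> {0..T}"
  shows "norm (q t - q' t) \<le> 8 / 7 * max (norm (x - x')) (norm (x - x' + T *\<^sub>R (v - v')))"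
    (is "_ \<le> 8 / 7 * ?m")
proof -
  have "continuous_on {0..T} (\<lambda>t. norm (q t - q' t))"
    using solution_continuous[OF h] solution_continuous[OF h'] by (intro continuous_intros)
  then obtain s where s: "s \<in> {0..T}" and
    max: "\<And>t. t \<in> {0..T} \<Longrightarrow> norm (q t - q' t) \<le> norm (q s - q' s)"
    using continuous_attains_sup[of "{0..T}" "\<lambda>t. norm (q t - q' t)"] T_pos by auto
  let ?S = "norm (q s - q' s)"
  \<comment> \<open>Free flight at time \<open>s\<close> is a convex combination of free flight at times \<open>0\<close> and \<open>T\<close>.\<close>
  have "x - x' + s *\<^sub>R (v - v') = (1 - s / T) *\<^sub>R (x - x') + (s / T) *\<^sub>R (x - x' + T *\<^sub>R (v - v'))"
    using T_pos by (simp add: algebra_simps)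
  also have "norm \<dots> \<le> (1 - s / T) * norm (x - x') + (s / T) * norm (x - x' + T *\<^sub>R (v - v'))"
    using s T_pos by (intro norm_triangle_le) (simp add: divide_simps)
  also have "\<dots> \<le> (1 - s / T) * ?m + (s / T) * ?m"
    using s T_pos by (intro add_mono mult_left_mono) (auto simp: divide_simps)
  also have "\<dots> = ?m" by (simp add: algebra_simps)
  finally have lin: "norm (x - x' + s *\<^sub>R (v - v')) \<le> ?m" .
  have "?S \<le> norm (x - x' + s *\<^sub>R (v - v')) + norm ((q s - q' s) - ((x - x') + s *\<^sub>R (v - v')))"
    by (rule norm_triangle_sub)
  also have "\<dots> \<le> ?m + L * ?S * s\<^sup>2 / 2"
    using lin solution_difference_bound(2)[OF h h' max s] by (intro add_mono) auto
  also have "L * ?S * s\<^sup>2 / 2 \<le> ?S / 8"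
  proof -
    have "L * s\<^sup>2 \<le> L * T\<^sup>2" using s L_pos by (intro mult_left_mono power_mono) auto
    then have "L * s\<^sup>2 \<le> 1 / 4" using LT by simp
    then have "(L * s\<^sup>2) * ?S \<le> 1 / 4 * ?S" by (intro mult_right_mono) auto
    then show ?thesis by (simp add: algebra_simps)
  qed
  finally have "?S \<le> 8 / 7 * ?m" by simp
  then show ?thesis using max[OF t] by linarith
qed

lemma solution_endpoint_bound:
  assumes h: "hamiltonian_solution U T x v q p" and h': "hamiltonian_solution U T x' v' q' p'"
  shows "norm ((q T - q' T) - ((x - x') + T *\<^sub>R (v - v')))
    \<le> 4 / 7 * (L * T\<^sup>2) * max (norm (x - x')) (norm (x - x' + T *\<^sub>R (v - v')))"
  using solution_difference_bound(2)[OF h h' solution_distance_bound[OF h h'], of T] T_pos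
  by (simp add: algebra_simps)

text \<open>
The Picard map in position space, \<open>q \<mapsto> x + t v - \<integral>\<integral> \<nabla>U(q)\<close>, is a contraction with constant \<open>L T\<^sup>2 / 2 \<le> 1/8\<close>
on the whole interval, so Banach's theorem applies without subdividing \<open>[0, T]\<close>.
\<close>

lemma solution_exists: "\<exists>q p. hamiltonian_solution U T x v q p"
proof -
  \<comment> \<open>Clamping the time to \<open>[0, T]\<close> lets the map act on bounded continuous functions on the whole line.\<close>
  define c where "c t = max 0 (min t T)" for t
  have c: "c t \<in> {0..T}" "continuous_on A c" for t A
    using T_pos by (auto simp: c_def[abs_def] intro!: continuous_intros)
  have c_id: "c t = t" if "t \<in> {0..T}" for t using that by (auto simp: c_def)
  define P where "P q t = v - integral {0..t} (\<lambda>s. gradient U (apply_bcontfun q s))"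
    for q :: "real \<Rightarrow>\<^sub>C 'a" and t
  define Q where "Q q t = x + integral {0..t} (P q)" for q t
  have dP: "(P q has_vector_derivative - gradient U (apply_bcontfun q t)) (at t within {0..T})"
    if "t \<in> {0..T}" for q t
  proof -
    have "continuous_on {0..T} (\<lambda>s. gradient U (apply_bcontfun q s))"
      by (rule continuous_on_compose2[OF gradient_continuous[of UNIV]]) auto
    from integral_has_vector_derivative[OF this that] show ?thesis
      unfolding P_def[abs_def] by (auto intro!: derivative_eq_intros)
  qed
  then have P_cont: "continuous_on {0..T} (P q)" for q
    by (rule continuous_on_of_has_vector_derivative)
  have dQ: "(Q q has_vector_derivative P q t) (at t within {0..T})" if "t \<in> {0..T}" for q t
    using integral_has_vector_derivative[OF P_cont[of q] that]
    unfolding Q_def[abs_def] by (auto intro!: derivative_eq_intros)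
  then have Q_cont: "continuous_on {0..T} (Q q)" for q
    by (rule continuous_on_of_has_vector_derivative)
  have Q_b: "(\<lambda>t. Q q (c t)) \<in> bcontfun" for q
  proof -
    have "bounded (Q q ` {0..T})"
      using Q_cont by (intro compact_imp_bounded compact_continuous_image) auto
    then obtain B where B: "\<forall>y\<in>Q q ` {0..T}. norm y \<le> B"
      unfolding bounded_iff by blast
    have "continuous_on UNIV (\<lambda>t. Q q (c t))"
      using c by (intro continuous_on_compose2[OF Q_cont]) auto
    then show ?thesis
      using B c(1) by (intro bcontfun_normI[where b = B]) auto
  qed
  define F where "F q = Bcontfun (\<lambda>t. Q q (c t))" for q
  have F: "apply_bcontfun (F q) t = Q q (c t)" for q t
    using Q_b by (simp add: F_def Bcontfun_inverse)
  have "dist (F q) (F q') \<le> 1 / 8 * dist q q'" for q q'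
  proof (rule dist_bound)
    fix r
    define t where "t = c r"
    have t: "t \<in> {0..T}" using c by (simp add: t_def)
    let ?D = "dist q q'"
    have nP: "norm ((P q s - P q' s) - (P q 0 - P q' 0)) \<le> L * ?D * s - L * ?D * 0" if s: "s \<in> {0..T}" for s
    proof (rule norm_increment_le_of_deriv_le[where \<phi>' = "\<lambda>_. L * ?D"])
      fix u assume u: "u \<in> {0..s}"
      have "(P q has_vector_derivative - gradient U (apply_bcontfun q u)) (at u within {0..s})" for q
        using dP[of u q] u s by (auto intro: has_vector_derivative_within_subset)
      then show "((\<lambda>u. P q u - P q' u) has_vector_derivative - gradient U (apply_bcontfun q u) - - gradient U (apply_bcontfun q' u)) (at u within {0..s})"
        by (intro has_vector_derivative_diff)
      have "norm (- gradient U (apply_bcontfun q u) - - gradient U (apply_bcontfun q' u)) \<le> L * norm (apply_bcontfun q u - apply_bcontfun q' u)"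
        using lip[of "apply_bcontfun q u" "apply_bcontfun q' u"] by (simp add: norm_minus_commute)
      also have "\<dots> \<le> L * ?D"
        using dist_bounded[of q u q'] L_pos by (auto simp: dist_norm)
      finally show "norm (- gradient U (apply_bcontfun q u) - - gradient U (apply_bcontfun q' u)) \<le> L * ?D" .
      show "((*) (L * ?D) has_vector_derivative L * ?D) (at u within {0..s})"
        by (auto intro!: derivative_eq_intros simp: has_vector_derivative_def)
    qed (use s in auto)
    have "norm ((Q q t - Q q' t) - (Q q 0 - Q q' 0)) \<le> L * ?D * t\<^sup>2 / 2 - L * ?D * 0\<^sup>2 / 2"
    proof (rule norm_increment_le_of_deriv_le[where \<phi>' = "\<lambda>s. L * ?D * s"])
      fix u assume u: "u \<in> {0..t}"
      have "(Q q has_vector_derivative P q u) (at u within {0..t})" for q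
        using dQ[of u q] u t by (auto intro: has_vector_derivative_within_subset)
      then show "((\<lambda>u. Q q u - Q q' u) has_vector_derivative P q u - P q' u) (at u within {0..t})"
        by (intro has_vector_derivative_diff)
      show "norm (P q u - P q' u) \<le> L * ?D * u"
        using nP[of u] u t by (simp add: P_def)
      have "((\<lambda>s. L * ?D * s\<^sup>2 / 2) has_real_derivative L * ?D * u) (at u within {0..t})"
        by (auto intro!: derivative_eq_intros)
      then show "((\<lambda>s. L * ?D * s\<^sup>2 / 2) has_vector_derivative L * ?D * u) (at u within {0..t})"
        by (simp add: has_real_derivative_iff_has_vector_derivative)
    qed (use t in auto)
    then have "dist (Q q t) (Q q' t) \<le> L * t\<^sup>2 * ?D / 2"
      by (simp add: Q_def dist_norm mult_ac)
    also have "L * t\<^sup>2 * ?D / 2 \<le> 1 / 8 * ?D"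
    proof -
      have "L * t\<^sup>2 \<le> L * T\<^sup>2" using t L_pos by (intro mult_left_mono power_mono) auto
      then have "L * t\<^sup>2 \<le> 1 / 4" using LT by simp
      then have "(L * t\<^sup>2) * ?D \<le> 1 / 4 * ?D" by (intro mult_right_mono) auto
      then show ?thesis by (simp add: mult_ac)
    qed
    finally show "dist (apply_bcontfun (F q) r) (apply_bcontfun (F q') r) \<le> 1 / 8 * ?D"
      by (simp add: F t_def)
  qed
  then obtain q where "F q = q"
    using banach_fix_type[of "1/8" F] by auto
  then have q: "apply_bcontfun q t = Q q t" if "t \<in> {0..T}" for t
    using F[of q t] c_id[OF that] by simp
  have "hamiltonian_solution U T x v (Q q) (P q)"
    unfolding hamiltonian_solution_def
  proof (intro conjI ballI)
    show "Q q 0 = x" "P q 0 = v" by (simp_all add: Q_def P_def)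
    fix t assume t: "t \<in> {0..T}"
    show "(Q q has_vector_derivative P q t) (at t within {0..T})" by (rule dQ[OF t])
    show "(P q has_vector_derivative - gradient U (Q q t)) (at t within {0..T})"
      using dP[OF t, of q] q[OF t] by simp
  qed
  then show ?thesis by blast
qed

lemma hmc_position_eq:
  assumes "hamiltonian_solution U T x v q p"
  shows "hmc_position U T x v = q T"
  unfolding hmc_position_def
proof (rule the_equality)
  show "\<exists>q' p'. hamiltonian_solution U T x v q' p' \<and> q' T = q T"
    using assms by blast
next
  fix y assume "\<exists>q' p'. hamiltonian_solution U T x v q' p' \<and> q' T = y"
  then obtain q' p' where "hamiltonian_solution U T x v q' p'" "y = q' T" by blast
  with solution_endpoint_bound[OF this(1) assms] show "y = q T" by simp
qed

lemma hmc_position_endpoint_bound: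
  "norm ((hmc_position U T x v - hmc_position U T x' v') - ((x - x') + T *\<^sub>R (v - v')))
    \<le> 4 / 7 * (L * T\<^sup>2) * max (norm (x - x')) (norm (x - x' + T *\<^sub>R (v - v')))"
proof -
  obtain q p q' p' where "hamiltonian_solution U T x v q p" "hamiltonian_solution U T x' v' q' p'"
    using solution_exists by meson
  from solution_endpoint_bound[OF this] hmc_position_eq[OF this(1)] hmc_position_eq[OF this(2)]
  show ?thesis by simp
qed

lemma hmc_position_bound:
  "norm (hmc_position U T x v - hmc_position U T x' v')
    \<le> 8 / 7 * max (norm (x - x')) (norm (x - x' + T *\<^sub>R (v - v')))"
proof -
  obtain q p q' p' where "hamiltonian_solution U T x v q p" "hamiltonian_solution U T x' v' q' p'"
    using solution_exists by meson
  from solution_distance_bound[OF this, of T] hmc_position_eq[OF this(1)] hmc_position_eq[OF this(2)]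
  show ?thesis using T_pos by simp
qed

lemma hmc_position_continuous: "continuous_on UNIV (\<lambda>z. hmc_position U T (fst z) (snd z))"
proof -
  have "((\<lambda>y. hmc_position U T (fst y) (snd y)) \<longlongrightarrow> hmc_position U T (fst z) (snd z)) (at z)" for z
  proof -
    let ?B = "\<lambda>y. 8 / 7 * max (norm (fst y - fst z)) (norm (fst y - fst z + T *\<^sub>R (snd y - snd z)))"
    have "(?B \<longlongrightarrow> 8 / 7 * max (norm (fst z - fst z)) (norm (fst z - fst z + T *\<^sub>R (snd z - snd z)))) (at z)"
      by (intro tendsto_intros)
    then have B: "(?B \<longlongrightarrow> 0) (at z)" by simp
    have "((\<lambda>y. hmc_position U T (fst y) (snd y) - hmc_position U T (fst z) (snd z)) \<longlongrightarrow> 0) (at z)"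
      by (rule Lim_null_comparison[OF _ B], rule always_eventually, rule allI, rule hmc_position_bound)
    then show ?thesis by (rule LIM_zero_cancel)
  qed
  then show ?thesis by (simp add: continuous_on_def)
qed

lemma hmc_position_measurable [measurable]:
  assumes [measurable]: "f \<in> borel_measurable M" "g \<in> borel_measurable M"
  shows "(\<lambda>z. hmc_position U T (f z) (g z)) \<in> borel_measurable M"
proof -
  have "(\<lambda>z. hmc_position U T (fst z) (snd z)) \<in> borel_measurable (borel :: ('a \<times> 'a) measure)"
    by (rule borel_measurable_continuous_onI[OF hmc_position_continuous])
  then have [measurable]: "(\<lambda>z. hmc_position U T (fst z) (snd z)) \<in> borel_measurable (borel \<Otimes>\<^sub>M borel)"
    by (simp add: borel_prod)
  have "(\<lambda>z. hmc_position U T (fst (f z, g z)) (snd (f z, g z))) \<in> borel_measurable M"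
    by (rule measurable_compose[where f = "\<lambda>z. (f z, g z)"]) measurable
  then show ?thesis by simp
qed

text \<open>
For equal initial velocities the distance stays above \<open>6/7\<close> of its initial value and hence outside the ball where
convexity may fail.  There \<open>(z \<bullet> w)' = |w|\<^sup>2 - z \<bullet> (\<nabla>U(q) - \<nabla>U(q'))\<close>, in which the first term is
\<open>O(L\<^sup>2 t\<^sup>2)\<close> and the second at least \<open>36/49 K r\<^sup>2\<close>.  Integrating twice and using \<open>L\<^sup>2 T\<^sup>2 \<le> K\<close> leaves the
coefficient \<open>32/147 - 36/49 < - 1/2\<close> of \<open>K T\<^sup>2 r\<^sup>2\<close>.
\<close>

lemma convex_contraction:
  assumes h: "hamiltonian_solution U T x v q p" and h': "hamiltonian_solution U T x' v q' p'"
    and K: "0 < K" "L * T\<^sup>2 \<le> K / L"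
    and cvx: "\<And>y y'. norm (y - y') \<ge> R \<Longrightarrow>
        (y - y') \<bullet> (gradient U y - gradient U y') \<ge> K * (norm (y - y'))\<^sup>2"
    and far: "7 * R \<le> 6 * norm (x - x')"
  shows "(norm (q T - q' T))\<^sup>2 \<le> (1 - K * T\<^sup>2 / 2) * (norm (x - x'))\<^sup>2"
proof -
  define r where "r = norm (x - x')"
  define z where "z t = q t - q' t" for t
  define w where "w t = p t - p' t" for t
  define g where "g t = gradient U (q t) - gradient U (q' t)" for t
  have init: "z 0 = x - x'" "w 0 = 0"
    using h h' by (auto simp: hamiltonian_solution_def z_def w_def)
  have dz: "(z has_vector_derivative w t) (at t within {0..T})"
    and dw: "(w has_vector_derivative - g t) (at t within {0..T})" if "t \<in> {0..T}" for t
    using h h' that unfolding hamiltonian_solution_def z_def[abs_def] w_def[abs_def] g_def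
    by (auto intro!: derivative_eq_intros)
  have S: "norm (q t - q' t) \<le> 8 / 7 * r" if "t \<in> {0..T}" for t
    using solution_distance_bound[OF h h' that] by (simp add: r_def)
  have w_le: "norm (w t) \<le> 8 / 7 * L * r * t" if "t \<in> {0..T}" for t
    using solution_difference_bound(1)[OF h h' S that] by (simp add: w_def)
  have z_ge: "6 / 7 * r \<le> norm (z t)" if t: "t \<in> {0..T}" for t
  proof -
    have "norm (z t - (x - x')) \<le> L * (8 / 7 * r) * t\<^sup>2 / 2"
      using solution_difference_bound(2)[OF h h' S that] by (simp add: z_def)
    also have "L * (8 / 7 * r) * t\<^sup>2 / 2 = 4 / 7 * r * (L * t\<^sup>2)" by simp
    also have "\<dots> \<le> 4 / 7 * r * (1 / 4)"
    proof (rule mult_left_mono)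
      have "L * t\<^sup>2 \<le> L * T\<^sup>2" using t L_pos by (intro mult_left_mono power_mono) auto
      then show "L * t\<^sup>2 \<le> 1 / 4" using LT by simp
    qed (simp add: r_def)
    finally have "norm (z t - (x - x')) \<le> r / 7" by simp
    moreover have "r \<le> norm (z t) + norm (z t - (x - x'))"
      unfolding r_def by (metis norm_minus_commute norm_triangle_sub)
    ultimately show ?thesis by linarith
  qed
  have LT2: "L\<^sup>2 * T\<^sup>2 \<le> K"
    using K L_pos by (simp add: field_simps power2_eq_square)
  have zg: "36 / 49 * K * r\<^sup>2 \<le> z t \<bullet> g t" if t: "t \<in> {0..T}" for t
  proof -
    have "R \<le> norm (z t)" using z_ge[OF t] far by (simp add: r_def)
    then have "K * (norm (z t))\<^sup>2 \<le> z t \<bullet> g t"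
      using cvx[of "q t" "q' t"] by (simp add: z_def g_def)
    moreover have "(6 / 7 * r)\<^sup>2 \<le> (norm (z t))\<^sup>2"
      using z_ge[OF t] by (intro power_mono) (auto simp: r_def)
    then have "K * (6 / 7 * r)\<^sup>2 \<le> K * (norm (z t))\<^sup>2"
      using K by (intro mult_left_mono) auto
    ultimately show ?thesis by (simp add: power2_eq_square)
  qed
  have zw: "z t \<bullet> w t \<le> 64 / 147 * L\<^sup>2 * r\<^sup>2 * t ^ 3 - 36 / 49 * K * r\<^sup>2 * t" if t: "t \<in> {0..T}" for t
  proof -
    have "z t \<bullet> w t - z 0 \<bullet> w 0 \<le> (64 / 147 * L\<^sup>2 * r\<^sup>2 * t ^ 3 - 36 / 49 * K * r\<^sup>2 * t)
        - (64 / 147 * L\<^sup>2 * r\<^sup>2 * 0 ^ 3 - 36 / 49 * K * r\<^sup>2 * 0)"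
    proof (rule increment_le_of_deriv_le[where f' = "\<lambda>s. z s \<bullet> (- g s) + w s \<bullet> w s"
          and g' = "\<lambda>s. 64 / 49 * L\<^sup>2 * r\<^sup>2 * s\<^sup>2 - 36 / 49 * K * r\<^sup>2"])
      fix s assume s: "s \<in> {0..t}"
      have sub: "{0..t} \<subseteq> {0..T}" "s \<in> {0..T}" using t s by auto
      show "((\<lambda>s. z s \<bullet> w s) has_vector_derivative z s \<bullet> (- g s) + w s \<bullet> w s) (at s within {0..t})"
        by (rule bounded_bilinear.has_vector_derivative[OF bounded_bilinear_inner])
          (use dz[OF sub(2)] dw[OF sub(2)] sub(1) in \<open>auto intro: has_vector_derivative_within_subset\<close>)
      show "((\<lambda>s. 64 / 147 * L\<^sup>2 * r\<^sup>2 * s ^ 3 - 36 / 49 * K * r\<^sup>2 * s) has_vector_derivative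
          64 / 49 * L\<^sup>2 * r\<^sup>2 * s\<^sup>2 - 36 / 49 * K * r\<^sup>2) (at s within {0..t})"
        unfolding has_real_derivative_iff_has_vector_derivative[symmetric]
        by (auto intro!: derivative_eq_intros)
      have "w s \<bullet> w s \<le> (8 / 7 * L * r * s)\<^sup>2"
        unfolding power2_norm_eq_inner[symmetric] using w_le[OF sub(2)] by (intro power_mono) auto
      then show "z s \<bullet> (- g s) + w s \<bullet> w s \<le> 64 / 49 * L\<^sup>2 * r\<^sup>2 * s\<^sup>2 - 36 / 49 * K * r\<^sup>2"
        using zg[OF sub(2)] by (simp add: field_simps power2_eq_square)
    qed (use t in auto)
    then show ?thesis by (simp add: init)
  qed
  have "z T \<bullet> z T - z 0 \<bullet> z 0 \<le> (32 / 147 * L\<^sup>2 * r\<^sup>2 * T ^ 4 - 36 / 49 * K * r\<^sup>2 * T\<^sup>2)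
        - (32 / 147 * L\<^sup>2 * r\<^sup>2 * 0 ^ 4 - 36 / 49 * K * r\<^sup>2 * 0\<^sup>2)"
  proof (rule increment_le_of_deriv_le[where f' = "\<lambda>s. z s \<bullet> w s + w s \<bullet> z s"
          and g' = "\<lambda>s. 2 * (64 / 147 * L\<^sup>2 * r\<^sup>2 * s ^ 3 - 36 / 49 * K * r\<^sup>2 * s)"])
    fix s assume s: "s \<in> {0..T}"
    show "((\<lambda>s. z s \<bullet> z s) has_vector_derivative z s \<bullet> w s + w s \<bullet> z s) (at s within {0..T})"
      by (rule bounded_bilinear.has_vector_derivative[OF bounded_bilinear_inner dz[OF s] dz[OF s]])
    show "((\<lambda>s. 32 / 147 * L\<^sup>2 * r\<^sup>2 * s ^ 4 - 36 / 49 * K * r\<^sup>2 * s\<^sup>2) has_vector_derivative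
        2 * (64 / 147 * L\<^sup>2 * r\<^sup>2 * s ^ 3 - 36 / 49 * K * r\<^sup>2 * s)) (at s within {0..T})"
      unfolding has_real_derivative_iff_has_vector_derivative[symmetric]
      by (auto intro!: derivative_eq_intros)
    show "z s \<bullet> w s + w s \<bullet> z s \<le> 2 * (64 / 147 * L\<^sup>2 * r\<^sup>2 * s ^ 3 - 36 / 49 * K * r\<^sup>2 * s)"
      using zw[OF s] by (simp add: inner_commute)
  qed (use T_pos in auto)
  then have "(norm (z T))\<^sup>2 \<le> r\<^sup>2 + 32 / 147 * L\<^sup>2 * r\<^sup>2 * T ^ 4 - 36 / 49 * K * r\<^sup>2 * T\<^sup>2"
    by (simp add: power2_norm_eq_inner init r_def)
  also have "32 / 147 * L\<^sup>2 * r\<^sup>2 * T ^ 4 = 32 / 147 * r\<^sup>2 * T\<^sup>2 * (L\<^sup>2 * T\<^sup>2)"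
    by (simp add: eval_nat_numeral)
  also have "\<dots> \<le> 32 / 147 * r\<^sup>2 * T\<^sup>2 * K"
    using LT2 by (intro mult_left_mono) auto
  also have "r\<^sup>2 + 32 / 147 * r\<^sup>2 * T\<^sup>2 * K - 36 / 49 * K * r\<^sup>2 * T\<^sup>2 = (1 - K * T\<^sup>2 / 2) * r\<^sup>2 - 5 / 294 * (K * T\<^sup>2 * r\<^sup>2)"
    by (simp add: algebra_simps)
  also have "\<dots> \<le> (1 - K * T\<^sup>2 / 2) * r\<^sup>2" using K by simp
  finally show ?thesis by (simp add: z_def r_def)
qed

lemma hmc_position_convex_contraction:
  assumes K: "0 < K" "L * T\<^sup>2 \<le> K / L"
    and cvx: "\<And>y y'. norm (y - y') \<ge> R \<Longrightarrow>
        (y - y') \<bullet> (gradient U y - gradient U y') \<ge> K * (norm (y - y'))\<^sup>2"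
    and far: "7 * R \<le> 6 * norm (x - x')"
  shows "norm (hmc_position U T x v - hmc_position U T x' v) \<le> (1 - K * T\<^sup>2 / 4) * norm (x - x')"
proof -
  obtain q p q' p' where h: "hamiltonian_solution U T x v q p" "hamiltonian_solution U T x' v q' p'"
    using solution_exists by meson
  let ?r = "norm (x - x')"
  have sq: "(norm (q T - q' T))\<^sup>2 \<le> (1 - K * T\<^sup>2 / 2) * ?r\<^sup>2"
    by (rule convex_contraction[OF h K cvx far])
  \<comment> \<open>The square root below needs a nonnegative factor; otherwise the bound on the square forces \<open>x = x'\<close>.\<close>
  have "?r = 0 \<or> K * T\<^sup>2 \<le> 2"
  proof (rule disjCI)
    assume "\<not> K * T\<^sup>2 \<le> 2"
    then have neg: "1 - K * T\<^sup>2 / 2 < 0" by simp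
    have "0 \<le> (1 - K * T\<^sup>2 / 2) * ?r\<^sup>2" using sq by (meson order_trans zero_le_power2)
    with neg have "?r\<^sup>2 \<le> 0" by (simp add: zero_le_mult_iff)
    then show "?r = 0" by simp
  qed
  then show ?thesis
  proof
    assume "?r = 0"
    then show ?thesis by simp
  next
    assume KT: "K * T\<^sup>2 \<le> 2"
    have "(1 - K * T\<^sup>2 / 2) \<le> (1 - K * T\<^sup>2 / 4)\<^sup>2"
    proof -
      have "(1 - u / 4)\<^sup>2 = (1 - u / 2) + (u / 4)\<^sup>2" for u :: real
        by (simp add: power2_eq_square field_simps)
      from this[of "K * T\<^sup>2"] show ?thesis by simp
    qed
    then have "(1 - K * T\<^sup>2 / 2) * ?r\<^sup>2 \<le> ((1 - K * T\<^sup>2 / 4) * ?r)\<^sup>2"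
      unfolding power_mult_distrib by (rule mult_right_mono) simp
    with sq have "(norm (q T - q' T))\<^sup>2 \<le> ((1 - K * T\<^sup>2 / 4) * ?r)\<^sup>2" by linarith
    then have "norm (q T - q' T) \<le> (1 - K * T\<^sup>2 / 4) * ?r"
      by (rule power2_le_imp_le) (use KT in simp)
    then show ?thesis by (simp add: hmc_position_eq[OF h(1)] hmc_position_eq[OF h(2)])
  qed
qed

end

section \<open>Reflections preserve Lebesgue measure\<close>

lemma nn_integral_lborel_translate:
  fixes f :: "'a::euclidean_space \<Rightarrow> ennreal"
  assumes [measurable]: "f \<in> borel_measurable borel"
  shows "(\<integral>\<^sup>+ x. f (x + c) \<partial>lborel) = (\<integral>\<^sup>+ x. f x \<partial>lborel)"
proof -
  have "(\<integral>\<^sup>+ x. f x \<partial>lborel) = (\<integral>\<^sup>+ x. f x \<partial>distr lborel borel ((+) c))"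
    by (simp only: lborel_distr_plus)
  also have "\<dots> = (\<integral>\<^sup>+ x. f (c + x) \<partial>lborel)"
    by (subst nn_integral_distr) auto
  finally show ?thesis by (simp add: add.commute)
qed

text \<open>
The reflection in the hyperplane orthogonal to \<open>h\<close>; division by zero makes it the identity for \<open>h = 0\<close>.
\<close>

definition reflect :: "'a::euclidean_space \<Rightarrow> 'a \<Rightarrow> 'a" where
  "reflect h x = x - (2 * (x \<bullet> h) / (h \<bullet> h)) *\<^sub>R h"

lemma reflect_inner: "reflect h x \<bullet> h = - (x \<bullet> h)"
  by (cases "h = 0") (simp_all add: reflect_def inner_diff_left)

lemma reflect_reflect: "reflect h (reflect h x) = x"
proof -
  have "reflect h (reflect h x) = reflect h x - (2 * (reflect h x \<bullet> h) / (h \<bullet> h)) *\<^sub>R h"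
    by (simp only: reflect_def[of h "reflect h x"])
  then show ?thesis by (simp add: reflect_inner) (simp add: reflect_def)
qed

lemma reflect_add: "reflect h (x + y) = reflect h x + reflect h y"
  by (simp add: reflect_def inner_add_left add_divide_distrib distrib_left scaleR_left_distrib)

lemma reflect_self: "reflect h h = - h"
proof (cases "h = 0")
  case False
  then have "reflect h h = h - 2 *\<^sub>R h" by (simp add: reflect_def)
  also have "\<dots> = - h" by (simp add: scaleR_2)
  finally show ?thesis .
qed (simp add: reflect_def)

lemma norm_reflect: "norm (reflect h x) = norm x"
proof -
  have "reflect h x \<bullet> reflect h x = x \<bullet> x"
    by (cases "h = 0") (simp_all add: reflect_def inner_diff_left inner_diff_right inner_commute)
  then show ?thesis by (simp add: norm_eq_sqrt_inner)
qed

lemma reflect_measurable [measurable]: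
  assumes [measurable]: "f \<in> borel_measurable M" "g \<in> borel_measurable M"
  shows "(\<lambda>z. reflect (f z) (g z)) \<in> borel_measurable M"
  unfolding reflect_def by measurable

text \<open>
Uniqueness of Haar measure, specialised.  The image \<open>m\<close> of Lebesgue measure \<open>\<lambda>\<close> is translation invariant, so two
applications of Fubini's theorem to \<open>1\<^sub>A(x + y) 1\<^sub>B(y)\<close> give \<open>m(A) \<lambda>(B) = \<lambda>(A) m(- B)\<close>.  For the unit ball \<open>B\<close>
one has \<open>m(- B) = \<lambda>(B)\<close>, because a reflection preserves the norm, and this number cancels.
\<close>

lemma distr_lborel_reflect:
  fixes h :: "'a::euclidean_space"
  shows "distr lborel borel (reflect h) = (lborel :: 'a measure)"
proof (rule measure_eqI)
  fix A :: "'a set" assume "A \<in> sets (distr lborel borel (reflect h))"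
  then have [measurable]: "A \<in> sets borel" by simp
  define B where "B = (indicator (ball 0 1) :: 'a \<Rightarrow> ennreal)"
  define V where "V = emeasure lborel (ball 0 1 :: 'a set)"
  have [measurable]: "B \<in> borel_measurable borel"
    unfolding B_def by (rule borel_measurable_indicator) simp
  have B_cong: "B x = B y" if "norm x = norm y" for x y
    using that by (simp add: B_def indicator_def)
  have B_int: "(\<integral>\<^sup>+ y. B y \<partial>lborel) = V" by (simp add: B_def V_def)
  have V: "V \<noteq> 0" "V \<noteq> \<infinity>"
    using emeasure_lborel_ball_finite[of "0::'a" 1] content_ball_pos[of 1 "0::'a"]
    by (auto simp: V_def measure_def)
  have "emeasure (distr lborel borel (reflect h)) A * V
      = (\<integral>\<^sup>+ x. indicator A (reflect h x) \<partial>lborel) * (\<integral>\<^sup>+ y. B y \<partial>lborel)"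
  proof -
    have "emeasure (distr lborel borel (reflect h)) A = (\<integral>\<^sup>+ x. indicator A x \<partial>distr lborel borel (reflect h))"
      by (rule nn_integral_indicator[symmetric]) simp
    also have "\<dots> = (\<integral>\<^sup>+ x. indicator A (reflect h x) \<partial>lborel)"
      by (rule nn_integral_distr) measurable
    finally show ?thesis by (simp only: B_int)
  qed
  also have "\<dots> = (\<integral>\<^sup>+ y. (\<integral>\<^sup>+ x. indicator A (reflect h x) \<partial>lborel) * B y \<partial>lborel)"
    by (rule nn_integral_cmult[symmetric]) measurable
  also have "\<dots> = (\<integral>\<^sup>+ y. \<integral>\<^sup>+ x. indicator A (reflect h x) * B y \<partial>lborel \<partial>lborel)"
    by (intro nn_integral_cong nn_integral_multc[symmetric]) measurable
  also have "\<dots> = (\<integral>\<^sup>+ y. \<integral>\<^sup>+ x. indicator A (reflect h x + y) * B y \<partial>lborel \<partial>lborel)"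
  proof (rule nn_integral_cong)
    show "(\<integral>\<^sup>+ x. indicator A (reflect h x) * B y \<partial>lborel)
        = (\<integral>\<^sup>+ x. indicator A (reflect h x + y) * B y \<partial>lborel)" for y
      using nn_integral_lborel_translate[of "\<lambda>x. indicator A (reflect h x) * B y" "reflect h y"]
      by (simp add: reflect_add reflect_reflect)
  qed
  also have "\<dots> = (\<integral>\<^sup>+ x. \<integral>\<^sup>+ y. indicator A (reflect h x + y) * B y \<partial>lborel \<partial>lborel)"
    by (rule lborel_pair.Fubini') measurable
  also have "\<dots> = (\<integral>\<^sup>+ x. \<integral>\<^sup>+ y. indicator A y * B (y - reflect h x) \<partial>lborel \<partial>lborel)"
  proof (rule nn_integral_cong)
    show "(\<integral>\<^sup>+ y. indicator A (reflect h x + y) * B y \<partial>lborel)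
        = (\<integral>\<^sup>+ y. indicator A y * B (y - reflect h x) \<partial>lborel)" for x
      using nn_integral_lborel_translate[of "\<lambda>y. indicator A y * B (y - reflect h x)" "reflect h x"]
      by (simp add: add.commute)
  qed
  also have "\<dots> = (\<integral>\<^sup>+ y. \<integral>\<^sup>+ x. indicator A y * B (y - reflect h x) \<partial>lborel \<partial>lborel)"
    by (rule lborel_pair.Fubini') measurable
  also have "\<dots> = (\<integral>\<^sup>+ y. indicator A y * V \<partial>lborel)"
  proof (rule nn_integral_cong)
    fix y
    have "B (y - reflect h x) = B (x + - reflect h y)" for x
    proof (rule B_cong)
      have "norm (y - reflect h x) = norm (reflect h (y + (- 1) *\<^sub>R reflect h x))"
        by (simp add: norm_reflect)
      also have "\<dots> = norm (reflect h y - x)"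
        using reflect_add[of h "y - reflect h x" "reflect h x"] by (simp add: reflect_reflect algebra_simps)
      finally show "norm (y - reflect h x) = norm (x + - reflect h y)"
        by (simp add: norm_minus_commute)
    qed
    then have "(\<integral>\<^sup>+ x. B (y - reflect h x) \<partial>lborel) = V"
      using nn_integral_lborel_translate[of B "- reflect h y"] B_int by simp
    then show "(\<integral>\<^sup>+ x. indicator A y * B (y - reflect h x) \<partial>lborel) = indicator A y * V"
      by (subst nn_integral_cmult) auto
  qed
  also have "\<dots> = emeasure lborel A * V"
    by (subst nn_integral_multc) auto
  finally show "emeasure (distr lborel borel (reflect h)) A = emeasure lborel A"
    using V ennreal_mult_cancel_left[of V] by (simp add: mult.commute[of _ V])
qed simp

lemma nn_integral_lborel_reflect:
  fixes f :: "'a::euclidean_space \<Rightarrow> ennreal"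
  assumes [measurable]: "f \<in> borel_measurable borel"
  shows "(\<integral>\<^sup>+ x. f (reflect h x) \<partial>lborel) = (\<integral>\<^sup>+ x. f x \<partial>lborel)"
proof -
  have "(\<integral>\<^sup>+ x. f x \<partial>lborel) = (\<integral>\<^sup>+ x. f x \<partial>distr lborel borel (reflect h))"
    by (simp only: distr_lborel_reflect)
  also have "\<dots> = (\<integral>\<^sup>+ x. f (reflect h x) \<partial>lborel)"
    by (subst nn_integral_distr) auto
  finally show ?thesis by simp
qed

section \<open>The standard Gaussian measure\<close>

definition gauss_density :: "'a::euclidean_space \<Rightarrow> real" where
  "gauss_density v = (2 * pi) powr (- real DIM('a) / 2) * exp (- (norm v)\<^sup>2 / 2)"

lemma gauss_density_nonneg: "0 \<le> gauss_density v"
  by (simp add: gauss_density_def)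

lemma gauss_density_measurable [measurable]: "gauss_density \<in> borel_measurable borel"
  unfolding gauss_density_def[abs_def] by measurable

lemma std_gaussian_eq: "std_gaussian = density lborel (\<lambda>v. ennreal (gauss_density v))"
  by (simp add: std_gaussian_def gauss_density_def)

lemma sets_std_gaussian [measurable_cong, simp]: "sets std_gaussian = sets borel"
  by (simp add: std_gaussian_def)

lemma space_std_gaussian [simp]: "space std_gaussian = UNIV"
  by (simp add: std_gaussian_def)

lemma nn_integral_std_gaussian:
  assumes [measurable]: "f \<in> borel_measurable borel"
  shows "(\<integral>\<^sup>+ v. f v \<partial>std_gaussian) = (\<integral>\<^sup>+ v. ennreal (gauss_density v) * f v \<partial>lborel)"
  unfolding std_gaussian_eq by (rule nn_integral_density) auto

text \<open>
The product form gives access to the one-dimensional normal density, for which the moments are known.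
\<close>

lemma gauss_density_product:
  "gauss_density v = (\<Prod>b\<in>Basis. std_normal_density (v \<bullet> b))" for v :: "'a::euclidean_space"
proof -
  have "(\<Prod>b\<in>Basis. std_normal_density (v \<bullet> b))
      = (1 / sqrt (2 * pi)) ^ DIM('a) * (\<Prod>b\<in>Basis. exp (- (v \<bullet> b)\<^sup>2 / 2))"
    by (simp add: std_normal_density_def prod_dividef power_one_over)
  also have "(\<Prod>b\<in>Basis. exp (- (v \<bullet> b)\<^sup>2 / 2)) = exp (- (norm v)\<^sup>2 / 2)"
  proof -
    have "(\<Sum>b\<in>Basis. - (v \<bullet> b)\<^sup>2 / 2) = - (v \<bullet> v) / 2"
      by (simp add: euclidean_inner[of v v] sum_negf sum_divide_distrib power2_eq_square)
    then show ?thesis by (simp add: exp_sum[symmetric] power2_norm_eq_inner)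
  qed
  also have "(1 / sqrt (2 * pi)) ^ DIM('a) = (2 * pi) powr (- real DIM('a) / 2)"
  proof -
    have "1 / sqrt (2 * pi) = (2 * pi) powr (- 1 / 2)"
      by (simp add: powr_minus_divide powr_half_sqrt)
    then have "(1 / sqrt (2 * pi)) ^ DIM('a) = ((2 * pi) powr (- 1 / 2)) powr real DIM('a)"
      by (simp add: powr_realpow)
    then show ?thesis by (simp add: powr_powr)
  qed
  finally show ?thesis by (simp add: gauss_density_def)
qed

lemma nn_integral_std_gaussian_coordinate:
  fixes b :: "'a::euclidean_space"
  assumes b: "b \<in> Basis" and [measurable]: "g \<in> borel_measurable borel"
  shows "(\<integral>\<^sup>+ v. g (v \<bullet> b) \<partial>std_gaussian) = (\<integral>\<^sup>+ s. ennreal (std_normal_density s) * g s \<partial>lborel)"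
proof -
  define F where "F b' s = ennreal (std_normal_density s) * (if b' = b then g s else 1)" for b' :: 'a and s
  have [measurable]: "F b' \<in> borel_measurable borel" for b'
    unfolding F_def[abs_def] by (cases "b' = b") auto
  have total: "(\<integral>\<^sup>+ s. ennreal (std_normal_density s) \<partial>lborel) = 1"
  proof -
    interpret prob_space "density lborel (\<lambda>x. ennreal (std_normal_density x))"
      by (rule prob_space_normal_density) simp
    show ?thesis using emeasure_space_1 by (simp add: emeasure_density)
  qed
  have "(\<integral>\<^sup>+ v. g (v \<bullet> b) \<partial>std_gaussian) = (\<integral>\<^sup>+ v. (\<Prod>b'\<in>Basis. F b' (v \<bullet> b')) \<partial>lborel)"
  proof (subst nn_integral_std_gaussian)
    have "ennreal (gauss_density v) * g (v \<bullet> b) = (\<Prod>b'\<in>Basis. F b' (v \<bullet> b'))" for v :: 'a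
    proof -
      have "(\<Prod>b'\<in>Basis. F b' (v \<bullet> b')) = (\<Prod>b'\<in>Basis. ennreal (std_normal_density (v \<bullet> b')))
          * (\<Prod>b'\<in>Basis. if b' = b then g (v \<bullet> b) else 1)"
        unfolding prod.distrib[symmetric] by (intro prod.cong) (auto simp: F_def)
      also have "(\<Prod>b'\<in>Basis. if b' = b then g (v \<bullet> b) else 1) = g (v \<bullet> b)"
        using b by (subst prod.delta) auto
      finally show ?thesis by (simp add: gauss_density_product prod_ennreal)
    qed
    then show "(\<integral>\<^sup>+ v. ennreal (gauss_density v) * g (v \<bullet> b) \<partial>lborel) = (\<integral>\<^sup>+ v. (\<Prod>b'\<in>Basis. F b' (v \<bullet> b')) \<partial>lborel)"
      by simp
  qed measurable
  also have "\<dots> = (\<Prod>b'\<in>Basis. \<integral>\<^sup>+ s. F b' s \<partial>lborel)"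
    by (rule nn_integral_lborel_prod) auto
  also have "\<dots> = (\<Prod>b'\<in>Basis. if b' = b then \<integral>\<^sup>+ s. F b s \<partial>lborel else 1)"
    by (intro prod.cong) (auto simp: F_def total)
  also have "\<dots> = (\<integral>\<^sup>+ s. F b s \<partial>lborel)"
    using b by (simp add: prod.delta)
  finally show ?thesis by (simp add: F_def)
qed

lemma prob_space_std_gaussian: "prob_space (std_gaussian :: 'a::euclidean_space measure)"
proof
  obtain b :: 'a where b: "b \<in> Basis" using nonempty_Basis by blast
  interpret prob_space "density lborel (\<lambda>x. ennreal (std_normal_density x))"
    by (rule prob_space_normal_density) simp
  have "(\<integral>\<^sup>+ v. 1 \<partial>(std_gaussian :: 'a measure)) = 1"
    using nn_integral_std_gaussian_coordinate[OF b, of "\<lambda>_. 1"] emeasure_space_1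
    by (simp add: emeasure_density del: nn_integral_const)
  then show "emeasure (std_gaussian :: 'a measure) (space std_gaussian) = 1" by simp
qed

interpretation std_gaussian: prob_space "std_gaussian :: 'a::euclidean_space measure"
  by (rule prob_space_std_gaussian)

text \<open>
A reflection carries \<open>e\<close> to a vector of the standard basis, and both Lebesgue measure and the Gaussian density are
invariant under it; so every one-dimensional projection has the law of a coordinate.
\<close>

lemma nn_integral_std_gaussian_direction:
  fixes e :: "'a::euclidean_space"
  assumes e: "norm e = 1" and [measurable]: "g \<in> borel_measurable borel"
  shows "(\<integral>\<^sup>+ v. g (v \<bullet> e) \<partial>std_gaussian) = (\<integral>\<^sup>+ s. ennreal (std_normal_density s) * g s \<partial>lborel)"
proof -
  obtain b :: 'a where b: "b \<in> Basis" using nonempty_Basis by blast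
  define h where "h = e - b"
  have eq: "reflect h v \<bullet> b = v \<bullet> e" for v
  proof (cases "h = 0")
    case False
    have n: "e \<bullet> e = 1" "b \<bullet> b = 1"
      using e b by (simp_all add: norm_eq_1)
    have hh: "h \<bullet> h = - 2 * (h \<bullet> b)" using n by (simp add: h_def algebra_simps inner_commute)
    moreover have "h \<bullet> b \<noteq> 0" using hh False by auto
    ultimately have "2 * (v \<bullet> h) / (h \<bullet> h) * (h \<bullet> b) = - (v \<bullet> h)"
      by (simp add: field_simps)
    then have "reflect h v \<bullet> b = v \<bullet> b + v \<bullet> h"
      by (simp add: reflect_def inner_diff_left)
    then show ?thesis by (simp add: h_def inner_diff_right)
  qed (simp add: reflect_def h_def)
  have "(\<integral>\<^sup>+ v. g (v \<bullet> b) \<partial>std_gaussian) = (\<integral>\<^sup>+ v. ennreal (gauss_density v) * g (v \<bullet> b) \<partial>lborel)"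
    by (rule nn_integral_std_gaussian) measurable
  also have "\<dots> = (\<integral>\<^sup>+ v. ennreal (gauss_density (reflect h v)) * g (reflect h v \<bullet> b) \<partial>lborel)"
    by (rule nn_integral_lborel_reflect[symmetric]) measurable
  also have "\<dots> = (\<integral>\<^sup>+ v. ennreal (gauss_density v) * g (v \<bullet> e) \<partial>lborel)"
    unfolding eq by (simp add: gauss_density_def norm_reflect)
  also have "\<dots> = (\<integral>\<^sup>+ v. g (v \<bullet> e) \<partial>std_gaussian)"
    by (rule nn_integral_std_gaussian[symmetric]) measurable
  finally show ?thesis using nn_integral_std_gaussian_coordinate[OF b, of g] by simp
qed

text \<open>
The first and third moments of the positive part are half of those of the absolute value, since
\<open>2 (max 0 s)\<^sup>k = s\<^sup>k + |s|\<^sup>k\<close> for odd \<open>k\<close> and odd moments vanish.  The quadratic term keeps \<open>s\<^sup>2\<close> instead of \<open>(max 0 s)\<^sup>2\<close>.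
\<close>

lemma nn_integral_std_normal_cubic:
  assumes "0 \<le> A" "0 \<le> B" "0 \<le> C" "0 \<le> D"
  shows "(\<integral>\<^sup>+ s. ennreal (std_normal_density s) * ennreal (A + B * max 0 s + C * s\<^sup>2 + D * (max 0 s) ^ 3) \<partial>lborel)
    = ennreal (A + B * (sqrt (2 / pi) / 2) + C + D * sqrt (2 / pi))"
proof -
  let ?\<phi> = std_normal_density
  have m: "has_bochner_integral lborel ?\<phi> 1" "has_bochner_integral lborel (\<lambda>s. ?\<phi> s * s\<^sup>2) 1"
    "has_bochner_integral lborel (\<lambda>s. ?\<phi> s * s) 0" "has_bochner_integral lborel (\<lambda>s. ?\<phi> s * s ^ 3) 0"
    "has_bochner_integral lborel (\<lambda>s. ?\<phi> s * \<bar>s\<bar>) (sqrt (2 / pi))"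
    "has_bochner_integral lborel (\<lambda>s. ?\<phi> s * \<bar>s\<bar> ^ 3) (sqrt (2 / pi) * 2)"
    using std_normal_moment_even[of 0] std_normal_moment_even[of 1] std_normal_moment_odd[of 0]
      std_normal_moment_odd[of 1] std_normal_moment_abs_odd[of 0] std_normal_moment_abs_odd[of 1]
    by (simp_all add: numeral_eq_Suc)
  have "has_bochner_integral lborel (\<lambda>s. A * ?\<phi> s + (B / 2) * (?\<phi> s * s + ?\<phi> s * \<bar>s\<bar>) + C * (?\<phi> s * s\<^sup>2)
        + (D / 2) * (?\<phi> s * s ^ 3 + ?\<phi> s * \<bar>s\<bar> ^ 3))
      (A * 1 + (B / 2) * (0 + sqrt (2 / pi)) + C * 1 + (D / 2) * (0 + sqrt (2 / pi) * 2))"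
    by (intro has_bochner_integral_add has_bochner_integral_mult_right m)
  moreover have "A * ?\<phi> s + (B / 2) * (?\<phi> s * s + ?\<phi> s * \<bar>s\<bar>) + C * (?\<phi> s * s\<^sup>2)
        + (D / 2) * (?\<phi> s * s ^ 3 + ?\<phi> s * \<bar>s\<bar> ^ 3)
      = ?\<phi> s * (A + B * max 0 s + C * s\<^sup>2 + D * (max 0 s) ^ 3)" for s
    by (cases "0 \<le> s") (auto simp: algebra_simps max_def power3_eq_cube)
  ultimately have hb: "has_bochner_integral lborel (\<lambda>s. ?\<phi> s * (A + B * max 0 s + C * s\<^sup>2 + D * (max 0 s) ^ 3))
      (A + B * (sqrt (2 / pi) / 2) + C + D * sqrt (2 / pi))"
    by simp
  have "(\<integral>\<^sup>+ s. ennreal (?\<phi> s * (A + B * max 0 s + C * s\<^sup>2 + D * (max 0 s) ^ 3)) \<partial>lborel)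
      = ennreal (\<integral> s. ?\<phi> s * (A + B * max 0 s + C * s\<^sup>2 + D * (max 0 s) ^ 3) \<partial>lborel)"
    using assms hb by (intro nn_integral_eq_integral) (auto simp: has_bochner_integral_iff)
  also have "\<dots> = ennreal (A + B * (sqrt (2 / pi) / 2) + C + D * sqrt (2 / pi))"
    using hb by (simp add: has_bochner_integral_iff)
  finally show ?thesis
    by (simp only: ennreal_mult'[symmetric] normal_density_nonneg)
qed

section \<open>Coupling a Gaussian velocity with its translate\<close>

definition unit_uniform :: "real measure" where
  "unit_uniform = density lborel (\<lambda>u. indicator {0..1} u)"

lemma sets_unit_uniform [measurable_cong, simp]: "sets unit_uniform = sets borel"
  by (simp add: unit_uniform_def)

lemma space_unit_uniform [simp]: "space unit_uniform = UNIV"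
  by (simp add: unit_uniform_def)

lemma prob_space_unit_uniform: "prob_space unit_uniform"
  by standard (simp add: unit_uniform_def emeasure_density)

interpretation unit_uniform: prob_space unit_uniform
  by (rule prob_space_unit_uniform)

text \<open>
A uniform variable serves as an independent coin with success probability \<open>min 1 p\<close>.
\<close>

lemma nn_integral_unit_uniform_threshold:
  assumes "0 \<le> p"
  shows "(\<integral>\<^sup>+ u. (if u \<le> p then a else b) \<partial>unit_uniform) = ennreal (min 1 p) * a + ennreal (1 - min 1 p) * b"
proof -
  have "(\<integral>\<^sup>+ u. (if u \<le> p then a else b) \<partial>unit_uniform)
      = (\<integral>\<^sup>+ u. indicator {0..1} u * (if u \<le> p then a else b) \<partial>lborel)"
    unfolding unit_uniform_def by (rule nn_integral_density) auto
  also have "\<dots> = (\<integral>\<^sup>+ u. a * indicator {0..min 1 p} u + b * indicator {min 1 p<..1} u \<partial>lborel)"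
    using assms by (intro nn_integral_cong) (auto split: split_indicator)
  also have "\<dots> = a * ennreal (min 1 p) + b * ennreal (1 - min 1 p)"
    using assms by (subst nn_integral_add) (auto simp: nn_integral_cmult)
  finally show ?thesis by (simp add: mult.commute)
qed

text \<open>
The threshold is the ratio of the Gaussian densities at \<open>\<xi> + h\<close> and at \<open>\<xi>\<close>: with \<open>u\<close> uniform, the translate is
accepted as in a Metropolis step, and a rejected velocity is reflected.  For \<open>h = 0\<close> the result is \<open>\<xi>\<close> itself, so
the synchronous coupling is a special case.
\<close>

definition velocity_coupling :: "'a::euclidean_space \<Rightarrow> 'a \<Rightarrow> real \<Rightarrow> 'a" where
  "velocity_coupling h \<xi> u = (if u \<le> exp (- (\<xi> \<bullet> h) - (norm h)\<^sup>2 / 2) then \<xi> + h else reflect h \<xi>)"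

lemma velocity_coupling_measurable [measurable]:
  assumes [measurable]: "h \<in> borel_measurable M" "\<xi> \<in> borel_measurable M" "u \<in> borel_measurable M"
  shows "(\<lambda>z. velocity_coupling (h z) (\<xi> z) (u z)) \<in> borel_measurable M"
  unfolding velocity_coupling_def by measurable

text \<open>
The coupled velocity is again Gaussian.  With \<open>D\<close> the Gaussian density, accepted velocities contribute the density
\<open>min (D(v - h)) (D v)\<close>.  Rejected ones have density \<open>D - min D (D(\<cdot> + h))\<close> before the reflection; since the reflection
preserves \<open>D\<close> and maps \<open>h\<close> to \<open>- h\<close>, it turns this into \<open>D v - min (D v) (D(v - h))\<close>.  The sum is \<open>D\<close>.
\<close>

lemma nn_integral_velocity_coupling:
  fixes h :: "'a::euclidean_space"
  assumes [measurable]: "g \<in> borel_measurable borel"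
  shows "(\<integral>\<^sup>+ \<xi>. \<integral>\<^sup>+ u. g (velocity_coupling h \<xi> u) \<partial>unit_uniform \<partial>std_gaussian) = (\<integral>\<^sup>+ \<xi>. g \<xi> \<partial>std_gaussian)"
proof -
  let ?D = "gauss_density :: 'a \<Rightarrow> real"
  let ?S = "reflect h"
  define p where "p \<xi> = exp (- (\<xi> \<bullet> h) - (norm h)\<^sup>2 / 2)" for \<xi>
  have [measurable]: "p \<in> borel_measurable borel" unfolding p_def[abs_def] by measurable
  have D_shift: "?D \<xi> * p \<xi> = ?D (\<xi> + h)" for \<xi>
  proof -
    have "- (norm \<xi>)\<^sup>2 / 2 + (- (\<xi> \<bullet> h) - (norm h)\<^sup>2 / 2) = - (norm (\<xi> + h))\<^sup>2 / 2"
      by (simp add: power2_norm_eq_inner inner_add_left inner_add_right inner_commute field_simps)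
    then show ?thesis by (simp add: gauss_density_def p_def exp_add[symmetric])
  qed
  have D_min: "?D \<xi> * min 1 (p \<xi>) = min (?D \<xi>) (?D (\<xi> + h))" for \<xi>
    using gauss_density_nonneg[of \<xi>] by (simp add: min_mult_distrib_left D_shift)
  have D_reflect: "?D (?S \<xi>) = ?D \<xi>" for \<xi> by (simp add: gauss_density_def norm_reflect)
  have "(\<integral>\<^sup>+ \<xi>. \<integral>\<^sup>+ u. g (velocity_coupling h \<xi> u) \<partial>unit_uniform \<partial>std_gaussian)
      = (\<integral>\<^sup>+ \<xi>. ennreal (min 1 (p \<xi>)) * g (\<xi> + h) + ennreal (1 - min 1 (p \<xi>)) * g (?S \<xi>) \<partial>std_gaussian)"
  proof (rule nn_integral_cong)
    fix \<xi>
    have "(\<integral>\<^sup>+ u. g (velocity_coupling h \<xi> u) \<partial>unit_uniform)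
        = (\<integral>\<^sup>+ u. (if u \<le> p \<xi> then g (\<xi> + h) else g (?S \<xi>)) \<partial>unit_uniform)"
      by (intro nn_integral_cong) (simp add: velocity_coupling_def p_def)
    also have "\<dots> = ennreal (min 1 (p \<xi>)) * g (\<xi> + h) + ennreal (1 - min 1 (p \<xi>)) * g (?S \<xi>)"
      by (rule nn_integral_unit_uniform_threshold) (simp add: p_def)
    finally show "(\<integral>\<^sup>+ u. g (velocity_coupling h \<xi> u) \<partial>unit_uniform)
        = ennreal (min 1 (p \<xi>)) * g (\<xi> + h) + ennreal (1 - min 1 (p \<xi>)) * g (?S \<xi>)" .
  qed
  also have "\<dots> = (\<integral>\<^sup>+ \<xi>. ennreal (?D \<xi>) * (ennreal (min 1 (p \<xi>)) * g (\<xi> + h) + ennreal (1 - min 1 (p \<xi>)) * g (?S \<xi>)) \<partial>lborel)"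
    by (rule nn_integral_std_gaussian) measurable
  also have "\<dots> = (\<integral>\<^sup>+ \<xi>. ennreal (min (?D \<xi>) (?D (\<xi> + h))) * g (\<xi> + h)
      + ennreal (?D \<xi> - min (?D \<xi>) (?D (\<xi> + h))) * g (?S \<xi>) \<partial>lborel)"
  proof (rule nn_integral_cong)
    fix \<xi>
    have "ennreal (?D \<xi>) * ennreal (min 1 (p \<xi>)) = ennreal (min (?D \<xi>) (?D (\<xi> + h)))"
      by (simp add: ennreal_mult'[symmetric] gauss_density_nonneg D_min)
    moreover have "ennreal (?D \<xi>) * ennreal (1 - min 1 (p \<xi>)) = ennreal (?D \<xi> - min (?D \<xi>) (?D (\<xi> + h)))"
      by (simp add: ennreal_mult'[symmetric] gauss_density_nonneg D_min[symmetric] right_diff_distrib)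
    ultimately show "ennreal (?D \<xi>) * (ennreal (min 1 (p \<xi>)) * g (\<xi> + h) + ennreal (1 - min 1 (p \<xi>)) * g (?S \<xi>))
      = ennreal (min (?D \<xi>) (?D (\<xi> + h))) * g (\<xi> + h) + ennreal (?D \<xi> - min (?D \<xi>) (?D (\<xi> + h))) * g (?S \<xi>)"
      by (simp add: distrib_left mult.assoc[symmetric])
  qed
  also have "\<dots> = (\<integral>\<^sup>+ \<xi>. ennreal (min (?D \<xi>) (?D (\<xi> + h))) * g (\<xi> + h) \<partial>lborel)
      + (\<integral>\<^sup>+ \<xi>. ennreal (?D \<xi> - min (?D \<xi>) (?D (\<xi> + h))) * g (?S \<xi>) \<partial>lborel)"
    by (rule nn_integral_add) measurable
  also have "(\<integral>\<^sup>+ \<xi>. ennreal (min (?D \<xi>) (?D (\<xi> + h))) * g (\<xi> + h) \<partial>lborel)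
      = (\<integral>\<^sup>+ \<xi>. ennreal (min (?D (\<xi> - h)) (?D \<xi>)) * g \<xi> \<partial>lborel)"
    using nn_integral_lborel_translate[of "\<lambda>\<xi>. ennreal (min (?D (\<xi> - h)) (?D \<xi>)) * g \<xi>" h] by simp
  also have "(\<integral>\<^sup>+ \<xi>. ennreal (?D \<xi> - min (?D \<xi>) (?D (\<xi> + h))) * g (?S \<xi>) \<partial>lborel)
      = (\<integral>\<^sup>+ \<xi>. ennreal (?D (?S \<xi>) - min (?D (?S \<xi>)) (?D (?S \<xi> + h))) * g (?S (?S \<xi>)) \<partial>lborel)"
    by (rule nn_integral_lborel_reflect[symmetric]) measurable
  also have "\<dots> = (\<integral>\<^sup>+ \<xi>. ennreal (?D \<xi> - min (?D \<xi>) (?D (\<xi> - h))) * g \<xi> \<partial>lborel)"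
  proof -
    have "?D (?S \<xi> + h) = ?D (\<xi> - h)" for \<xi>
    proof -
      have "?S (\<xi> - h) = ?S \<xi> + h"
        using reflect_add[of h "\<xi> - h" h] by (simp add: reflect_self algebra_simps)
      then show ?thesis using D_reflect[of "\<xi> - h"] by simp
    qed
    then show ?thesis by (simp add: D_reflect reflect_reflect)
  qed
  also have "(\<integral>\<^sup>+ \<xi>. ennreal (min (?D (\<xi> - h)) (?D \<xi>)) * g \<xi> \<partial>lborel) + \<dots>
      = (\<integral>\<^sup>+ \<xi>. ennreal (min (?D (\<xi> - h)) (?D \<xi>)) * g \<xi> + ennreal (?D \<xi> - min (?D \<xi>) (?D (\<xi> - h))) * g \<xi> \<partial>lborel)"
    by (rule nn_integral_add[symmetric]) measurable
  also have "\<dots> = (\<integral>\<^sup>+ \<xi>. ennreal (?D \<xi>) * g \<xi> \<partial>lborel)"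
  proof (rule nn_integral_cong)
    fix \<xi>
    show "ennreal (min (?D (\<xi> - h)) (?D \<xi>)) * g \<xi> + ennreal (?D \<xi> - min (?D \<xi>) (?D (\<xi> - h))) * g \<xi> = ennreal (?D \<xi>) * g \<xi>"
      using gauss_density_nonneg[of \<xi>] gauss_density_nonneg[of "\<xi> - h"]
      by (simp add: distrib_right[symmetric] ennreal_plus[symmetric] min.commute del: ennreal_plus)
  qed
  also have "\<dots> = (\<integral>\<^sup>+ \<xi>. g \<xi> \<partial>std_gaussian)"
    by (rule nn_integral_std_gaussian[symmetric]) measurable
  finally show ?thesis .
qed

section \<open>Conservation of energy and of phase volume\<close>

context lipschitz_force
begin

lemma energy_conserved:
  assumes h: "hamiltonian_solution U T x v q p" and t: "t \<in> {0..T}"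
  shows "U (q t) + (norm (p t))\<^sup>2 / 2 = U x + (norm v)\<^sup>2 / 2"
proof -
  define E where "E t = 2 * U (q t) + p t \<bullet> p t" for t
  have dE: "(E has_derivative (\<lambda>_. 0)) (at s within {0..T})" if s: "s \<in> {0..T}" for s
  proof -
    have dq: "(q has_derivative (\<lambda>h. h *\<^sub>R p s)) (at s within {0..T})"
      and dp: "(p has_derivative (\<lambda>h. h *\<^sub>R (- gradient U (q s)))) (at s within {0..T})"
      using h s unfolding hamiltonian_solution_def has_vector_derivative_def by blast+
    have "(U has_derivative (\<lambda>h. h \<bullet> gradient U (q s))) (at (q s))"
      using gderiv unfolding gderiv_def .
    from has_derivative_compose[OF dq this]
    have "((\<lambda>s. U (q s)) has_derivative (\<lambda>h. (h *\<^sub>R p s) \<bullet> gradient U (q s))) (at s within {0..T})" .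
    then have "(E has_derivative (\<lambda>h. 2 * ((h *\<^sub>R p s) \<bullet> gradient U (q s))
        + (p s \<bullet> (h *\<^sub>R (- gradient U (q s))) + (h *\<^sub>R (- gradient U (q s))) \<bullet> p s))) (at s within {0..T})"
      unfolding E_def[abs_def] using dp
      by (intro has_derivative_add has_derivative_mult_right has_derivative_inner) auto
    moreover have "(\<lambda>h. 2 * ((h *\<^sub>R p s) \<bullet> gradient U (q s))
        + (p s \<bullet> (h *\<^sub>R (- gradient U (q s))) + (h *\<^sub>R (- gradient U (q s))) \<bullet> p s)) = (\<lambda>_. 0)"
      by (auto simp: inner_commute fun_eq_iff)
    ultimately show ?thesis by simp
  qed
  have "\<exists>c. \<forall>s\<in>{0..T}. E s = c"
    by (rule has_derivative_zero_constant) (use dE in auto)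
  then have "E t = E 0" using t T_pos by auto
  then show ?thesis
    using h by (simp add: E_def hamiltonian_solution_def power2_norm_eq_inner)
qed

text \<open>
The symplectic Euler scheme: the new velocity uses the force at the new position, so that a step is a
composition of two shears.
\<close>

definition euler_step :: "real \<Rightarrow> 'a \<times> 'a \<Rightarrow> 'a \<times> 'a" where
  "euler_step h z = (fst z + h *\<^sub>R snd z, snd z - h *\<^sub>R gradient U (fst z + h *\<^sub>R snd z))"

lemma gradient_measurable [measurable]: "gradient U \<in> borel_measurable borel"
  by (rule borel_measurable_continuous_onI[OF gradient_continuous])

lemma euler_step_measurable [measurable]: "euler_step h \<in> borel \<rightarrow>\<^sub>M borel"
  unfolding euler_step_def[abs_def] borel_prod[symmetric] by measurable

text \<open>
For fixed velocity the first shear is a translation of the position; for fixed position the second one is a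
translation of the velocity.
\<close>

lemma nn_integral_euler_step:
  assumes [measurable]: "F \<in> borel_measurable (borel :: ('a \<times> 'a) measure)"
  shows "(\<integral>\<^sup>+ z. F (euler_step h z) \<partial>lborel) = (\<integral>\<^sup>+ z. F z \<partial>lborel)"
proof -
  have [measurable]: "(\<lambda>z. F (fst z, snd z)) \<in> borel_measurable (borel \<Otimes>\<^sub>M borel)"
    by (simp add: borel_prod)
  have [measurable]: "(\<lambda>(x, v). F (x, v)) \<in> borel_measurable (borel \<Otimes>\<^sub>M borel)"
    by (simp add: borel_prod)
  have [measurable]: "F \<in> borel_measurable (borel \<Otimes>\<^sub>M borel)"
    by (simp add: borel_prod)
  have "(\<integral>\<^sup>+ z. F (euler_step h z) \<partial>lborel)
      = (\<integral>\<^sup>+ z. F (fst z + h *\<^sub>R snd z, snd z - h *\<^sub>R gradient U (fst z + h *\<^sub>R snd z)) \<partial>(lborel \<Otimes>\<^sub>M lborel))"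
    by (simp add: euler_step_def lborel_prod)
  also have "\<dots> = (\<integral>\<^sup>+ v. \<integral>\<^sup>+ x. F (x + h *\<^sub>R v, v - h *\<^sub>R gradient U (x + h *\<^sub>R v)) \<partial>lborel \<partial>lborel)"
    by (subst lborel_pair.nn_integral_snd[symmetric]) (auto simp: split_beta')
  also have "\<dots> = (\<integral>\<^sup>+ v. \<integral>\<^sup>+ x. F (x, v - h *\<^sub>R gradient U x) \<partial>lborel \<partial>lborel)"
    by (intro nn_integral_cong nn_integral_lborel_translate[where f = "\<lambda>x. F (x, v - h *\<^sub>R gradient U x)" for v]) measurable
  also have "\<dots> = (\<integral>\<^sup>+ x. \<integral>\<^sup>+ v. F (x, v - h *\<^sub>R gradient U x) \<partial>lborel \<partial>lborel)"
    by (rule lborel_pair.Fubini') measurable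
  also have "\<dots> = (\<integral>\<^sup>+ x. \<integral>\<^sup>+ v. F (x, v) \<partial>lborel \<partial>lborel)"
  proof (rule nn_integral_cong)
    show "(\<integral>\<^sup>+ v. F (x, v - h *\<^sub>R gradient U x) \<partial>lborel) = (\<integral>\<^sup>+ v. F (x, v) \<partial>lborel)" for x
      using nn_integral_lborel_translate[where f = "\<lambda>v. F (x, v)" and c = "- (h *\<^sub>R gradient U x)"] by simp
  qed
  also have "\<dots> = (\<integral>\<^sup>+ z. F z \<partial>(lborel \<Otimes>\<^sub>M lborel))"
    by (subst lborel.nn_integral_fst[symmetric]) auto
  finally show ?thesis by (simp add: lborel_prod)
qed

lemma euler_iterate_measurable [measurable]: "(euler_step h ^^ n) \<in> borel \<rightarrow>\<^sub>M borel"
  by (induction n) (auto simp: funpow.simps(1))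

lemma nn_integral_euler_iterate:
  assumes "F \<in> borel_measurable (borel :: ('a \<times> 'a) measure)"
  shows "(\<integral>\<^sup>+ z. F ((euler_step h ^^ n) z) \<partial>lborel) = (\<integral>\<^sup>+ z. F z \<partial>lborel)"
  using assms
proof (induction n arbitrary: F)
  case (Suc n)
  from Suc.prems have [measurable]: "F \<in> borel_measurable borel" .
  have "(\<integral>\<^sup>+ z. F (euler_step h ((euler_step h ^^ n) z)) \<partial>lborel) = (\<integral>\<^sup>+ z. F (euler_step h z) \<partial>lborel)"
    by (rule Suc.IH) measurable
  then show ?case by (simp add: nn_integral_euler_step)
qed simp

text \<open>
Consistency errors of order \<open>h\<^sup>2\<close> per step accumulate, by a discrete Gronwall argument, to an error of order
\<open>h\<close> along the given trajectory.  The constant may depend on the trajectory, since only pointwise convergence is used.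
\<close>

lemma euler_error:
  assumes sol: "hamiltonian_solution U T x v q p"
  shows "\<exists>C\<ge>0. \<forall>(N::nat) k. 0 < N \<longrightarrow> k \<le> N \<longrightarrow>
    norm ((euler_step (T / N) ^^ k) (x, v) - (q (k * (T / N)), p (k * (T / N)))) \<le> C / N"
proof -
  have "bounded (p ` {0..T})" "bounded (gradient U ` q ` {0..T})"
    using solution_continuous[OF sol]
    by (auto intro!: compact_imp_bounded compact_continuous_image gradient_continuous)
  then obtain P G where P: "\<forall>y\<in>p ` {0..T}. norm y \<le> P" and G: "\<forall>y\<in>gradient U ` q ` {0..T}. norm y \<le> G"
    unfolding bounded_iff by blast
  have P: "norm (p t) \<le> P" and G: "norm (gradient U (q t)) \<le> G" if "t \<in> {0..T}" for t
    using P G that by auto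
  have PG0: "0 \<le> P" "0 \<le> G"
    using order_trans[OF norm_ge_zero P[of 0]] order_trans[OF norm_ge_zero G[of 0]] T_pos by auto
  have d: "(q has_vector_derivative p s) (at s within {a..b})"
    "(p has_vector_derivative - gradient U (q s)) (at s within {a..b})"
    if "0 \<le> a" "b \<le> T" "s \<in> {a..b}" for a b s
  proof -
    have sub: "{a..b} \<subseteq> {0..T}" "s \<in> {0..T}" using that by auto
    have "(q has_vector_derivative p s) (at s within {0..T})"
      "(p has_vector_derivative - gradient U (q s)) (at s within {0..T})"
      using sol sub(2) unfolding hamiltonian_solution_def by blast+
    then show "(q has_vector_derivative p s) (at s within {a..b})"
      "(p has_vector_derivative - gradient U (q s)) (at s within {a..b})"
      using has_vector_derivative_within_subset[OF _ sub(1)] by blast+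
  qed
  have lin: "((\<lambda>s. c * s) has_vector_derivative c) (at s within A)" for c s :: real and A
    by (auto intro!: derivative_eq_intros simp: has_vector_derivative_def)
  have lin2: "((\<lambda>s. s *\<^sub>R y) has_vector_derivative y) (at s within A)" for y :: 'a and s A
    by (auto intro!: derivative_eq_intros simp: has_vector_derivative_def)
  have q_lip: "norm (q b - q a) \<le> P * (b - a)" and p_lip: "norm (p b - p a) \<le> G * (b - a)"
    if ab: "0 \<le> a" "a \<le> b" "b \<le> T" for a b
  proof -
    have "norm (q b - q a) \<le> P * b - P * a"
      by (rule norm_increment_le_of_deriv_le[where \<phi>' = "\<lambda>_. P" and f' = p])
        (use ab d lin P in auto)
    moreover have "norm (p b - p a) \<le> G * b - G * a"
      by (rule norm_increment_le_of_deriv_le[where \<phi>' = "\<lambda>_. G" and f' = "\<lambda>s. - gradient U (q s)"])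
        (use ab d lin G in auto)
    ultimately show "norm (q b - q a) \<le> P * (b - a)" "norm (p b - p a) \<le> G * (b - a)"
      by (auto simp: algebra_simps)
  qed
  have q_loc: "norm (q b - (q a + (b - a) *\<^sub>R p a)) \<le> G * (b - a)\<^sup>2"
    and p_loc: "norm (p b - (p a - (b - a) *\<^sub>R gradient U (q b))) \<le> L * P * (b - a)\<^sup>2"
    if ab: "0 \<le> a" "a \<le> b" "b \<le> T" for a b
  proof -
    have "norm ((q b - b *\<^sub>R p a) - (q a - a *\<^sub>R p a)) \<le> (G * (b - a)) * b - (G * (b - a)) * a"
    proof (rule norm_increment_le_of_deriv_le[where \<phi>' = "\<lambda>_. G * (b - a)" and f' = "\<lambda>s. p s - p a"])
      fix s assume s: "s \<in> {a..b}"
      show "((\<lambda>s. q s - s *\<^sub>R p a) has_vector_derivative p s - p a) (at s within {a..b})"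
        by (rule has_vector_derivative_diff[OF d(1) lin2]) (use s ab in auto)
      have "norm (p s - p a) \<le> G * (s - a)" using p_lip[of a s] s ab by auto
      also have "\<dots> \<le> G * (b - a)" using s PG0 by (intro mult_left_mono) auto
      finally show "norm (p s - p a) \<le> G * (b - a)" .
    qed (use ab lin in auto)
    then show "norm (q b - (q a + (b - a) *\<^sub>R p a)) \<le> G * (b - a)\<^sup>2"
      by (simp add: algebra_simps power2_eq_square)
    have "norm ((p b + b *\<^sub>R gradient U (q b)) - (p a + a *\<^sub>R gradient U (q b))) \<le> (L * P * (b - a)) * b - (L * P * (b - a)) * a"
    proof (rule norm_increment_le_of_deriv_le[where \<phi>' = "\<lambda>_. L * P * (b - a)" and f' = "\<lambda>s. - gradient U (q s) + gradient U (q b)"])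
      fix s assume s: "s \<in> {a..b}"
      show "((\<lambda>s. p s + s *\<^sub>R gradient U (q b)) has_vector_derivative - gradient U (q s) + gradient U (q b)) (at s within {a..b})"
        by (rule has_vector_derivative_add[OF d(2) lin2]) (use s ab in auto)
      have "norm (- gradient U (q s) + gradient U (q b)) \<le> L * norm (q b - q s)"
        using lip[of "q b" "q s"] by (simp add: algebra_simps)
      also have "\<dots> \<le> L * (P * (b - s))" using q_lip[of s b] s ab L_pos by (intro mult_left_mono) auto
      also have "\<dots> \<le> L * (P * (b - a))" using s PG0 L_pos by (intro mult_left_mono) auto
      finally show "norm (- gradient U (q s) + gradient U (q b)) \<le> L * P * (b - a)" by simp
    qed (use ab lin in auto)
    then show "norm (p b - (p a - (b - a) *\<^sub>R gradient U (q b))) \<le> L * P * (b - a)\<^sup>2"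
      by (simp add: algebra_simps power2_eq_square)
  qed
  \<comment> \<open>\<open>A\<close> is the growth rate of the error per unit time and \<open>D\<close> bounds the consistency error divided by \<open>h\<^sup>2\<close>.\<close>
  define A where "A = 1 + L * (1 + T)"
  define D where "D = G + L * P + L * G * T"
  have A0: "0 < A" "1 \<le> A" and D0: "0 \<le> D" using L_pos T_pos PG0 by (auto simp: A_def D_def intro: add_pos_pos)
  show ?thesis
  proof (intro exI conjI allI impI)
    show "0 \<le> D * T\<^sup>2 * exp (A * T)" using D0 by simp
    fix N k :: nat assume N: "0 < N" and k: "k \<le> N"
    define h where "h = T / N"
    have h: "0 < h" "h \<le> T" using N T_pos by (auto simp: h_def field_simps)
    define X where "X k = fst ((euler_step h ^^ k) (x, v))" for k
    define V where "V k = snd ((euler_step h ^^ k) (x, v))" for k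
    define e where "e k = norm (X k - q (k * h)) + norm (V k - p (k * h))" for k :: nat
    have X: "X (Suc k) = X k + h *\<^sub>R V k" and V: "V (Suc k) = V k - h *\<^sub>R gradient U (X (Suc k))" for k
      by (simp_all add: X_def V_def euler_step_def)
    have step: "e (Suc k) \<le> (1 + A * h) * e k + D * h\<^sup>2" if "Suc k \<le> N" for k
    proof -
      define a where "a = k * h"
      have sb: "real (Suc k) * h = a + h" by (simp add: a_def algebra_simps)
      have "real (Suc k) * h \<le> real N * h" using that h by (intro mult_right_mono) auto
      also have "\<dots> = T" using N by (simp add: h_def)
      finally have ab: "0 \<le> a" "a \<le> a + h" "a + h \<le> T" using h sb by (auto simp: a_def)
      let ?x = "norm (X k - q a)" and ?v = "norm (V k - p a)"
      have "X (Suc k) - q (a + h) = (X k - q a) + h *\<^sub>R (V k - p a) - (q (a + h) - (q a + h *\<^sub>R p a))"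
        by (simp add: X algebra_simps)
      also have "norm \<dots> \<le> ?x + h * ?v + G * h\<^sup>2"
      proof -
        have "norm (y + z - u) \<le> norm y + norm z + norm u" for y z u :: 'a
          using norm_triangle_ineq4[of "y + z" u] norm_triangle_ineq[of y z] by linarith
        from this[of "X k - q a" "h *\<^sub>R (V k - p a)" "q (a + h) - (q a + h *\<^sub>R p a)"]
        show ?thesis using q_loc[OF ab] h by simp
      qed
      finally have x1: "norm (X (Suc k) - q (a + h)) \<le> ?x + h * ?v + G * h\<^sup>2" .
      have "V (Suc k) - p (a + h) = (V k - p a) - h *\<^sub>R (gradient U (X (Suc k)) - gradient U (q (a + h)))
          - (p (a + h) - (p a - h *\<^sub>R gradient U (q (a + h))))"
        by (simp add: V algebra_simps)
      also have "norm \<dots> \<le> ?v + h * (L * norm (X (Suc k) - q (a + h))) + L * P * h\<^sup>2"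
      proof -
        have tri: "norm (y - z - u) \<le> \<alpha> + \<beta> + \<gamma>"
          if "norm y \<le> \<alpha>" "norm z \<le> \<beta>" "norm u \<le> \<gamma>" for y z u :: 'a and \<alpha> \<beta> \<gamma>
          using norm_triangle_ineq4[of "y - z" u] norm_triangle_ineq4[of y z] that by linarith
        show ?thesis
        proof (rule tri[OF order_refl])
          show "norm (h *\<^sub>R (gradient U (X (Suc k)) - gradient U (q (a + h))))
              \<le> h * (L * norm (X (Suc k) - q (a + h)))"
            unfolding norm_scaleR using h lip[of "X (Suc k)" "q (a + h)"]
            by (intro mult_mono) auto
          show "norm (p (a + h) - (p a - h *\<^sub>R gradient U (q (a + h)))) \<le> L * P * h\<^sup>2"
            using p_loc[OF ab] by simp
        qed
      qed
      also have "\<dots> \<le> ?v + h * (L * (?x + h * ?v + G * h\<^sup>2)) + L * P * h\<^sup>2"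
        using x1 h L_pos PG0 by (intro add_mono mult_left_mono order_refl) auto
      finally have "e (Suc k) \<le> (?x + h * ?v + G * h\<^sup>2) + (?v + h * (L * (?x + h * ?v + G * h\<^sup>2)) + L * P * h\<^sup>2)"
        using x1 unfolding e_def sb by linarith
      also have "\<dots> = ?x + ?v + h * ?v + h * L * ?x + h * L * (h * ?v) + (G + L * P + L * G * h) * h\<^sup>2"
        by (simp add: algebra_simps power2_eq_square)
      also have "\<dots> \<le> ?x + ?v + h * ?v + h * L * ?x + h * L * (T * ?v) + (G + L * P + L * G * T) * h\<^sup>2"
        using h L_pos PG0 by (intro add_mono mult_mono mult_right_mono mult_left_mono) auto
      also have "\<dots> \<le> (1 + A * h) * (?x + ?v) + D * h\<^sup>2"
      proof -
        have "0 \<le> h * ?x + h * (L * T * ?x) + h * (L * ?v)" using h L_pos T_pos by simp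
        then show ?thesis by (simp add: A_def D_def algebra_simps)
      qed
      finally show ?thesis by (simp add: e_def a_def)
    qed
    have e0: "e 0 = 0" using sol by (simp add: e_def X_def V_def hamiltonian_solution_def)
    have bound: "e k \<le> D * h\<^sup>2 * k * exp (A * h * k)" if "k \<le> N" for k
      using that
    proof (induction k)
      case (Suc k)
      have "e (Suc k) \<le> (1 + A * h) * e k + D * h\<^sup>2" by (rule step[OF Suc.prems])
      also have "\<dots> \<le> (1 + A * h) * (D * h\<^sup>2 * k * exp (A * h * k)) + D * h\<^sup>2"
        using Suc h A0 by (intro add_right_mono mult_left_mono) auto
      also have "\<dots> \<le> exp (A * h) * (D * h\<^sup>2 * k * exp (A * h * k)) + D * h\<^sup>2 * exp (A * h * Suc k)"
      proof (rule add_mono)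
        show "(1 + A * h) * (D * h\<^sup>2 * k * exp (A * h * k)) \<le> exp (A * h) * (D * h\<^sup>2 * k * exp (A * h * k))"
          using D0 by (intro mult_right_mono exp_ge_add_one_self) auto
        have "1 \<le> exp (A * h * Suc k)" using A0 h by simp
        then show "D * h\<^sup>2 \<le> D * h\<^sup>2 * exp (A * h * Suc k)" using D0 mult_left_mono[of 1 "exp (A * h * Suc k)" "D * h\<^sup>2"] by simp
      qed
      also have "\<dots> = D * h\<^sup>2 * Suc k * exp (A * h * Suc k)"
        by (simp add: algebra_simps exp_add)
      finally show ?case .
    qed (simp add: e0)
    have kh: "k * h \<le> T" using k N T_pos by (simp add: h_def field_simps)
    have "norm ((euler_step h ^^ k) (x, v) - (q (k * h), p (k * h))) \<le> e k"
    proof -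
      have "(euler_step h ^^ k) (x, v) - (q (k * h), p (k * h)) = (X k - q (k * h), V k - p (k * h))"
        by (simp add: X_def V_def prod_eq_iff)
      then show ?thesis unfolding e_def by (simp only: norm_Pair_le)
    qed
    also have "e k \<le> D * h\<^sup>2 * k * exp (A * h * k)" by (rule bound[OF k])
    also have "\<dots> = D * h * (k * h) * exp (A * (k * h))" by (simp add: power2_eq_square mult_ac)
    also have "\<dots> \<le> D * h * T * exp (A * T)"
      using kh D0 h A0 T_pos by (intro mult_mono) auto
    also have "\<dots> = (D * T\<^sup>2 * exp (A * T)) / N" by (simp add: h_def power2_eq_square)
    finally show "norm ((euler_step (T / N) ^^ k) (x, v) - (q (k * (T / N)), p (k * (T / N)))) \<le> D * T\<^sup>2 * exp (A * T) / N"
      by (simp add: h_def)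
  qed
qed

definition flow :: "'a \<times> 'a \<Rightarrow> 'a \<times> 'a" where
  "flow z = (SOME y. \<exists>q p. hamiltonian_solution U T (fst z) (snd z) q p \<and> y = (q T, p T))"

lemma flow: "\<exists>q p. hamiltonian_solution U T x v q p \<and> flow (x, v) = (q T, p T)"
proof -
  have "\<exists>y q p. hamiltonian_solution U T x v q p \<and> y = (q T, p T)"
    using solution_exists by blast
  from someI_ex[OF this] show ?thesis by (simp add: flow_def)
qed

lemma fst_flow: "fst (flow (x, v)) = hmc_position U T x v"
proof -
  obtain q p where "hamiltonian_solution U T x v q p" "flow (x, v) = (q T, p T)"
    using flow by blast
  then show ?thesis by (simp add: hmc_position_eq)
qed

lemma energy_flow: "U (fst (flow z)) + (norm (snd (flow z)))\<^sup>2 / 2 = U (fst z) + (norm (snd z))\<^sup>2 / 2"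
proof -
  obtain q p where sol: "hamiltonian_solution U T (fst z) (snd z) q p" and fl: "flow z = (q T, p T)"
    using flow[of "fst z" "snd z"] by auto
  show ?thesis
    using energy_conserved[OF sol, of T] T_pos unfolding fl by simp
qed

lemma euler_tendsto_flow: "(\<lambda>N. (euler_step (T / real (Suc N)) ^^ Suc N) z) \<longlonglongrightarrow> flow z"
proof -
  obtain q p where sol: "hamiltonian_solution U T (fst z) (snd z) q p" and fl: "flow z = (q T, p T)"
    using flow[of "fst z" "snd z"] by auto
  obtain C where C: "\<forall>(N::nat) k. 0 < N \<longrightarrow> k \<le> N \<longrightarrow>
    norm ((euler_step (T / N) ^^ k) (fst z, snd z) - (q (k * (T / N)), p (k * (T / N)))) \<le> C / N"
    using euler_error[OF sol] by (elim exE conjE)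
  have le: "norm ((euler_step (T / real (Suc N)) ^^ Suc N) z - flow z) \<le> C / real (Suc N)" for N
  proof -
    have eq: "real (Suc N) * (T / real (Suc N)) = T" by simp
    show ?thesis
      using C[rule_format, of "Suc N" "Suc N", OF zero_less_Suc order_refl]
      unfolding fl eq prod.collapse .
  qed
  have lim: "(\<lambda>N. C / real (Suc N)) \<longlonglongrightarrow> 0"
    by (rule LIMSEQ_Suc[OF lim_const_over_n])
  have "(\<lambda>N. (euler_step (T / real (Suc N)) ^^ Suc N) z - flow z) \<longlonglongrightarrow> 0"
    by (rule Lim_null_comparison[OF _ lim], rule always_eventually, rule allI, rule le)
  then show ?thesis by (rule LIM_zero_cancel)
qed

section \<open>The transition kernel and its invariant measure\<close>

lemma hmc_kernel_measurable [measurable]: "hmc_kernel U T \<in> borel \<rightarrow>\<^sub>M subprob_algebra borel"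
proof -
  have "(\<lambda>x. distr std_gaussian borel (hmc_position U T x)) \<in> borel \<rightarrow>\<^sub>M subprob_algebra borel"
  proof (rule measurable_distr2)
    show "case_prod (hmc_position U T) \<in> borel \<Otimes>\<^sub>M std_gaussian \<rightarrow>\<^sub>M borel"
      by measurable
    show "(\<lambda>x. std_gaussian) \<in> borel \<rightarrow>\<^sub>M subprob_algebra std_gaussian"
      using prob_space_imp_subprob_space[OF prob_space_std_gaussian]
      by (intro measurable_const) (simp add: space_subprob_algebra)
  qed
  then show ?thesis by (simp add: hmc_kernel_def[abs_def])
qed

lemma nn_integral_hmc_kernel:
  assumes [measurable]: "f \<in> borel_measurable borel"
  shows "(\<integral>\<^sup>+ y. f y \<partial>hmc_kernel U T x) = (\<integral>\<^sup>+ v. f (hmc_position U T x v) \<partial>std_gaussian)"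
  unfolding hmc_kernel_def by (rule nn_integral_distr) measurable

lemma prob_space_hmc_kernel: "prob_space (hmc_kernel U T x)"
  unfolding hmc_kernel_def by (rule prob_space.prob_space_distr[OF prob_space_std_gaussian]) measurable

lemma sets_bind_hmc_kernel:
  assumes "sets \<nu> = sets borel"
  shows "sets (\<nu> \<bind> hmc_kernel U T) = sets borel"
proof (rule sets_bind)
  show "sets (hmc_kernel U T x) = sets borel" for x by (simp add: hmc_kernel_def)
  show "space \<nu> \<noteq> {}" using sets_eq_imp_space_eq[OF assms] by simp
qed

lemma prob_space_bind_hmc_kernel:
  assumes "prob_space \<nu>" and [measurable_cong]: "sets \<nu> = sets borel"
  shows "prob_space (\<nu> \<bind> hmc_kernel U T)"
  by (rule prob_space.prob_space_bind[OF assms(1), where S = borel])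
    (auto intro: prob_space_hmc_kernel)

lemma emeasure_bind_hmc_kernel:
  assumes [measurable_cong]: "sets \<nu> = sets borel" and [measurable]: "A \<in> sets borel"
  shows "emeasure (\<nu> \<bind> hmc_kernel U T) A
    = (\<integral>\<^sup>+ x. \<integral>\<^sup>+ v. indicator A (hmc_position U T x v) \<partial>std_gaussian \<partial>\<nu>)"
proof -
  have "emeasure (\<nu> \<bind> hmc_kernel U T) A = (\<integral>\<^sup>+ x. emeasure (hmc_kernel U T x) A \<partial>\<nu>)"
    by (rule emeasure_bind[where N = borel]) (auto simp: sets_eq_imp_space_eq[OF assms(1)])
  also have "\<dots> = (\<integral>\<^sup>+ x. \<integral>\<^sup>+ v. indicator A (hmc_position U T x v) \<partial>std_gaussian \<partial>\<nu>)"
  proof (rule nn_integral_cong)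
    fix x
    have "emeasure (hmc_kernel U T x) A = (\<integral>\<^sup>+ y. indicator A y \<partial>hmc_kernel U T x)"
      by (rule nn_integral_indicator[symmetric]) (simp add: hmc_kernel_def)
    also have "\<dots> = (\<integral>\<^sup>+ v. indicator A (hmc_position U T x v) \<partial>std_gaussian)"
      by (rule nn_integral_hmc_kernel) measurable
    finally show "emeasure (hmc_kernel U T x) A = (\<integral>\<^sup>+ v. indicator A (hmc_position U T x v) \<partial>std_gaussian)" .
  qed
  finally show ?thesis .
qed

lemma U_continuous: "continuous_on UNIV U"
proof -
  have "isCont U x" for x
    using gderiv[of x] unfolding gderiv_def by (rule has_derivative_continuous)
  then show ?thesis by (simp add: continuous_on_eq_continuous_at)
qed

lemma U_measurable [measurable]: "U \<in> borel_measurable borel"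
  by (rule borel_measurable_continuous_onI[OF U_continuous])

lemma prob_space_gibbs_measure:
  assumes int: "integrable lborel (\<lambda>x. exp (- U x))"
  shows "prob_space (gibbs_measure U)" and "0 < (LINT y|lborel. exp (- U y))"
proof -
  let ?Z = "LINT y|lborel. exp (- U y)"
  have "?Z \<noteq> 0"
  proof
    assume "?Z = 0"
    then have "AE x in (lborel :: 'a measure). False"
      using integral_nonneg_eq_0_iff_AE[OF int] by simp
    then have "emeasure (lborel :: 'a measure) UNIV = 0"
      by (subst (asm) AE_iff_measurable[of UNIV]) auto
    then show False by simp
  qed
  then show Z: "0 < ?Z" by (simp add: less_le integral_nonneg_AE)
  have "emeasure (gibbs_measure U) (space (gibbs_measure U)) = (\<integral>\<^sup>+ x. ennreal (exp (- U x) / ?Z) \<partial>lborel)"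
    unfolding gibbs_measure_def by (simp add: emeasure_density)
  also have "\<dots> = ennreal (LINT x|lborel. exp (- U x) / ?Z)"
    using int Z by (intro nn_integral_eq_integral) auto
  also have "\<dots> = 1" using Z by simp
  finally show "prob_space (gibbs_measure U)" by (rule prob_spaceI)
qed

text \<open>
Let \<open>w\<close> be the density of \<open>\<mu> \<times> N(0, I)\<close>, a function of the energy and hence constant along the flow.  For an open set
\<open>G\<close> the mass after one step is the integral of \<open>(w 1\<^sub>G) \<circ> flow\<close>.  As \<open>w 1\<^sub>G\<close> is lower semicontinuous, this
integrand is at most the lower limit of its counterparts for the Euler scheme, all of which have the integral
\<open>\<mu>(G)\<close>.  Outer regularity extends the resulting inequality to Borel sets, and taking complements reverses it.
\<close>

lemma gibbs_invariant:
  assumes int: "integrable lborel (\<lambda>x. exp (- U x))"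
  shows "gibbs_measure U \<bind> hmc_kernel U T = gibbs_measure U"
proof -
  let ?\<mu> = "gibbs_measure U" and ?\<mu>' = "gibbs_measure U \<bind> hmc_kernel U T"
  define Z where "Z = (LINT y|lborel. exp (- U y))"
  have Z: "0 < Z" and P: "prob_space ?\<mu>"
    using prob_space_gibbs_measure[OF int] by (auto simp: Z_def)
  have sets_\<mu> [simp, measurable_cong]: "sets ?\<mu> = sets borel" by (simp add: gibbs_measure_def)
  have P': "prob_space ?\<mu>'" by (rule prob_space_bind_hmc_kernel[OF P sets_\<mu>])
  have sets_\<mu>': "sets ?\<mu>' = sets borel" by (rule sets_bind_hmc_kernel[OF sets_\<mu>])
  have space: "space ?\<mu> = UNIV" "space ?\<mu>' = UNIV"
    using sets_eq_imp_space_eq[OF sets_\<mu>] sets_eq_imp_space_eq[OF sets_\<mu>'] by auto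
  define w where "w z = exp (- U (fst z)) / Z * gauss_density (snd z)" for z :: "'a \<times> 'a"
  have w_nonneg: "0 \<le> w z" for z using Z by (simp add: w_def gauss_density_nonneg)
  have w_flow: "w (flow z) = w z" for z
  proof -
    have "w z = (2 * pi) powr (- real DIM('a) / 2) / Z * exp (- (U (fst z) + (norm (snd z))\<^sup>2 / 2))" for z :: "'a \<times> 'a"
    proof -
      have "exp (- (U (fst z) + (norm (snd z))\<^sup>2 / 2)) = exp (- U (fst z)) * exp (- (norm (snd z))\<^sup>2 / 2)"
        by (simp add: exp_add[symmetric])
      then show ?thesis by (simp add: w_def gauss_density_def)
    qed
    then show ?thesis by (simp only: energy_flow)
  qed
  have w_cont: "continuous_on UNIV w"
    unfolding w_def[abs_def] gauss_density_def
    by (intro continuous_intros continuous_on_compose2[OF U_continuous]) (use Z in auto)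
  have w_meas [measurable]: "w \<in> borel_measurable borel"
    by (rule borel_measurable_continuous_onI[OF w_cont])
  have w_meas' [measurable]: "w \<in> borel_measurable (borel \<Otimes>\<^sub>M borel)"
    using w_meas by (simp add: borel_prod)
  have product: "(\<integral>\<^sup>+ x. \<integral>\<^sup>+ v. g (x, v) \<partial>std_gaussian \<partial>?\<mu>) = (\<integral>\<^sup>+ z. ennreal (w z) * g z \<partial>lborel)"
    if [measurable]: "g \<in> borel_measurable (borel \<Otimes>\<^sub>M borel)" for g :: "'a \<times> 'a \<Rightarrow> ennreal"
  proof -
    have "(\<integral>\<^sup>+ x. \<integral>\<^sup>+ v. g (x, v) \<partial>std_gaussian \<partial>?\<mu>)
        = (\<integral>\<^sup>+ x. ennreal (exp (- U x) / Z) * (\<integral>\<^sup>+ v. g (x, v) \<partial>std_gaussian) \<partial>lborel)"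
      unfolding gibbs_measure_def Z_def
      by (rule nn_integral_density) measurable
    also have "\<dots> = (\<integral>\<^sup>+ x. \<integral>\<^sup>+ v. ennreal (w (x, v)) * g (x, v) \<partial>lborel \<partial>lborel)"
    proof (rule nn_integral_cong)
      fix x
      have "ennreal (exp (- U x) / Z) * (\<integral>\<^sup>+ v. g (x, v) \<partial>std_gaussian)
          = ennreal (exp (- U x) / Z) * (\<integral>\<^sup>+ v. ennreal (gauss_density v) * g (x, v) \<partial>lborel)"
        by (subst nn_integral_std_gaussian) auto
      also have "\<dots> = (\<integral>\<^sup>+ v. ennreal (exp (- U x) / Z) * (ennreal (gauss_density v) * g (x, v)) \<partial>lborel)"
        by (rule nn_integral_cmult[symmetric]) measurable
      also have "\<dots> = (\<integral>\<^sup>+ v. ennreal (w (x, v)) * g (x, v) \<partial>lborel)"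
      proof (rule nn_integral_cong)
        fix v
        have "ennreal (w (x, v)) = ennreal (exp (- U x) / Z) * ennreal (gauss_density v)"
          unfolding w_def fst_conv snd_conv using Z by (intro ennreal_mult gauss_density_nonneg) simp
        then show "ennreal (exp (- U x) / Z) * (ennreal (gauss_density v) * g (x, v)) = ennreal (w (x, v)) * g (x, v)"
          by (simp only: mult.assoc)
      qed
      finally show "ennreal (exp (- U x) / Z) * (\<integral>\<^sup>+ v. g (x, v) \<partial>std_gaussian)
          = (\<integral>\<^sup>+ v. ennreal (w (x, v)) * g (x, v) \<partial>lborel)" .
    qed
    also have "\<dots> = (\<integral>\<^sup>+ z. ennreal (w z) * g z \<partial>(lborel \<Otimes>\<^sub>M lborel))"
      by (subst lborel.nn_integral_fst[symmetric]) auto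
    finally show ?thesis by (simp add: lborel_prod)
  qed
  have open_le: "emeasure ?\<mu>' G \<le> emeasure ?\<mu> G" if "open G" for G :: "'a set"
  proof -
    have [measurable]: "G \<in> sets borel" using that by simp
    define F where "F z = ennreal (w z) * indicator G (fst z)" for z :: "'a \<times> 'a"
    have F_meas [measurable]: "F \<in> borel_measurable borel"
      unfolding F_def[abs_def] borel_prod[symmetric] by measurable
    have lsc: "F (flow z) \<le> liminf (\<lambda>N. F ((euler_step (T / real (Suc N)) ^^ Suc N) z))" for z
    proof (cases "fst (flow z) \<in> G")
      case True
      let ?E = "\<lambda>N. (euler_step (T / real (Suc N)) ^^ Suc N) z"
      have "(\<lambda>N. fst (?E N)) \<longlonglongrightarrow> fst (flow z)"
        by (rule tendsto_fst[OF euler_tendsto_flow])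
      then have "eventually (\<lambda>N. fst (?E N) \<in> G) sequentially"
        using that True by (rule topological_tendstoD)
      then have ev: "eventually (\<lambda>N. ennreal (w (?E N)) = F (?E N)) sequentially"
        by (rule eventually_mono) (simp add: F_def)
      have "(\<lambda>N. w (?E N)) \<longlonglongrightarrow> w (flow z)"
        using w_cont euler_tendsto_flow by (rule continuous_on_tendsto_compose) auto
      then have "(\<lambda>N. ennreal (w (?E N))) \<longlonglongrightarrow> ennreal (w (flow z))"
        by (rule tendsto_ennrealI)
      from Lim_transform_eventually[OF this ev] have "(\<lambda>N. F (?E N)) \<longlonglongrightarrow> F (flow z)"
        using True by (simp add: F_def)
      then show ?thesis by (simp add: lim_imp_Liminf)
    qed (simp add: F_def)
    have "emeasure ?\<mu>' G = (\<integral>\<^sup>+ x. \<integral>\<^sup>+ v. indicator G (hmc_position U T x v) \<partial>std_gaussian \<partial>?\<mu>)"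
      by (rule emeasure_bind_hmc_kernel) auto
    also have "\<dots> = (\<integral>\<^sup>+ z. ennreal (w z) * indicator G (hmc_position U T (fst z) (snd z)) \<partial>lborel)"
      using product[of "\<lambda>z. indicator G (hmc_position U T (fst z) (snd z))"] by simp
    also have "\<dots> = (\<integral>\<^sup>+ z. F (flow z) \<partial>lborel)"
      by (intro nn_integral_cong) (simp add: F_def w_flow fst_flow[of "fst z" "snd z" for z, unfolded prod.collapse])
    also have "\<dots> \<le> (\<integral>\<^sup>+ z. liminf (\<lambda>N. F ((euler_step (T / real (Suc N)) ^^ Suc N) z)) \<partial>lborel)"
      by (intro nn_integral_mono lsc)
    also have "\<dots> \<le> liminf (\<lambda>N. \<integral>\<^sup>+ z. F ((euler_step (T / real (Suc N)) ^^ Suc N) z) \<partial>lborel)"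
      by (rule nn_integral_liminf) measurable
    also have "\<dots> = (\<integral>\<^sup>+ z. F z \<partial>lborel)"
      by (simp only: nn_integral_euler_iterate[OF F_meas] Liminf_const[OF sequentially_bot])
    also have "\<dots> = (\<integral>\<^sup>+ x. \<integral>\<^sup>+ v. indicator G (fst (x, v)) \<partial>(std_gaussian :: 'a measure) \<partial>?\<mu>)"
      unfolding F_def by (rule product[where g = "\<lambda>z. indicator G (fst z)", symmetric]) measurable
    also have "\<dots> = (\<integral>\<^sup>+ x. indicator G x \<partial>?\<mu>)"
      using prob_space.emeasure_space_1[OF prob_space_std_gaussian[where 'a = 'a]] by simp
    also have "\<dots> = emeasure ?\<mu> G" by simp
    finally show ?thesis .
  qed
  have borel_le: "emeasure ?\<mu>' A \<le> emeasure ?\<mu> A" if A: "A \<in> sets borel" for A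
  proof -
    have "emeasure ?\<mu>' A = (INF V\<in>{V. A \<subseteq> V \<and> open V}. emeasure ?\<mu>' V)"
      using A prob_space.emeasure_space_1[OF P'] by (intro outer_regular[OF sets_\<mu>']) auto
    also have "\<dots> \<le> (INF V\<in>{V. A \<subseteq> V \<and> open V}. emeasure ?\<mu> V)"
      using open_le by (intro INF_mono) auto
    also have "\<dots> = emeasure ?\<mu> A"
      using A prob_space.emeasure_space_1[OF P] by (intro outer_regular[OF sets_\<mu>, symmetric]) auto
    finally show ?thesis .
  qed
  show ?thesis
  proof (rule measure_eqI)
    show "sets ?\<mu>' = sets ?\<mu>" using sets_\<mu>' by simp
    fix A assume "A \<in> sets ?\<mu>'"
    then have A: "A \<in> sets borel" "- A \<in> sets borel" by (auto simp: sets_\<mu>')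
    interpret p: prob_space ?\<mu> by (rule P)
    interpret p': prob_space ?\<mu>' by (rule P')
    have "p'.prob A \<le> p.prob A" "p'.prob (- A) \<le> p.prob (- A)"
      using borel_le[OF A(1)] borel_le[OF A(2)]
      by (simp_all add: p.emeasure_eq_measure p'.emeasure_eq_measure)
    moreover have "p.prob (- A) = 1 - p.prob A" "p'.prob (- A) = 1 - p'.prob A"
      using p.prob_compl[of A] p'.prob_compl[of A] A sets_\<mu>' by (simp_all add: space Compl_eq_Diff_UNIV)
    ultimately show "emeasure ?\<mu>' A = emeasure ?\<mu> A"
      by (simp add: p.emeasure_eq_measure p'.emeasure_eq_measure)
  qed
qed

end

section \<open>The concave distance function\<close>

text \<open>
The closed form of the integral of \<open>exp (- min s R\<^sub>1 / T)\<close> over \<open>0 \<le> s \<le> r\<close>, valid for \<open>r \<ge> 0\<close>.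
\<close>

definition capped_dist :: "real \<Rightarrow> real \<Rightarrow> real \<Rightarrow> real" where
  "capped_dist T R\<^sub>1 r = T * (1 - exp (- min r R\<^sub>1 / T)) + max 0 (r - R\<^sub>1) * exp (- R\<^sub>1 / T)"

lemma integral_capped_exp:
  assumes T: "0 < T" and R1: "0 < R\<^sub>1" and r: "0 \<le> r"
  shows "integral {0..r} (\<lambda>s. exp (- (1 / T) * min s R\<^sub>1)) = capped_dist T R\<^sub>1 r"
proof -
  have head: "((\<lambda>s. exp (- (1 / T) * min s R\<^sub>1)) has_integral T * (1 - exp (- b / T))) {0..b}"
    if "0 \<le> b" "b \<le> R\<^sub>1" for b
  proof -
    have "((\<lambda>s. exp (- (1 / T) * s)) has_integral (- T * exp (- b / T) - (- T * exp (- 0 / T)))) {0..b}"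
      using T that(1) by (intro fundamental_theorem_of_calculus)
        (auto intro!: derivative_eq_intros simp: has_real_derivative_iff_has_vector_derivative[symmetric])
    then have "((\<lambda>s. exp (- (1 / T) * s)) has_integral T * (1 - exp (- b / T))) {0..b}"
      by (simp add: algebra_simps)
    then show ?thesis
      by (rule has_integral_eq[rotated]) (use that in auto)
  qed
  show ?thesis
  proof (cases "r \<le> R\<^sub>1")
    case True
    then show ?thesis using head[OF r True] by (simp add: capped_dist_def integral_unique)
  next
    case False
    have "((\<lambda>s. exp (- R\<^sub>1 / T)) has_integral (r - R\<^sub>1) *\<^sub>R exp (- R\<^sub>1 / T)) {R\<^sub>1..r}"
      using has_integral_const_real[of "exp (- R\<^sub>1 / T)" R\<^sub>1 r] False by simp
    then have "((\<lambda>s. exp (- (1 / T) * min s R\<^sub>1)) has_integral (r - R\<^sub>1) * exp (- R\<^sub>1 / T)) {R\<^sub>1..r}"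
      unfolding real_scaleR_def by (rule has_integral_eq[rotated]) auto
    from has_integral_combine[OF _ _ head this] False R1 show ?thesis
      by (simp add: capped_dist_def integral_unique)
  qed
qed

lemma capped_dist_0: "0 < R\<^sub>1 \<Longrightarrow> capped_dist T R\<^sub>1 0 = 0"
  by (simp add: capped_dist_def)

text \<open>
Concavity: the function lies below its tangent at \<open>r\<close>.
\<close>

lemma capped_dist_tangent:
  assumes T: "0 < T" and r: "0 \<le> r" "0 \<le> r'"
  shows "capped_dist T R\<^sub>1 r' \<le> capped_dist T R\<^sub>1 r - exp (- min r R\<^sub>1 / T) * (r - r')"
proof -
  have chord: "T * (1 - exp (- u' / T)) \<le> T * (1 - exp (- u / T)) - exp (- u / T) * (u - u')" for u u' :: real
  proof -
    have "exp (- u / T) * (1 + (u - u') / T) \<le> exp (- u / T) * exp ((u - u') / T)"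
      by (intro mult_left_mono exp_ge_add_one_self) auto
    also have "\<dots> = exp (- u' / T)" by (simp add: exp_add[symmetric] diff_divide_distrib)
    finally have "T * (exp (- u / T) * (1 + (u - u') / T)) \<le> T * exp (- u' / T)"
      using T by (intro mult_left_mono) auto
    moreover have "T * (exp (- u / T) * (1 + (u - u') / T)) = exp (- u / T) * (T + (u - u'))"
      using T by (simp add: field_simps)
    ultimately show ?thesis by (simp add: algebra_simps)
  qed
  have tail: "exp (- R\<^sub>1 / T) * (max 0 (r' - R\<^sub>1) - max 0 (r - R\<^sub>1)) \<le>
      exp (- min r R\<^sub>1 / T) * (max 0 (r' - R\<^sub>1) - max 0 (r - R\<^sub>1))"
  proof (cases "r \<le> R\<^sub>1")
    case True
    then show ?thesis using T by (intro mult_right_mono) (auto simp: divide_right_mono)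
  qed auto
  have "min r R\<^sub>1 - min r' R\<^sub>1 - (max 0 (r' - R\<^sub>1) - max 0 (r - R\<^sub>1)) = r - r'"
    by (auto simp: min_def max_def)
  then have "exp (- min r R\<^sub>1 / T) * (r - r') = exp (- min r R\<^sub>1 / T) * (min r R\<^sub>1 - min r' R\<^sub>1)
      - exp (- min r R\<^sub>1 / T) * (max 0 (r' - R\<^sub>1) - max 0 (r - R\<^sub>1))"
    by (metis right_diff_distrib)
  with chord[of "min r' R\<^sub>1" "min r R\<^sub>1"] tail show ?thesis
    unfolding capped_dist_def by (simp add: algebra_simps)
qed

lemma capped_dist_mono:
  assumes "0 < T" "0 \<le> r'" "r' \<le> r"
  shows "capped_dist T R\<^sub>1 r' \<le> capped_dist T R\<^sub>1 r"
proof -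
  have "0 \<le> exp (- min r R\<^sub>1 / T) * (r - r')" using assms by simp
  then show ?thesis using capped_dist_tangent[of T r r' R\<^sub>1] assms by linarith
qed

lemma capped_dist_bounds:
  assumes "0 < T" "0 < R\<^sub>1" "0 \<le> r"
  shows "exp (- R\<^sub>1 / T) * r \<le> capped_dist T R\<^sub>1 r" "capped_dist T R\<^sub>1 r \<le> r"
proof -
  have "exp (- R\<^sub>1 / T) * r \<le> exp (- min r R\<^sub>1 / T) * r"
    using assms by (intro mult_right_mono) (auto simp: divide_right_mono)
  then show "exp (- R\<^sub>1 / T) * r \<le> capped_dist T R\<^sub>1 r"
    using capped_dist_tangent[of T r 0 R\<^sub>1] assms by (simp add: capped_dist_0)
  show "capped_dist T R\<^sub>1 r \<le> r"
    using capped_dist_tangent[of T 0 r R\<^sub>1] assms by (simp add: capped_dist_0)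
qed

lemma capped_dist_nonneg: "0 < T \<Longrightarrow> 0 < R\<^sub>1 \<Longrightarrow> 0 \<le> r \<Longrightarrow> 0 \<le> capped_dist T R\<^sub>1 r"
  using capped_dist_mono[of T 0 r R\<^sub>1] by (simp add: capped_dist_0)

text \<open>
The part of the function up to \<open>R\<^sub>1\<close> never exceeds \<open>T\<close>, so a jump of any size from \<open>r \<le> R\<^sub>1\<close> costs at most \<open>T\<close> times
the slope at \<open>r\<close>, apart from the linear tail.  This makes rare large increases of the distance affordable.
\<close>

lemma capped_dist_jump:
  assumes "0 < T" "r \<le> R\<^sub>1"
  shows "capped_dist T R\<^sub>1 r' \<le> capped_dist T R\<^sub>1 r + T * exp (- r / T) + max 0 (r' - R\<^sub>1) * exp (- R\<^sub>1 / T)"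
proof -
  have "T * (1 - exp (- min r' R\<^sub>1 / T)) \<le> T" using assms(1) by simp
  moreover have "capped_dist T R\<^sub>1 r + T * exp (- r / T) = T"
    using assms(2) by (simp add: capped_dist_def algebra_simps)
  ultimately show ?thesis by (simp only: capped_dist_def[of T R\<^sub>1 r'])
qed

lemma capped_dist_measurable [measurable]:
  assumes [measurable]: "g \<in> borel_measurable M"
  shows "(\<lambda>x. capped_dist T R\<^sub>1 (g x)) \<in> borel_measurable M"
  unfolding capped_dist_def by measurable

section \<open>Numerical estimates\<close>

lemma exp_minus_half_bounds: "29 / 48 \<le> exp (- 1 / 2 :: real)" "exp (- 1 / 2 :: real) \<le> 233 / 384"
proof -
  obtain t :: real where "exp (- 1 / 2 :: real) = (\<Sum>m<4. (- 1 / 2) ^ m / fact m) + exp t / fact 4 * (- 1 / 2) ^ 4"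
    using Maclaurin_exp_le[of "- 1 / 2" 4] by blast
  then have "exp (- 1 / 2 :: real) = 29 / 48 + exp t / 384"
    by (simp add: eval_nat_numeral)
  then show "29 / 48 \<le> exp (- 1 / 2 :: real)" by simp
  obtain t :: real where "exp (- 1 / 2 :: real) = (\<Sum>m<5. (- 1 / 2) ^ m / fact m) + exp t / fact 5 * (- 1 / 2) ^ 5"
    using Maclaurin_exp_le[of "- 1 / 2" 5] by blast
  then have "exp (- 1 / 2 :: real) = 233 / 384 - exp t / 3840"
    by (simp add: eval_nat_numeral)
  then show "exp (- 1 / 2 :: real) \<le> 233 / 384" by simp
qed

lemma exp_minus_five_halves_bounds: "2 / 25 \<le> exp (- 5 / 2 :: real)" "exp (- 5 / 2 :: real) \<le> 33 / 400"
proof -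
  have eq: "exp (- 5 / 2 :: real) = exp (- 1 / 2) ^ 5"
    by (simp add: exp_of_nat_mult[symmetric])
  have "(29 / 48 :: real) ^ 5 \<le> exp (- 1 / 2) ^ 5"
    by (rule power_mono[OF exp_minus_half_bounds(1)]) simp
  moreover have "exp (- 1 / 2 :: real) ^ 5 \<le> (233 / 384) ^ 5"
    by (rule power_mono[OF exp_minus_half_bounds(2)]) simp
  ultimately show "2 / 25 \<le> exp (- 5 / 2 :: real)" "exp (- 5 / 2 :: real) \<le> 33 / 400"
    unfolding eq by (simp_all add: power_divide)
qed

text \<open>
\<open>(exp u - 1) / u\<close> is increasing, by convexity of the exponential function.
\<close>

lemma expm1_chord:
  fixes u v :: real
  assumes "0 \<le> u" "u \<le> v"
  shows "v * (exp u - 1) \<le> u * (exp v - 1)"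
proof (cases "v = 0")
  case False
  then have v: "0 < v" using assms by simp
  have "exp ((1 - u / v) *\<^sub>R 0 + (u / v) *\<^sub>R v) \<le> (1 - u / v) * exp 0 + (u / v) * exp v"
    by (rule convex_onD[OF exp_convex]) (use assms v in auto)
  then have "exp u \<le> 1 - u / v + (u / v) * exp v" using v by simp
  then have "v * exp u \<le> v * (1 - u / v + (u / v) * exp v)" using v by (intro mult_left_mono) auto
  then show ?thesis using v by (simp add: algebra_simps)
qed (use assms in auto)

lemma cubic_bound: "18 * (w\<^sup>2 - 1) \<le> 7 * w ^ 3" if "1 \<le> (w::real)"
proof -
  have "0 \<le> (w - 12 / 7)\<^sup>2 * (7 * w + 6)" using that by simp
  also have "\<dots> = 7 * w ^ 3 - 18 * w\<^sup>2 + 864 / 49 * 1"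
    by (simp add: power2_eq_square power3_eq_cube field_simps)
  finally show ?thesis by simp
qed

text \<open>
With \<open>w = exp (7 y / 12)\<close>, and \<open>exp (- 2 y)\<close> enlarged to \<open>w\<^sup>-\<^sup>3\<close>, the left-hand side is at most
\<open>(w\<^sup>2 - 1) / w\<^sup>3\<close>.
\<close>

lemma near_rate_numeric:
  fixes y :: real assumes "0 \<le> y"
  shows "exp (- 2 * y) * (exp (7 / 6 * y) - 1) \<le> 7 / 18"
proof -
  define w where "w = exp (7 / 12 * y)"
  have w: "1 \<le> w" using assms by (simp add: w_def)
  have w2: "w\<^sup>2 = exp (7 / 6 * y)" and w3: "w ^ 3 = exp (7 / 4 * y)"
    by (simp_all add: w_def exp_of_nat_mult[symmetric])
  have "exp (- 2 * y) * (exp (7 / 6 * y) - 1) \<le> exp (- (7 / 4 * y)) * (w\<^sup>2 - 1)"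
    using assms unfolding w2 by (intro mult_right_mono) auto
  also have "\<dots> = (w\<^sup>2 - 1) / w ^ 3" by (simp add: w3 exp_minus field_simps)
  also have "\<dots> \<le> 7 / 18" using cubic_bound[OF w] w by (simp add: field_simps)
  finally show ?thesis .
qed

text \<open>
If \<open>\<pi> / 2\<close> were below \<open>25/16\<close>, the cosine of \<open>25/16\<close> would not be positive, contrary to its Taylor polynomial of
degree five with remainder.
\<close>

lemma pi_ge_25_8: "25 / 8 \<le> pi"
proof (rule ccontr)
  assume "\<not> 25 / 8 \<le> pi"
  then have "pi / 2 \<le> 25 / 16" by simp
  then have "cos (25 / 16) \<le> cos (pi / 2)"
    using pi_ge_two by (intro cos_monotone_0_pi_le) auto
  then have le: "cos (25 / 16 :: real) \<le> 0" by simp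
  obtain t where "cos (25 / 16 :: real) = (\<Sum>m<6. cos_coeff m * (25 / 16) ^ m)
      + (cos (t + 1 / 2 * real 6 * pi) / fact 6) * (25 / 16) ^ 6"
    using Maclaurin_cos_expansion[of "25 / 16" 6] by blast
  moreover have "(\<Sum>m<6. cos_coeff m * (25 / 16) ^ m) = (1 - (25 / 16)\<^sup>2 / 2 + (25 / 16) ^ 4 / 24 :: real)"
  proof -
    have "cos_coeff 0 = 1" "cos_coeff 1 = 0" "cos_coeff 2 = - 1 / 2" "cos_coeff 3 = 0"
      "cos_coeff 4 = 1 / 24" "cos_coeff 5 = 0"
      by (simp_all add: cos_coeff_def fact_numeral)
    moreover have "{..<6} = {0, 1, 2, 3, 4, 5 :: nat}" by auto
    ultimately show ?thesis by simp
  qed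
  moreover have "(- 1 / fact 6) * (25 / 16) ^ 6 \<le> (cos (t + 1 / 2 * real 6 * pi) / fact 6) * (25 / 16) ^ 6"
    by (intro mult_right_mono divide_right_mono cos_ge_minus_one) auto
  moreover have "0 < (1 - (25 / 16)\<^sup>2 / 2 + (25 / 16) ^ 4 / 24 + (- 1 / fact 6) * (25 / 16) ^ 6 :: real)"
    by (simp add: eval_nat_numeral)
  ultimately show False using le by linarith
qed

lemma sqrt_2_over_pi_le: "sqrt (2 / pi) \<le> 4 / 5"
proof (rule real_le_lsqrt)
  show "2 / pi \<le> (4 / 5)\<^sup>2" using pi_ge_25_8 by (simp add: power2_eq_square field_simps)
qed auto

text \<open>
The parabola is tangent to the line, at \<open>s = 35/16\<close>.
\<close>

lemma tail_le_square: "max 0 (16 / 7 * s - 5 / 2) \<le> 128 / 245 * (max 0 s)\<^sup>2" for s :: real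
proof (cases "0 \<le> s")
  case True
  have "0 \<le> (128 / 245) * (s - 35 / 16)\<^sup>2" by simp
  also have "\<dots> = 128 / 245 * s\<^sup>2 - (16 / 7 * s - 5 / 2)"
    by (simp add: power2_eq_square field_simps)
  finally have "16 / 7 * s - 5 / 2 \<le> 128 / 245 * s\<^sup>2" by simp
  then show ?thesis using True by (simp only: max.bounded_iff max_absorb2) simp
qed auto

text \<open>
In terms of \<open>u = r / T\<close> and \<open>u\<^sub>1 = R\<^sub>1 / T\<close>, the quotient of \<open>r \<Phi>'(r)\<close> and \<open>\<Phi>(r)\<close> is smallest at \<open>r = R\<^sub>1\<close>, where it
is at least \<open>u\<^sub>1 exp (- u\<^sub>1)\<close>.  As \<open>u\<^sub>1 = 5/2 (1 + R/T)\<close>, the prefactor \<open>1/20\<close> of the rate is absorbed because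
\<open>exp (5/2) \<le> 25/2\<close>.
\<close>

lemma far_rate:
  assumes T: "0 < T" and R: "0 \<le> R" and r: "0 \<le> r" and K: "0 < K" and R1: "R\<^sub>1 = 5 / 2 * (R + T)"
    and c: "c \<le> 1 / 20 * K * T\<^sup>2 * (1 + R / T) * exp (- 5 * R / (2 * T))"
  shows "c * capped_dist T R\<^sub>1 r \<le> K * T\<^sup>2 / 4 * (exp (- min r R\<^sub>1 / T) * r)"
proof -
  define \<kappa> where "\<kappa> = K * T\<^sup>2 / 4"
  define u\<^sub>1 where "u\<^sub>1 = R\<^sub>1 / T"
  have \<kappa>: "0 \<le> \<kappa>" using K by (simp add: \<kappa>_def)
  have u1: "u\<^sub>1 = 5 / 2 * (1 + R / T)" using T by (simp add: u\<^sub>1_def R1 field_simps)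
  have u1_pos: "0 < u\<^sub>1" using T R by (simp add: u1 add_pos_nonneg)
  have R1_pos: "0 < R\<^sub>1" using T R by (simp add: R1)
  have "- 5 * R / (2 * T) = 5 / 2 + - u\<^sub>1"
    using T by (simp add: u1 field_simps)
  then have "exp (- 5 * R / (2 * T)) = exp (5 / 2) * exp (- u\<^sub>1)"
    by (simp only: exp_add)
  also have "\<dots> \<le> 25 / 2 * exp (- u\<^sub>1)"
  proof (rule mult_right_mono)
    show "exp (5 / 2 :: real) \<le> 25 / 2"
      using exp_minus_five_halves_bounds(1) by (simp add: exp_minus field_simps)
  qed simp
  finally have E: "exp (- 5 * R / (2 * T)) \<le> 25 / 2 * exp (- u\<^sub>1)" .
  have "1 / 20 * K * T\<^sup>2 * (1 + R / T) = \<kappa> * 2 / 25 * u\<^sub>1"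
    by (simp add: \<kappa>_def u1)
  with c have "c \<le> \<kappa> * 2 / 25 * u\<^sub>1 * exp (- 5 * R / (2 * T))" by (simp only:)
  also have "\<dots> \<le> \<kappa> * 2 / 25 * u\<^sub>1 * (25 / 2 * exp (- u\<^sub>1))"
    using \<kappa> u1_pos E by (intro mult_left_mono) auto
  finally have c': "c \<le> \<kappa> * (u\<^sub>1 * exp (- u\<^sub>1))" by simp
  have core: "u\<^sub>1 * exp (- u\<^sub>1) * capped_dist T R\<^sub>1 r \<le> exp (- min r R\<^sub>1 / T) * r"
  proof (cases "r \<le> R\<^sub>1")
    case True
    define u where "u = r / T"
    have u: "0 \<le> u" "u \<le> u\<^sub>1" using T r True by (auto simp: u_def u\<^sub>1_def divide_right_mono)
    have "u\<^sub>1 * (exp u - 1) \<le> u * (exp u\<^sub>1 - 1)" by (rule expm1_chord[OF u])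
    also have "\<dots> \<le> u * exp u\<^sub>1" using u by (intro mult_left_mono) auto
    finally have "(exp (- u\<^sub>1) * exp (- u)) * (u\<^sub>1 * (exp u - 1)) \<le> (exp (- u\<^sub>1) * exp (- u)) * (u * exp u\<^sub>1)"
      by (intro mult_left_mono) auto
    then have "u\<^sub>1 * exp (- u\<^sub>1) * (1 - exp (- u)) \<le> exp (- u) * u"
      by (simp add: exp_minus field_simps)
    then have "T * (u\<^sub>1 * exp (- u\<^sub>1) * (1 - exp (- u))) \<le> T * (exp (- u) * u)"
      using T by (intro mult_left_mono) auto
    then show ?thesis using True T by (simp add: capped_dist_def u_def mult_ac)
  next
    case False
    have "u\<^sub>1 * exp (- u\<^sub>1) \<le> 1"
    proof -
      have "u\<^sub>1 \<le> exp u\<^sub>1" using exp_ge_add_one_self[of u\<^sub>1] by linarith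
      then show ?thesis by (simp add: exp_minus field_simps)
    qed
    then have "u\<^sub>1 * exp (- u\<^sub>1) * (r - R\<^sub>1) \<le> 1 * (r - R\<^sub>1)"
      using False by (intro mult_right_mono) auto
    moreover have "u\<^sub>1 * T * (1 - exp (- u\<^sub>1)) \<le> R\<^sub>1"
      using T R1_pos by (simp add: u\<^sub>1_def)
    ultimately have "u\<^sub>1 * T * (1 - exp (- u\<^sub>1)) + u\<^sub>1 * exp (- u\<^sub>1) * (r - R\<^sub>1) \<le> r" by simp
    then have "exp (- u\<^sub>1) * (u\<^sub>1 * T * (1 - exp (- u\<^sub>1)) + u\<^sub>1 * exp (- u\<^sub>1) * (r - R\<^sub>1)) \<le> exp (- u\<^sub>1) * r"
      by (intro mult_left_mono) auto
    moreover have cd: "capped_dist T R\<^sub>1 r = T * (1 - exp (- u\<^sub>1)) + (r - R\<^sub>1) * exp (- u\<^sub>1)"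
      and mn: "exp (- min r R\<^sub>1 / T) = exp (- u\<^sub>1)"
      using False by (simp_all add: capped_dist_def u\<^sub>1_def)
    ultimately show ?thesis unfolding cd mn by (simp add: algebra_simps)
  qed
  have "c * capped_dist T R\<^sub>1 r \<le> \<kappa> * (u\<^sub>1 * exp (- u\<^sub>1)) * capped_dist T R\<^sub>1 r"
    using c' capped_dist_nonneg[OF T R1_pos r] by (rule mult_right_mono)
  also have "\<dots> = \<kappa> * (u\<^sub>1 * exp (- u\<^sub>1) * capped_dist T R\<^sub>1 r)" by (simp add: mult_ac)
  also have "\<dots> \<le> \<kappa> * (exp (- min r R\<^sub>1 / T) * r)" using core \<kappa> by (rule mult_left_mono)
  finally show ?thesis by (simp add: \<kappa>_def)
qed

text \<open>
Up to \<open>R\<^sub>1\<close> the quotient of \<open>r \<Phi>'(r)\<close> and \<open>\<Phi>(r)\<close> decreases in \<open>r\<close>, so the worst case is \<open>r = 7 R / 6\<close>, and the claim becomes an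
inequality in \<open>y = R / T\<close> alone.  The two cases correspond to the two values of \<open>\<gamma>\<close>.
\<close>

lemma near_rate:
  assumes T: "0 < T" and R: "0 < R" and r: "0 \<le> r" "r \<le> 7 / 6 * R" and R1: "7 / 6 * R \<le> R\<^sub>1"
    and c: "c \<le> 1 / 10 * exp (- 2 * R / T)"
    and \<gamma>: "\<gamma> = min (1 / T) (1 / (4 * R))"
  shows "c * capped_dist T R\<^sub>1 r \<le> 2 / 15 * \<gamma> * T * r * exp (- r / T)"
proof -
  define y where "y = R / T"
  define u where "u = r / T"
  have y: "0 < y" using T R by (simp add: y_def)
  have u: "0 \<le> u" "u \<le> 7 / 6 * y" using T r by (auto simp: u_def y_def field_simps)
  have gT: "\<gamma> * T = min 1 (1 / (4 * y))" using T by (simp add: \<gamma> min_mult_distrib_right y_def)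
  have R1_pos: "0 < R\<^sub>1" using R1 R by linarith
  have *: "exp (- 2 * y) * (exp (7 / 6 * y) - 1) \<le> 4 / 3 * (\<gamma> * T) * (7 / 6 * y)"
  proof (cases "1 / (4 * y) \<le> 1")
    case True
    then have "\<gamma> * T = 1 / (4 * y)" using gT by simp
    then have "4 / 3 * (\<gamma> * T) * (7 / 6 * y) = 7 / 18" using y by simp
    then show ?thesis using near_rate_numeric[of y] y by simp
  next
    case False
    then have one: "\<gamma> * T = 1" using gT by simp
    have "1 - 7 / 6 * y \<le> exp (- (7 / 6 * y))" using exp_ge_add_one_self[of "- (7 / 6 * y)"] by simp
    then have "exp (7 / 6 * y) * (1 - 7 / 6 * y) \<le> exp (7 / 6 * y) * exp (- (7 / 6 * y))"
      by (intro mult_left_mono) auto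
    then have "exp (7 / 6 * y) - 1 \<le> 7 / 6 * y * exp (7 / 6 * y)"
      by (simp add: exp_add[symmetric] algebra_simps)
    then have "exp (- 2 * y) * (exp (7 / 6 * y) - 1) \<le> exp (- 2 * y) * (7 / 6 * y * exp (7 / 6 * y))"
      by (intro mult_left_mono) auto
    also have "\<dots> = 7 / 6 * y * exp (- (5 / 6 * y))" by (simp add: exp_add[symmetric])
    also have "\<dots> \<le> 7 / 6 * y * 1" using y by (intro mult_left_mono) auto
    also have "\<dots> \<le> 4 / 3 * (\<gamma> * T) * (7 / 6 * y)" using one y by simp
    finally show ?thesis .
  qed
  have "7 / 6 * y * (exp (- 2 * y) * (exp u - 1)) = exp (- 2 * y) * (7 / 6 * y * (exp u - 1))" by simp
  also have "\<dots> \<le> exp (- 2 * y) * (u * (exp (7 / 6 * y) - 1))"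
    using expm1_chord[OF u] by (intro mult_left_mono) auto
  also have "\<dots> = u * (exp (- 2 * y) * (exp (7 / 6 * y) - 1))" by simp
  also have "\<dots> \<le> u * (4 / 3 * (\<gamma> * T) * (7 / 6 * y))" using * u by (intro mult_left_mono)
  also have "\<dots> = 7 / 6 * y * (4 / 3 * (\<gamma> * T) * u)" by simp
  finally have "exp (- 2 * y) * (exp u - 1) \<le> 4 / 3 * (\<gamma> * T) * u"
    by (rule mult_left_le_imp_le) (use y in simp)
  then have "T * exp (- u) * (exp (- 2 * y) * (exp u - 1)) \<le> T * exp (- u) * (4 / 3 * (\<gamma> * T) * u)"
    using T by (intro mult_left_mono) auto
  then have "exp (- 2 * y) * (T * (1 - exp (- u))) \<le> 4 / 3 * \<gamma> * T * (T * u) * exp (- u)"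
    by (simp add: exp_minus field_simps)
  moreover have "capped_dist T R\<^sub>1 r = T * (1 - exp (- u))" using r R1 by (simp add: capped_dist_def u_def)
  moreover have "T * u = r" using T by (simp add: u_def)
  ultimately have "exp (- 2 * y) * capped_dist T R\<^sub>1 r \<le> 4 / 3 * \<gamma> * T * r * exp (- r / T)"
    by (simp add: u_def)
  moreover have "c * capped_dist T R\<^sub>1 r \<le> 1 / 10 * exp (- 2 * y) * capped_dist T R\<^sub>1 r"
    using c capped_dist_nonneg[OF T R1_pos r(1)] by (intro mult_right_mono) (auto simp: y_def)
  ultimately show ?thesis by simp
qed

section \<open>Expected decrease of the distance in one step\<close>

text \<open>
A majorant, in terms of the component \<open>s\<close> of the velocity along \<open>x - y\<close>, of the rejection probability times the loss
incurred by a rejection, in units of \<open>\<gamma> T r exp (- r / T)\<close>.  It is the expansion of \<open>(m + 7/48) (5/4 + 33/400 \<cdot> 128/245 m\<^sup>2)\<close> with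
\<open>m = max 0 s\<close>, except that \<open>s\<^sup>2\<close> replaces \<open>m\<^sup>2\<close>.
\<close>

definition reflection_cost :: "real \<Rightarrow> real" where
  "reflection_cost s = 35 / 192 + 5 / 4 * max 0 s + 22 / 3500 * s\<^sup>2 + 1056 / 24500 * (max 0 s) ^ 3"

locale hmc_convergence = lipschitz_force U L T
  for U :: "'a::euclidean_space \<Rightarrow> real" and L T :: real +
  fixes K R :: real
  assumes K_pos: "0 < K" and R_nonneg: "0 \<le> R"
    and LT_K: "L * T\<^sup>2 \<le> K / L"
    and LT_R: "R \<noteq> 0 \<Longrightarrow> L * T\<^sup>2 \<le> 1 / (256 * L * R\<^sup>2)"
    and convex_outside: "\<And>x y. norm (x - y) \<ge> R \<Longrightarrow>
      (x - y) \<bullet> (gradient U x - gradient U y) \<ge> K * (norm (x - y))\<^sup>2"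
begin

definition R\<^sub>1 :: real where "R\<^sub>1 = 5 / 2 * (R + T)"

definition rate :: real where
  "rate = 1 / 10 * min 1 (1 / 2 * K * T\<^sup>2 * (1 + R / T) * exp (- R / (2 * T))) * exp (- 2 * R / T)"

definition \<gamma> :: real where "\<gamma> = min (1 / T) (1 / (4 * R))"

text \<open>
The translation to be attempted in the velocity of the second particle.  Beyond the distance \<open>7 R / 6\<close> it is zero,
which gives equal velocities.
\<close>

definition shift :: "'a \<Rightarrow> 'a \<Rightarrow> 'a" where
  "shift x y = (if norm (x - y) < 7 / 6 * R then \<gamma> *\<^sub>R (x - y) else 0)"

abbreviation \<Phi> :: "real \<Rightarrow> real" where "\<Phi> \<equiv> capped_dist T R\<^sub>1"

lemma R1_pos: "0 < R\<^sub>1"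
  using R_nonneg T_pos by (simp add: R\<^sub>1_def)

lemma shift_measurable [measurable]:
  assumes [measurable]: "f \<in> borel_measurable M" "g \<in> borel_measurable M"
  shows "(\<lambda>z. shift (f z) (g z)) \<in> borel_measurable M"
  unfolding shift_def by measurable

lemma rate_le: "rate \<le> 1 / 20 * K * T\<^sup>2 * (1 + R / T) * exp (- 5 * R / (2 * T))"
    "rate \<le> 1 / 10 * exp (- 2 * R / T)"
    and rate_pos: "0 < rate"
proof -
  let ?x = "1 / 2 * K * T\<^sup>2 * (1 + R / T) * exp (- R / (2 * T))"
  have "- R / (2 * T) + - 2 * R / T = - 5 * R / (2 * T)" using T_pos by (simp add: field_simps)
  then have e: "exp (- R / (2 * T)) * exp (- 2 * R / T) = exp (- 5 * R / (2 * T))"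
    by (simp only: exp_add[symmetric])
  have "rate \<le> 1 / 10 * ?x * exp (- 2 * R / T)"
    unfolding rate_def by (intro mult_right_mono mult_left_mono min.cobounded2) auto
  also have "\<dots> = 1 / 20 * K * T\<^sup>2 * (1 + R / T) * (exp (- R / (2 * T)) * exp (- 2 * R / T))" by simp
  finally show "rate \<le> 1 / 20 * K * T\<^sup>2 * (1 + R / T) * exp (- 5 * R / (2 * T))"
    unfolding e .
  have "rate \<le> 1 / 10 * 1 * exp (- 2 * R / T)"
    unfolding rate_def by (intro mult_right_mono mult_left_mono) auto
  then show "rate \<le> 1 / 10 * exp (- 2 * R / T)" by simp
  have "0 < ?x" using K_pos T_pos R_nonneg by (intro mult_pos_pos add_pos_nonneg) auto
  then show "0 < rate" unfolding rate_def by (intro mult_pos_pos) auto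
qed

text \<open>
The contraction of the distance outside the non-convex region, inserted into the tangent inequality.
\<close>

lemma far_drift:
  assumes far: "7 / 6 * R \<le> norm (x - y)"
  shows "\<Phi> (norm (hmc_position U T x v - hmc_position U T y v)) \<le> (1 - rate) * \<Phi> (norm (x - y))"
proof -
  let ?r = "norm (x - y)" and ?r' = "norm (hmc_position U T x v - hmc_position U T y v)"
  have contr: "?r' \<le> (1 - K * T\<^sup>2 / 4) * ?r"
    using hmc_position_convex_contraction[OF K_pos LT_K convex_outside] far by auto
  have "\<Phi> ?r' \<le> \<Phi> ?r - exp (- min ?r R\<^sub>1 / T) * (?r - ?r')"
    using T_pos by (intro capped_dist_tangent) auto
  also have "\<dots> \<le> \<Phi> ?r - exp (- min ?r R\<^sub>1 / T) * (K * T\<^sup>2 / 4 * ?r)"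
    using contr by (intro diff_left_mono mult_left_mono) (auto simp: algebra_simps)
  also have "\<dots> \<le> \<Phi> ?r - rate * \<Phi> ?r"
    using far_rate[OF T_pos R_nonneg _ K_pos R\<^sub>1_def rate_le(1), of ?r] by (simp add: mult_ac)
  finally show ?thesis by (simp add: algebra_simps)
qed

text \<open>
The hypothesis \<open>L T\<^sup>2 \<le> 1 / (256 L R\<^sup>2)\<close> says \<open>L T R \<le> 1/16\<close>.  The last bound makes the effect of the force small
compared with the attraction \<open>\<gamma> T\<close> obtained from the velocities.
\<close>

lemma \<gamma>_bounds:
  assumes "0 < R"
  shows "0 < \<gamma>" "\<gamma> * T \<le> 1" "\<gamma> * R \<le> 1 / 4" "L * T\<^sup>2 \<le> \<gamma> * T / 4"
proof -
  show "0 < \<gamma>" using assms T_pos by (simp add: \<gamma>_def)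
  have "\<gamma> \<le> 1 / T" "\<gamma> \<le> 1 / (4 * R)" by (auto simp: \<gamma>_def)
  then show "\<gamma> * T \<le> 1" "\<gamma> * R \<le> 1 / 4" using T_pos assms by (auto simp: field_simps)
  have "(16 * (L * T * R))\<^sup>2 \<le> 1\<^sup>2"
    using LT_R assms L_pos by (simp add: field_simps power2_eq_square)
  then have "16 * (L * T * R) \<le> 1" by (rule power2_le_imp_le) simp
  then have "T * (16 * (L * T * R)) \<le> T * 1" using T_pos by (intro mult_left_mono) auto
  then have "L * T\<^sup>2 \<le> T / (16 * R)" using assms by (simp add: field_simps power2_eq_square)
  then show "L * T\<^sup>2 \<le> \<gamma> * T / 4"
    using LT T_pos by (auto simp: \<gamma>_def min_def)
qed

text \<open>
Free flight brings the particles from distance \<open>r\<close> to \<open>(1 - \<gamma> T) r\<close>; the force adds at most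
\<open>4/7 L T\<^sup>2 r \<le> \<gamma> T r / 7\<close>.
\<close>

lemma near_shifted:
  assumes R: "0 < R" and near: "norm (x - y) \<le> 7 / 6 * R"
  shows "\<Phi> (norm (hmc_position U T x \<xi> - hmc_position U T y (\<xi> + \<gamma> *\<^sub>R (x - y))))
    \<le> \<Phi> (norm (x - y)) - 6 / 7 * \<gamma> * T * norm (x - y) * exp (- norm (x - y) / T)"
proof -
  let ?r = "norm (x - y)" and ?d = "hmc_position U T x \<xi> - hmc_position U T y (\<xi> + \<gamma> *\<^sub>R (x - y))"
  note g = \<gamma>_bounds[OF R]
  have w: "(x - y) + T *\<^sub>R (\<xi> - (\<xi> + \<gamma> *\<^sub>R (x - y))) = (1 - \<gamma> * T) *\<^sub>R (x - y)"
    by (simp add: algebra_simps)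
  have nw: "norm ((1 - \<gamma> * T) *\<^sub>R (x - y)) = (1 - \<gamma> * T) * ?r" using g by simp
  have "0 \<le> \<gamma> * T" using g(1) T_pos by simp
  then have le: "(1 - \<gamma> * T) * ?r \<le> 1 * ?r" using g by (intro mult_right_mono) auto
  have "norm (?d - (1 - \<gamma> * T) *\<^sub>R (x - y)) \<le> 4 / 7 * (L * T\<^sup>2) * max ?r ((1 - \<gamma> * T) * ?r)"
    using hmc_position_endpoint_bound[of x \<xi> y "\<xi> + \<gamma> *\<^sub>R (x - y)"] unfolding w nw .
  also have "max ?r ((1 - \<gamma> * T) * ?r) = ?r" using le by simp
  also have "4 / 7 * (L * T\<^sup>2) * ?r \<le> 4 / 7 * (\<gamma> * T / 4) * ?r"
    using g by (intro mult_right_mono mult_left_mono) auto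
  finally have "norm (?d - (1 - \<gamma> * T) *\<^sub>R (x - y)) \<le> \<gamma> * T / 7 * ?r" by (simp add: mult_ac)
  moreover have "norm ?d \<le> norm ((1 - \<gamma> * T) *\<^sub>R (x - y)) + norm (?d - (1 - \<gamma> * T) *\<^sub>R (x - y))"
    by (rule norm_triangle_sub)
  ultimately have d: "6 / 7 * \<gamma> * T * ?r \<le> ?r - norm ?d" unfolding nw by (simp add: algebra_simps)
  have min: "min ?r R\<^sub>1 = ?r" using near R T_pos by (simp add: R\<^sub>1_def)
  have "\<Phi> (norm ?d) \<le> \<Phi> ?r - exp (- min ?r R\<^sub>1 / T) * (?r - norm ?d)"
    using T_pos by (intro capped_dist_tangent) auto
  also have "\<dots> \<le> \<Phi> ?r - exp (- ?r / T) * (6 / 7 * \<gamma> * T * ?r)"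
    unfolding min using d by (intro diff_left_mono mult_left_mono) auto
  finally show ?thesis by (simp add: mult_ac)
qed

text \<open>
After a reflection the difference of the velocities is \<open>2 s\<close> along \<open>x - y\<close>, so free flight leads to the distance
\<open>r + 2 T s\<close>.  A translate is rejected only if \<open>s\<close> is at least \<open>- \<gamma> r / 2\<close>, hence the particles do not pass each other.
\<close>

lemma near_reflected:
  assumes R: "0 < R" and near: "norm (x - y) \<le> 7 / 6 * R" and ne: "x \<noteq> y"
    and s: "s = \<xi> \<bullet> (x - y) / norm (x - y)" "- (\<gamma> * norm (x - y) / 2) \<le> s"
  shows "\<Phi> (norm (hmc_position U T x \<xi> - hmc_position U T y (reflect (\<gamma> *\<^sub>R (x - y)) \<xi>)))
    \<le> \<Phi> (norm (x - y)) + T * exp (- norm (x - y) / T) * (1 + exp (- 5 / 2) * max 0 (16 / 7 * s - 5 / 2))"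
proof -
  let ?r = "norm (x - y)" and ?h = "\<gamma> *\<^sub>R (x - y)"
  let ?d = "hmc_position U T x \<xi> - hmc_position U T y (reflect ?h \<xi>)"
  note g = \<gamma>_bounds[OF R]
  have r: "0 < ?r" using ne by simp
  have sr: "\<xi> \<bullet> (x - y) = s * ?r" using r by (simp add: s(1))
  have refl: "\<xi> - reflect ?h \<xi> = (2 * s / ?r) *\<^sub>R (x - y)"
  proof -
    have "?h \<bullet> ?h = \<gamma>\<^sup>2 * ?r\<^sup>2"
      by (simp add: dot_square_norm power_mult_distrib)
    moreover have "\<xi> \<bullet> ?h = \<gamma> * (s * ?r)" by (simp add: sr)
    ultimately have "\<xi> - reflect ?h \<xi> = (2 * (\<gamma> * (s * ?r)) / (\<gamma>\<^sup>2 * ?r\<^sup>2) * \<gamma>) *\<^sub>R (x - y)"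
      by (simp add: reflect_def)
    also have "2 * (\<gamma> * (s * ?r)) / (\<gamma>\<^sup>2 * ?r\<^sup>2) * \<gamma> = 2 * s / ?r"
      using g(1) r by (simp add: field_simps power2_eq_square)
    finally show ?thesis .
  qed
  have w: "(x - y) + T *\<^sub>R (\<xi> - reflect ?h \<xi>) = ((?r + 2 * T * s) / ?r) *\<^sub>R (x - y)"
    unfolding refl using r by (simp add: add_divide_distrib scaleR_left_distrib)
  have "\<gamma> * T * ?r \<le> 1 * ?r" using g(2) by (intro mult_right_mono) auto
  moreover have "2 * T * (- (\<gamma> * ?r / 2)) \<le> 2 * T * s" using s(2) T_pos by (intro mult_left_mono) auto
  ultimately have nn: "0 \<le> ?r + 2 * T * s" by (simp add: algebra_simps)
  have nw: "norm (((?r + 2 * T * s) / ?r) *\<^sub>R (x - y)) = ?r + 2 * T * s"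
    using nn r by simp
  have "norm ?d \<le> 8 / 7 * max ?r (?r + 2 * T * s)"
    using hmc_position_bound[of x \<xi> y "reflect ?h \<xi>"] unfolding w nw .
  also have "max ?r (?r + 2 * T * s) = ?r + 2 * T * max 0 s"
    using T_pos by (auto simp: max_def zero_le_mult_iff)
  finally have d: "norm ?d \<le> 8 / 7 * ?r + 16 / 7 * T * max 0 s" by (simp add: algebra_simps)
  have "norm ?d - R\<^sub>1 \<le> T * (16 / 7 * max 0 s - 5 / 2)"
  proof -
    have "T * (16 / 7 * max 0 s - 5 / 2) = 16 / 7 * T * max 0 s - 5 / 2 * T"
      by (simp add: right_diff_distrib)
    moreover have "R\<^sub>1 = 5 / 2 * R + 5 / 2 * T" by (simp add: R\<^sub>1_def)
    ultimately show ?thesis using d near R by linarith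
  qed
  also have "\<dots> \<le> T * max 0 (16 / 7 * s - 5 / 2)"
    using T_pos by (intro mult_left_mono) (auto simp: max_def)
  finally have "max 0 (norm ?d - R\<^sub>1) \<le> T * max 0 (16 / 7 * s - 5 / 2)"
    using T_pos by simp
  moreover have "exp (- R\<^sub>1 / T) \<le> exp (- 5 / 2) * exp (- ?r / T)"
    unfolding exp_add[symmetric] using near T_pos R by (simp add: R\<^sub>1_def field_simps)
  ultimately have "max 0 (norm ?d - R\<^sub>1) * exp (- R\<^sub>1 / T)
      \<le> (T * max 0 (16 / 7 * s - 5 / 2)) * (exp (- 5 / 2) * exp (- ?r / T))"
    using T_pos by (intro mult_mono) auto
  moreover have "\<Phi> (norm ?d) \<le> \<Phi> ?r + T * exp (- ?r / T) + max 0 (norm ?d - R\<^sub>1) * exp (- R\<^sub>1 / T)"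
    using near R T_pos by (intro capped_dist_jump) (auto simp: R\<^sub>1_def)
  ultimately show ?thesis by (simp add: algebra_simps)
qed

text \<open>
The rejection probability \<open>1 - p\<close> is at most \<open>\<gamma> r (max 0 s + \<gamma> r / 2)\<close>, by \<open>1 - exp (- t) \<le> t\<close>.  A rejection costs the
missed gain of the shifted velocities plus the loss from the reflection; the product of both factors is bounded by
\<open>reflection_cost\<close>.
\<close>

lemma near_pointwise:
  fixes \<xi> :: 'a
  assumes R: "0 < R" and near: "norm (x - y) \<le> 7 / 6 * R" and ne: "x \<noteq> y"
  defines "r \<equiv> norm (x - y)"
  defines "h \<equiv> \<gamma> *\<^sub>R (x - y)"
  defines "p \<equiv> min 1 (exp (- (\<xi> \<bullet> h) - (norm h)\<^sup>2 / 2))"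
  shows "p * \<Phi> (norm (hmc_position U T x \<xi> - hmc_position U T y (\<xi> + h)))
      + (1 - p) * \<Phi> (norm (hmc_position U T x \<xi> - hmc_position U T y (reflect h \<xi>)))
    \<le> \<Phi> r - 6 / 7 * \<gamma> * T * r * exp (- r / T) + \<gamma> * T * r * exp (- r / T) * reflection_cost (\<xi> \<bullet> ((x - y) /\<^sub>R r))"
    (is "p * ?A + (1 - p) * ?B \<le> _")
proof -
  define s where "s = \<xi> \<bullet> ((x - y) /\<^sub>R r)"
  define E where "E = exp (- r / T)"
  define \<theta> where "\<theta> = max 0 (16 / 7 * s - 5 / 2)"
  define m where "m = max 0 s"
  note g = \<gamma>_bounds[OF R]
  have r: "0 < r" using ne by (simp add: r_def)
  have \<theta>: "0 \<le> \<theta>" "\<theta> \<le> 128 / 245 * m\<^sup>2" using tail_le_square[of s] by (auto simp: \<theta>_def m_def)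
  have m: "0 \<le> m" "m\<^sup>2 \<le> s\<^sup>2" by (auto simp: m_def max_def)
  have s_eq: "s = \<xi> \<bullet> (x - y) / norm (x - y)" by (simp add: s_def r_def divide_inverse mult.commute)
  have gr: "0 < \<gamma> * r" "\<gamma> * r \<le> 7 / 24"
  proof -
    show "0 < \<gamma> * r" using g(1) r by simp
    have "\<gamma> * r \<le> \<gamma> * (7 / 6 * R)" using near g(1) by (intro mult_left_mono) (auto simp: r_def)
    then show "\<gamma> * r \<le> 7 / 24" using g(3) by simp
  qed
  have hp: "\<xi> \<bullet> h = \<gamma> * r * s" "norm h = \<gamma> * r"
    using g(1) r by (auto simp: h_def s_def r_def)
  define t where "t = \<gamma> * r * (s + \<gamma> * r / 2)"
  have p: "p = min 1 (exp (- t))"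
    unfolding p_def hp t_def by (rule arg_cong2[where f = min]) (auto simp: algebra_simps power2_eq_square)
  have p01: "0 \<le> p" "p \<le> 1" by (auto simp: p)
  have A: "?A \<le> \<Phi> r - 6 / 7 * (\<gamma> * T * r * E)"
    using near_shifted[OF R near, of \<xi>] by (simp add: h_def r_def E_def mult.assoc)
  \<comment> \<open>For \<open>t < 0\<close> the reflected velocity may lead anywhere, but then it has weight zero.\<close>
  have B: "(1 - p) * ?B \<le> (1 - p) * (\<Phi> r + T * E * (1 + exp (- 5 / 2) * \<theta>))"
  proof (cases "0 \<le> t")
    case True
    then have "0 \<le> s + \<gamma> * r / 2" using gr(1) by (simp add: t_def zero_le_mult_iff)
    then have "- (\<gamma> * norm (x - y) / 2) \<le> s" by (simp add: r_def)
    from near_reflected[OF R near ne s_eq this] show ?thesis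
      using p01 by (intro mult_left_mono) (auto simp: h_def r_def E_def \<theta>_def)
  next
    case False
    then have "p = 1" by (simp add: p)
    then show ?thesis by simp
  qed
  have q: "1 - p \<le> \<gamma> * r * (m + 7 / 48)"
  proof -
    have "1 - p \<le> max 0 t"
      using exp_ge_add_one_self[of "- t"] by (auto simp: p min_def max_def)
    also have "t \<le> \<gamma> * r * (m + 7 / 48)"
    proof -
      have "\<gamma> * r / 2 \<le> 7 / 48" using gr(2) by linarith
      then show ?thesis
        unfolding t_def using gr(1) by (intro mult_left_mono add_mono) (auto simp: m_def)
    qed
    then have "max 0 t \<le> \<gamma> * r * (m + 7 / 48)" using gr(1) m by simp
    finally show ?thesis .
  qed
  have e: "exp (- 5 / 2) * \<theta> \<le> 33 / 400 * (128 / 245 * m\<^sup>2)"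
    using \<theta> exp_minus_five_halves_bounds(2) by (intro mult_mono) auto
  have "(1 - p) * (6 / 7 * (\<gamma> * r) + 1 + exp (- 5 / 2) * \<theta>)
      \<le> \<gamma> * r * (m + 7 / 48) * (5 / 4 + 33 / 400 * (128 / 245 * m\<^sup>2))"
    using q gr m e p01 \<theta> by (intro mult_mono) auto
  also have "\<dots> = \<gamma> * r * (35 / 192 + 5 / 4 * m + 22 / 3500 * m\<^sup>2 + 1056 / 24500 * m ^ 3)"
    by (simp add: algebra_simps power2_eq_square power3_eq_cube)
  also have "\<dots> \<le> \<gamma> * r * reflection_cost s"
    unfolding reflection_cost_def m_def[symmetric] using gr m by (intro mult_left_mono) auto
  finally have G: "(1 - p) * (6 / 7 * (\<gamma> * r) + 1 + exp (- 5 / 2) * \<theta>) \<le> \<gamma> * r * reflection_cost s" .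
  have TE: "0 \<le> T * E" using T_pos by (simp add: E_def)
  have "p * ?A + (1 - p) * ?B \<le> p * (\<Phi> r - 6 / 7 * (\<gamma> * T * r * E)) + (1 - p) * (\<Phi> r + T * E * (1 + exp (- 5 / 2) * \<theta>))"
    using mult_left_mono[OF A p01(1)] B by linarith
  also have "\<dots> = \<Phi> r - 6 / 7 * (\<gamma> * T * r * E) + (T * E) * ((1 - p) * (6 / 7 * (\<gamma> * r) + 1 + exp (- 5 / 2) * \<theta>))"
    by (simp add: field_simps)
  also have "\<dots> \<le> \<Phi> r - 6 / 7 * (\<gamma> * T * r * E) + (T * E) * (\<gamma> * r * reflection_cost s)"
    using mult_left_mono[OF G TE] by simp
  finally show ?thesis by (simp add: E_def s_def mult_ac)
qed

text \<open>
At short distance the pointwise bound depends on the velocity only through its component along \<open>x - y\<close>, which is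
standard normal.  Its mean loss, with \<open>sqrt (2 / \<pi>) \<le> 4/5\<close>, is below \<open>6/7 - 2/15\<close>, so a gain of
\<open>2/15 \<gamma> T r exp (- r / T)\<close> remains.
\<close>

lemma drift:
  "(\<integral>\<^sup>+ \<xi>. \<integral>\<^sup>+ u. ennreal (\<Phi> (norm (hmc_position U T x \<xi>
      - hmc_position U T y (velocity_coupling (shift x y) \<xi> u)))) \<partial>unit_uniform \<partial>std_gaussian)
    \<le> ennreal ((1 - rate) * \<Phi> (norm (x - y)))"
    (is "?I \<le> _")
proof (cases "norm (x - y) < 7 / 6 * R \<and> x \<noteq> y")
  case False
  have "norm (x - y) < 7 / 6 * R \<Longrightarrow> x = y" using False by blast
  then have sh: "shift x y = 0" by (auto simp: shift_def)
  have "?I = (\<integral>\<^sup>+ \<xi>. \<integral>\<^sup>+ u. ennreal (\<Phi> (norm (hmc_position U T x \<xi> - hmc_position U T y \<xi>))) \<partial>unit_uniform \<partial>std_gaussian)"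
    by (simp add: sh velocity_coupling_def reflect_def cong: if_cong)
  also have "\<dots> = (\<integral>\<^sup>+ \<xi>. ennreal (\<Phi> (norm (hmc_position U T x \<xi> - hmc_position U T y \<xi>))) \<partial>std_gaussian)"
    using unit_uniform.emeasure_space_1 by simp
  also have "\<dots> \<le> (\<integral>\<^sup>+ \<xi>. ennreal ((1 - rate) * \<Phi> (norm (x - y))) \<partial>(std_gaussian :: 'a measure))"
  proof (intro nn_integral_mono ennreal_leI)
    fix \<xi> :: 'a
    show "\<Phi> (norm (hmc_position U T x \<xi> - hmc_position U T y \<xi>)) \<le> (1 - rate) * \<Phi> (norm (x - y))"
      using False far_drift[of x y \<xi>] R1_pos by (cases "x = y") (auto simp: capped_dist_0)
  qed
  also have "\<dots> = ennreal ((1 - rate) * \<Phi> (norm (x - y)))"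
    using prob_space.emeasure_space_1[OF prob_space_std_gaussian[where 'a = 'a]] by simp
  finally show ?thesis .
next
  case True
  then have near: "norm (x - y) \<le> 7 / 6 * R" and ne: "x \<noteq> y" by auto
  have R: "0 < R" using True norm_ge_zero[of "x - y"] by linarith
  note g = \<gamma>_bounds[OF R]
  define r where "r = norm (x - y)"
  define h where "h = \<gamma> *\<^sub>R (x - y)"
  define p where "p \<xi> = exp (- (\<xi> \<bullet> h) - (norm h)\<^sup>2 / 2)" for \<xi>
  define A where "A \<xi> = \<Phi> (norm (hmc_position U T x \<xi> - hmc_position U T y (\<xi> + h)))" for \<xi>
  define B where "B \<xi> = \<Phi> (norm (hmc_position U T x \<xi> - hmc_position U T y (reflect h \<xi>)))" for \<xi>
  define e where "e = (x - y) /\<^sub>R r"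
  define k where "k = \<gamma> * T * r * exp (- r / T)"
  define b where "b = \<Phi> r - 6 / 7 * k"
  have sh: "shift x y = h" using True by (simp add: shift_def h_def)
  have r: "0 < r" using ne by (simp add: r_def)
  have e: "norm e = 1" using r by (simp add: e_def r_def)
  have k: "0 \<le> k" using g(1) T_pos r by (simp add: k_def)
  have nn: "0 \<le> A \<xi>" "0 \<le> B \<xi>" for \<xi>
    using T_pos R1_pos by (auto simp: A_def B_def intro: capped_dist_nonneg)
  have b: "0 \<le> b"
    using nn(1)[of 0] near_shifted[OF R near, of 0] by (simp add: A_def b_def k_def r_def h_def mult.assoc)
  have "?I = (\<integral>\<^sup>+ \<xi>. \<integral>\<^sup>+ u. (if u \<le> p \<xi> then ennreal (A \<xi>) else ennreal (B \<xi>)) \<partial>unit_uniform \<partial>std_gaussian)"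
    by (intro nn_integral_cong) (simp add: sh velocity_coupling_def p_def A_def B_def)
  also have "\<dots> = (\<integral>\<^sup>+ \<xi>. ennreal (min 1 (p \<xi>) * A \<xi> + (1 - min 1 (p \<xi>)) * B \<xi>) \<partial>std_gaussian)"
  proof (rule nn_integral_cong)
    fix \<xi> :: 'a
    have "0 \<le> p \<xi>" by (simp add: p_def)
    then show "(\<integral>\<^sup>+ u. (if u \<le> p \<xi> then ennreal (A \<xi>) else ennreal (B \<xi>)) \<partial>unit_uniform)
        = ennreal (min 1 (p \<xi>) * A \<xi> + (1 - min 1 (p \<xi>)) * B \<xi>)"
      using nn[of \<xi>] by (subst nn_integral_unit_uniform_threshold) (auto simp: ennreal_mult)
  qed
  also have "\<dots> \<le> (\<integral>\<^sup>+ \<xi>. ennreal (b + k * reflection_cost (\<xi> \<bullet> e)) \<partial>std_gaussian)"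
    using near_pointwise[OF R near ne] unfolding A_def B_def p_def h_def b_def k_def r_def e_def
    by (intro nn_integral_mono ennreal_leI) (simp add: mult.assoc)
  also have "\<dots> = (\<integral>\<^sup>+ s. ennreal (std_normal_density s) * ennreal (b + k * reflection_cost s) \<partial>lborel)"
    by (rule nn_integral_std_gaussian_direction[OF e, of "\<lambda>s. ennreal (b + k * reflection_cost s)"])
      (unfold reflection_cost_def, measurable)
  also have "\<dots> = (\<integral>\<^sup>+ s. ennreal (std_normal_density s) * ennreal ((b + k * (35 / 192)) + (k * (5 / 4)) * max 0 s
      + (k * (22 / 3500)) * s\<^sup>2 + (k * (1056 / 24500)) * (max 0 s) ^ 3) \<partial>lborel)"
    by (intro nn_integral_cong) (simp add: reflection_cost_def algebra_simps)
  also have "\<dots> = ennreal ((b + k * (35 / 192)) + (k * (5 / 4)) * (sqrt (2 / pi) / 2)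
      + (k * (22 / 3500)) + (k * (1056 / 24500)) * sqrt (2 / pi))"
    using b k by (intro nn_integral_std_normal_cubic) auto
  also have "\<dots> \<le> ennreal ((1 - rate) * \<Phi> (norm (x - y)))"
  proof (rule ennreal_leI)
    have "k * sqrt (2 / pi) \<le> k * (4 / 5)"
      using k sqrt_2_over_pi_le by (rule mult_left_mono[rotated])
    then have "(b + k * (35 / 192)) + (k * (5 / 4)) * (sqrt (2 / pi) / 2)
      + (k * (22 / 3500)) + (k * (1056 / 24500)) * sqrt (2 / pi) \<le> \<Phi> r - 2 / 15 * k"
      using k by (simp add: b_def)
    also have "2 / 15 * k = 2 / 15 * \<gamma> * T * r * exp (- r / T)" by (simp add: k_def)
    also have "\<Phi> r - \<dots> \<le> \<Phi> r - rate * \<Phi> r"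
      using near_rate[OF T_pos R, of r R\<^sub>1 rate \<gamma>] r near rate_le(2) R T_pos
      by (simp add: r_def R\<^sub>1_def \<gamma>_def)
    finally show "(b + k * (35 / 192)) + (k * (5 / 4)) * (sqrt (2 / pi) / 2)
      + (k * (22 / 3500)) + (k * (1056 / 24500)) * sqrt (2 / pi) \<le> (1 - rate) * \<Phi> (norm (x - y))"
      by (simp add: r_def algebra_simps)
  qed
  finally show ?thesis .
qed

end

section \<open>Contraction of Kantorovich distances\<close>

text \<open>
Division by \<open>k\<close> moves the constant to the other side, where the greatest lower bound can be tested.
\<close>

lemma le_ennreal_mult_INF:
  fixes a :: ennreal and k :: real
  assumes "0 < k" and le: "\<And>i. i \<in> I \<Longrightarrow> a \<le> ennreal k * f i"
  shows "a \<le> ennreal k * (INF i\<in>I. f i)"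
proof -
  have cancel: "ennreal k * (ennreal (1 / k) * b) = b" "ennreal (1 / k) * (ennreal k * b) = b" for b
    using \<open>0 < k\<close> by (simp_all add: mult.assoc[symmetric] ennreal_mult[symmetric])
  have "ennreal (1 / k) * a \<le> (INF i\<in>I. f i)"
  proof (rule INF_greatest)
    fix i assume "i \<in> I"
    from mult_left_mono[OF le[OF this], of "ennreal (1 / k)"] show "ennreal (1 / k) * a \<le> f i"
      by (simp add: cancel)
  qed
  from mult_left_mono[OF this, of "ennreal k"] show ?thesis by (simp add: cancel)
qed

context hmc_convergence
begin

text \<open>
All randomness is produced by a Gaussian velocity and an independent uniform variable, so that a coupling of two initial
laws is carried to a coupling of the next ones by the image under a single measurable map.
\<close>

definition coupled_step :: "('a \<times> 'a) \<times> ('a \<times> real) \<Rightarrow> 'a \<times> 'a" where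
  "coupled_step w = (let x = fst (fst w); y = snd (fst w); \<xi> = fst (snd w); u = snd (snd w)
    in (hmc_position U T x \<xi>, hmc_position U T y (velocity_coupling (shift x y) \<xi> u)))"

lemma coupled_step_measurable [measurable]:
  "coupled_step \<in> (borel \<Otimes>\<^sub>M borel) \<Otimes>\<^sub>M (borel \<Otimes>\<^sub>M borel) \<rightarrow>\<^sub>M borel \<Otimes>\<^sub>M borel"
  unfolding coupled_step_def[abs_def] Let_def by measurable

definition coupled_law :: "('a \<times> 'a) measure \<Rightarrow> ('a \<times> 'a) measure" where
  "coupled_law \<Gamma> = distr (\<Gamma> \<Otimes>\<^sub>M (std_gaussian \<Otimes>\<^sub>M unit_uniform)) (borel \<Otimes>\<^sub>M borel) coupled_step"

lemma nn_integral_coupled_law: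
  assumes \<Gamma>: "prob_space \<Gamma>" and [measurable_cong]: "sets \<Gamma> = sets (borel \<Otimes>\<^sub>M borel)"
    and [measurable]: "g \<in> borel_measurable (borel \<Otimes>\<^sub>M borel)"
  shows "(\<integral>\<^sup>+ z. g z \<partial>coupled_law \<Gamma>)
    = (\<integral>\<^sup>+ z. \<integral>\<^sup>+ \<xi>. \<integral>\<^sup>+ u. g (coupled_step (z, (\<xi>, u))) \<partial>unit_uniform \<partial>std_gaussian \<partial>\<Gamma>)"
proof -
  interpret \<Gamma>: prob_space \<Gamma> by (rule \<Gamma>)
  interpret N: pair_prob_space "std_gaussian :: 'a measure" unit_uniform ..
  have "(\<integral>\<^sup>+ z. g z \<partial>coupled_law \<Gamma>)
      = (\<integral>\<^sup>+ w. g (coupled_step w) \<partial>(\<Gamma> \<Otimes>\<^sub>M (std_gaussian \<Otimes>\<^sub>M unit_uniform)))"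
    unfolding coupled_law_def by (rule nn_integral_distr) measurable
  also have "\<dots> = (\<integral>\<^sup>+ z. \<integral>\<^sup>+ n. g (coupled_step (z, n)) \<partial>(std_gaussian \<Otimes>\<^sub>M unit_uniform) \<partial>\<Gamma>)"
    by (rule N.nn_integral_fst[symmetric]) measurable
  also have "\<dots> = (\<integral>\<^sup>+ z. \<integral>\<^sup>+ \<xi>. \<integral>\<^sup>+ u. g (coupled_step (z, (\<xi>, u))) \<partial>unit_uniform \<partial>std_gaussian \<partial>\<Gamma>)"
  proof (rule nn_integral_cong)
    fix z assume z: "z \<in> space \<Gamma>"
    have m: "(\<lambda>w. g (coupled_step w)) \<in> borel_measurable (\<Gamma> \<Otimes>\<^sub>M (std_gaussian \<Otimes>\<^sub>M unit_uniform))"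
      by measurable
    show "(\<integral>\<^sup>+ n. g (coupled_step (z, n)) \<partial>(std_gaussian \<Otimes>\<^sub>M unit_uniform))
        = (\<integral>\<^sup>+ \<xi>. \<integral>\<^sup>+ u. g (coupled_step (z, (\<xi>, u))) \<partial>unit_uniform \<partial>std_gaussian)"
      by (rule unit_uniform.nn_integral_fst[symmetric]) (rule measurable_Pair2[OF m z])
  qed
  finally show ?thesis .
qed

lemma couplings_measurable_projections:
  assumes "sets \<Gamma> = sets (borel \<Otimes>\<^sub>M borel)"
  shows "fst \<in> \<Gamma> \<rightarrow>\<^sub>M borel" "snd \<in> \<Gamma> \<rightarrow>\<^sub>M borel"
  using measurable_cong_sets[OF assms refl] by auto

text \<open>
The second marginal is where the coupled velocity has to be Gaussian for each fixed pair of positions.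
\<close>

lemma coupled_law_coupling:
  assumes "\<Gamma> \<in> couplings \<nu> \<eta>"
  shows "coupled_law \<Gamma> \<in> couplings (\<nu> \<bind> hmc_kernel U T) (\<eta> \<bind> hmc_kernel U T)"
proof -
  have \<Gamma>: "prob_space \<Gamma>" and sets_\<Gamma> [measurable_cong]: "sets \<Gamma> = sets (borel \<Otimes>\<^sub>M borel)"
    and marg: "distr \<Gamma> borel fst = \<nu>" "distr \<Gamma> borel snd = \<eta>"
    using assms by (auto simp: couplings_def)
  have sets_\<nu> [measurable_cong]: "sets \<nu> = sets borel" and sets_\<eta> [measurable_cong]: "sets \<eta> = sets borel"
    using marg by auto
  note [measurable] = couplings_measurable_projections[OF sets_\<Gamma>]
  interpret \<Gamma>: prob_space \<Gamma> by (rule \<Gamma>)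
  interpret N: pair_prob_space "std_gaussian :: 'a measure" unit_uniform ..
  interpret P: pair_prob_space \<Gamma> "(std_gaussian :: 'a measure) \<Otimes>\<^sub>M unit_uniform" ..
  have prob: "prob_space (coupled_law \<Gamma>)"
    unfolding coupled_law_def by (rule P.prob_space_distr) measurable
  have sets: "sets (coupled_law \<Gamma>) = sets (borel \<Otimes>\<^sub>M borel)" by (simp add: coupled_law_def)
  note [measurable_cong] = sets
  note [measurable] = couplings_measurable_projections[OF sets]
  have first: "distr (coupled_law \<Gamma>) borel fst = \<nu> \<bind> hmc_kernel U T"
  proof (rule measure_eqI)
    fix A assume "A \<in> sets (distr (coupled_law \<Gamma>) borel fst)"
    then have [measurable]: "A \<in> sets borel" by simp
    have "emeasure (distr (coupled_law \<Gamma>) borel fst) A = (\<integral>\<^sup>+ y. indicator A y \<partial>distr (coupled_law \<Gamma>) borel fst)"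
      by (rule nn_integral_indicator[symmetric]) simp
    also have "\<dots> = (\<integral>\<^sup>+ z. indicator A (fst z) \<partial>coupled_law \<Gamma>)"
      by (rule nn_integral_distr) measurable
    also have "\<dots> = (\<integral>\<^sup>+ z. \<integral>\<^sup>+ \<xi>. \<integral>\<^sup>+ u. indicator A (fst (coupled_step (z, (\<xi>, u)))) \<partial>unit_uniform \<partial>std_gaussian \<partial>\<Gamma>)"
      by (rule nn_integral_coupled_law[OF \<Gamma> sets_\<Gamma>]) measurable
    also have "\<dots> = (\<integral>\<^sup>+ z. \<integral>\<^sup>+ \<xi>. indicator A (hmc_position U T (fst z) \<xi>) \<partial>std_gaussian \<partial>\<Gamma>)"
      using unit_uniform.emeasure_space_1 by (simp add: coupled_step_def Let_def)
    also have "\<dots> = (\<integral>\<^sup>+ x. \<integral>\<^sup>+ \<xi>. indicator A (hmc_position U T x \<xi>) \<partial>std_gaussian \<partial>distr \<Gamma> borel fst)"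
      by (rule nn_integral_distr[symmetric]) measurable
    also have "\<dots> = emeasure (\<nu> \<bind> hmc_kernel U T) A"
      unfolding marg by (rule emeasure_bind_hmc_kernel[OF sets_\<nu>, symmetric]) measurable
    finally show "emeasure (distr (coupled_law \<Gamma>) borel fst) A = emeasure (\<nu> \<bind> hmc_kernel U T) A" .
  qed (simp add: sets_bind_hmc_kernel[OF sets_\<nu>])
  have second: "distr (coupled_law \<Gamma>) borel snd = \<eta> \<bind> hmc_kernel U T"
  proof (rule measure_eqI)
    fix A assume "A \<in> sets (distr (coupled_law \<Gamma>) borel snd)"
    then have [measurable]: "A \<in> sets borel" by simp
    have "emeasure (distr (coupled_law \<Gamma>) borel snd) A = (\<integral>\<^sup>+ y. indicator A y \<partial>distr (coupled_law \<Gamma>) borel snd)"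
      by (rule nn_integral_indicator[symmetric]) simp
    also have "\<dots> = (\<integral>\<^sup>+ z. indicator A (snd z) \<partial>coupled_law \<Gamma>)"
      by (rule nn_integral_distr) measurable
    also have "\<dots> = (\<integral>\<^sup>+ z. \<integral>\<^sup>+ \<xi>. \<integral>\<^sup>+ u. indicator A (snd (coupled_step (z, (\<xi>, u)))) \<partial>unit_uniform \<partial>std_gaussian \<partial>\<Gamma>)"
      by (rule nn_integral_coupled_law[OF \<Gamma> sets_\<Gamma>]) measurable
    also have "\<dots> = (\<integral>\<^sup>+ z. \<integral>\<^sup>+ \<xi>. indicator A (hmc_position U T (snd z) \<xi>) \<partial>std_gaussian \<partial>\<Gamma>)"
    proof (rule nn_integral_cong)
      fix z :: "'a \<times> 'a"
      have m: "(\<lambda>v. indicator A (hmc_position U T (snd z) v) :: ennreal) \<in> borel_measurable borel"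
        by measurable
      show "(\<integral>\<^sup>+ \<xi>. \<integral>\<^sup>+ u. indicator A (snd (coupled_step (z, (\<xi>, u)))) \<partial>unit_uniform \<partial>std_gaussian)
          = (\<integral>\<^sup>+ \<xi>. indicator A (hmc_position U T (snd z) \<xi>) \<partial>std_gaussian)"
        using nn_integral_velocity_coupling[OF m, of "shift (fst z) (snd z)"]
        by (simp add: coupled_step_def Let_def)
    qed
    also have "\<dots> = (\<integral>\<^sup>+ x. \<integral>\<^sup>+ \<xi>. indicator A (hmc_position U T x \<xi>) \<partial>std_gaussian \<partial>distr \<Gamma> borel snd)"
      by (rule nn_integral_distr[symmetric]) measurable
    also have "\<dots> = emeasure (\<eta> \<bind> hmc_kernel U T) A"
      unfolding marg by (rule emeasure_bind_hmc_kernel[OF sets_\<eta>, symmetric]) measurable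
    finally show "emeasure (distr (coupled_law \<Gamma>) borel snd) A = emeasure (\<eta> \<bind> hmc_kernel U T) A" .
  qed (simp add: sets_bind_hmc_kernel[OF sets_\<eta>])
  show ?thesis using prob sets first second by (simp add: couplings_def)
qed

lemma kantorovich_contraction:
  "kantorovich (\<lambda>x y. \<Phi> (norm (x - y))) (\<nu> \<bind> hmc_kernel U T) (\<eta> \<bind> hmc_kernel U T)
    \<le> ennreal (exp (- rate)) * kantorovich (\<lambda>x y. \<Phi> (norm (x - y))) \<nu> \<eta>"
  (is "?W \<le> _")
  unfolding kantorovich_def[of _ \<nu> \<eta>]
proof (rule le_ennreal_mult_INF)
  fix \<Gamma> assume \<Gamma>: "\<Gamma> \<in> couplings \<nu> \<eta>"
  then have prob: "prob_space \<Gamma>" and sets_\<Gamma> [measurable_cong]: "sets \<Gamma> = sets (borel \<Otimes>\<^sub>M borel)"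
    by (auto simp: couplings_def)
  note [measurable] = couplings_measurable_projections[OF sets_\<Gamma>]
  have "?W \<le> (\<integral>\<^sup>+ z. ennreal (\<Phi> (norm (fst z - snd z))) \<partial>coupled_law \<Gamma>)"
    unfolding kantorovich_def by (rule INF_lower[OF coupled_law_coupling[OF \<Gamma>]])
  also have "\<dots> = (\<integral>\<^sup>+ z. \<integral>\<^sup>+ \<xi>. \<integral>\<^sup>+ u. ennreal (\<Phi> (norm (fst (coupled_step (z, (\<xi>, u)))
      - snd (coupled_step (z, (\<xi>, u)))))) \<partial>unit_uniform \<partial>std_gaussian \<partial>\<Gamma>)"
    by (rule nn_integral_coupled_law[OF prob sets_\<Gamma>]) measurable
  also have "\<dots> \<le> (\<integral>\<^sup>+ z. ennreal (exp (- rate)) * ennreal (\<Phi> (norm (fst z - snd z))) \<partial>\<Gamma>)"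
  proof (rule nn_integral_mono)
    fix z :: "'a \<times> 'a"
    have nn: "0 \<le> \<Phi> (norm (fst z - snd z))"
      using T_pos R1_pos by (intro capped_dist_nonneg) auto
    have "(1 - rate) * \<Phi> (norm (fst z - snd z)) \<le> exp (- rate) * \<Phi> (norm (fst z - snd z))"
      using exp_ge_add_one_self[of "- rate"] nn by (intro mult_right_mono) auto
    from order_trans[OF drift[of "fst z" "snd z"] ennreal_leI[OF this]]
    show "(\<integral>\<^sup>+ \<xi>. \<integral>\<^sup>+ u. ennreal (\<Phi> (norm (fst (coupled_step (z, (\<xi>, u)))
        - snd (coupled_step (z, (\<xi>, u)))))) \<partial>unit_uniform \<partial>std_gaussian)
        \<le> ennreal (exp (- rate)) * ennreal (\<Phi> (norm (fst z - snd z)))"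
      using nn by (simp add: coupled_step_def Let_def ennreal_mult)
  qed
  also have "\<dots> = ennreal (exp (- rate)) * (\<integral>\<^sup>+ z. ennreal (\<Phi> (norm (fst z - snd z))) \<partial>\<Gamma>)"
    by (rule nn_integral_cmult) measurable
  finally show "?W \<le> ennreal (exp (- rate)) * (\<integral>\<^sup>+ z. ennreal (\<Phi> (norm (fst z - snd z))) \<partial>\<Gamma>)" .
qed simp

lemma kantorovich_chain_law:
  "kantorovich (\<lambda>x y. \<Phi> (norm (x - y))) (chain_law (hmc_kernel U T) \<nu> n) (chain_law (hmc_kernel U T) \<eta> n)
    \<le> ennreal (exp (- rate * real n)) * kantorovich (\<lambda>x y. \<Phi> (norm (x - y))) \<nu> \<eta>"
proof (induction n)
  case (Suc n)
  let ?k = "kantorovich (\<lambda>x y. \<Phi> (norm (x - y)))"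
  have "?k (chain_law (hmc_kernel U T) \<nu> (Suc n)) (chain_law (hmc_kernel U T) \<eta> (Suc n))
      \<le> ennreal (exp (- rate)) * ?k (chain_law (hmc_kernel U T) \<nu> n) (chain_law (hmc_kernel U T) \<eta> n)"
    using kantorovich_contraction by (simp add: chain_law_def)
  also have "\<dots> \<le> ennreal (exp (- rate)) * (ennreal (exp (- rate * real n)) * ?k \<nu> \<eta>)"
    by (intro mult_left_mono Suc.IH) simp
  also have "\<dots> = ennreal (exp (- rate * real (Suc n))) * ?k \<nu> \<eta>"
    by (simp add: mult.assoc[symmetric] ennreal_mult[symmetric] exp_add[symmetric] algebra_simps)
  finally show ?case .
qed (simp add: chain_law_def)

lemma kantorovich_le_wasserstein1:
  fixes \<nu> \<eta> :: "'a measure"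
  shows "kantorovich (\<lambda>x y. \<Phi> (norm (x - y))) \<nu> \<eta> \<le> wasserstein1 \<nu> \<eta>"
  unfolding wasserstein1_def kantorovich_def
  using T_pos R1_pos
  by (intro INF_mono') (auto intro!: nn_integral_mono ennreal_leI capped_dist_bounds)

lemma wasserstein1_le_kantorovich:
  fixes \<nu> \<eta> :: "'a measure"
  shows "wasserstein1 \<nu> \<eta> \<le> ennreal (exp (R\<^sub>1 / T)) * kantorovich (\<lambda>x y. \<Phi> (norm (x - y))) \<nu> \<eta>"
  unfolding kantorovich_def
proof (rule le_ennreal_mult_INF)
  fix \<Gamma> assume \<Gamma>: "\<Gamma> \<in> couplings \<nu> \<eta>"
  then have sets_\<Gamma> [measurable_cong]: "sets \<Gamma> = sets (borel \<Otimes>\<^sub>M borel)"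
    by (auto simp: couplings_def)
  note [measurable] = couplings_measurable_projections[OF sets_\<Gamma>]
  have "wasserstein1 \<nu> \<eta> \<le> (\<integral>\<^sup>+ z. ennreal (norm (fst z - snd z)) \<partial>\<Gamma>)"
    unfolding wasserstein1_def kantorovich_def by (rule INF_lower[OF \<Gamma>])
  also have "\<dots> \<le> (\<integral>\<^sup>+ z. ennreal (exp (R\<^sub>1 / T)) * ennreal (\<Phi> (norm (fst z - snd z))) \<partial>\<Gamma>)"
  proof (rule nn_integral_mono)
    fix z :: "'a \<times> 'a"
    let ?r = "norm (fst z - snd z)"
    have "exp (R\<^sub>1 / T) * (exp (- R\<^sub>1 / T) * ?r) \<le> exp (R\<^sub>1 / T) * \<Phi> ?r"
      using T_pos R1_pos by (intro mult_left_mono capped_dist_bounds) auto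
    then have "?r \<le> exp (R\<^sub>1 / T) * \<Phi> ?r"
      by (simp add: mult.assoc[symmetric] exp_add[symmetric])
    then show "ennreal ?r \<le> ennreal (exp (R\<^sub>1 / T)) * ennreal (\<Phi> ?r)"
      by (simp add: ennreal_mult'[symmetric] ennreal_leI)
  qed
  also have "\<dots> = ennreal (exp (R\<^sub>1 / T)) * (\<integral>\<^sup>+ z. ennreal (\<Phi> (norm (fst z - snd z))) \<partial>\<Gamma>)"
    by (rule nn_integral_cmult) measurable
  finally show "wasserstein1 \<nu> \<eta> \<le> ennreal (exp (R\<^sub>1 / T)) * (\<integral>\<^sup>+ z. ennreal (\<Phi> (norm (fst z - snd z))) \<partial>\<Gamma>)" .
qed simp

text \<open>
The detour through \<open>\<Phi>\<close> costs the factor \<open>exp (R\<^sub>1 / T)\<close> once, independently of \<open>n\<close>.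
\<close>

lemma wasserstein1_chain_law:
  "wasserstein1 (chain_law (hmc_kernel U T) \<nu> n) (chain_law (hmc_kernel U T) \<eta> n)
    \<le> ennreal (exp (R\<^sub>1 / T) * exp (- rate * real n)) * wasserstein1 \<nu> \<eta>"
proof -
  let ?k = "kantorovich (\<lambda>x y. \<Phi> (norm (x - y)))"
  have "wasserstein1 (chain_law (hmc_kernel U T) \<nu> n) (chain_law (hmc_kernel U T) \<eta> n)
      \<le> ennreal (exp (R\<^sub>1 / T)) * ?k (chain_law (hmc_kernel U T) \<nu> n) (chain_law (hmc_kernel U T) \<eta> n)"
    by (rule wasserstein1_le_kantorovich)
  also have "\<dots> \<le> ennreal (exp (R\<^sub>1 / T)) * (ennreal (exp (- rate * real n)) * ?k \<nu> \<eta>)"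
    by (intro mult_left_mono kantorovich_chain_law) simp
  also have "\<dots> \<le> ennreal (exp (R\<^sub>1 / T)) * (ennreal (exp (- rate * real n)) * wasserstein1 \<nu> \<eta>)"
    by (intro mult_left_mono kantorovich_le_wasserstein1) simp_all
  finally show ?thesis by (simp add: ennreal_mult mult.assoc)
qed

lemma chain_law_gibbs:
  assumes "integrable lborel (\<lambda>x. exp (- U x))"
  shows "chain_law (hmc_kernel U T) (gibbs_measure U) n = gibbs_measure U"
  by (induction n) (simp_all add: chain_law_def gibbs_invariant[OF assms])

end

text \<open>
For infinite initial distance the threshold is infinite, and for distance zero there is nothing to reach; in between,
the hypothesis is the logarithm of the claim.
\<close>

lemma exponential_decay_threshold:
  fixes D W :: ennreal and c k \<epsilon> :: real
  assumes c: "0 < c" and \<epsilon>: "0 < \<epsilon>"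
    and W: "W \<le> ennreal (exp k * exp (- c * real n)) * D"
    and n: "ereal (real n) \<ge> ereal (1 / c) * (ereal k + eln (D / ennreal \<epsilon>))"
  shows "W \<le> ennreal \<epsilon>"
proof (cases D)
  case top
  have "D / ennreal \<epsilon> = \<infinity>" using \<epsilon> by (simp add: top ennreal_top_divide)
  then have "eln (D / ennreal \<epsilon>) = \<infinity>" by (simp add: eln_def)
  with n c show ?thesis by simp
next
  case (real d)
  show ?thesis
  proof (cases "d = 0")
    case True
    with real W show ?thesis by simp
  next
    case False
    then have d: "0 < d" using real by simp
    have "D / ennreal \<epsilon> = ennreal (d / \<epsilon>)" using real \<epsilon> by (simp add: divide_ennreal)
    then have "eln (D / ennreal \<epsilon>) = ereal (ln (d / \<epsilon>))" using d \<epsilon> by (simp add: eln_def)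
    with n have "1 / c * (k + ln (d / \<epsilon>)) \<le> real n" by simp
    then have "k + ln (d / \<epsilon>) \<le> c * real n" using c by (simp add: field_simps)
    then have "k + - c * real n + ln d \<le> ln \<epsilon>" using d \<epsilon> by (simp add: ln_div)
    then have "exp (k + - c * real n + ln d) \<le> exp (ln \<epsilon>)" by (simp only: exp_le_cancel_iff)
    then have "exp k * exp (- c * real n) * d \<le> \<epsilon>" using d \<epsilon> by (simp only: exp_add exp_ln)
    moreover have "W \<le> ennreal (exp k * exp (- c * real n) * d)"
      using W real by (simp add: ennreal_mult)
    ultimately show ?thesis by (meson ennreal_leI order_trans)
  qed
qed

theorem corollary2p8:
  fixes U :: "'a::euclidean_space \<Rightarrow> real"
    and L K R T a R\<^sub>1 c M :: real
    and f :: "real \<Rightarrow> real" and \<rho> :: "'a \<Rightarrow> 'a \<Rightarrow> real"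
    and \<pi> :: "'a \<Rightarrow> 'a measure" and \<mu> \<nu> \<eta> :: "'a measure" and n :: nat
  assumes "C4 U" and "integrable lborel (\<lambda>x. exp (- U x))"
    and "assumption_A1 U" and "assumption_A2 U L" and "assumption_A3 U K R"
    and "0 < T"
    and "L * T\<^sup>2 \<le> min (K / L) (1 / 4)"
    and "R \<noteq> 0 \<Longrightarrow> L * T\<^sup>2 \<le> 1 / (256 * L * R\<^sup>2)"
    and "\<pi> = hmc_kernel U T" and "\<mu> = gibbs_measure U"
    and "a = 1 / T" and "R\<^sub>1 = 5 / 2 * (R + T)"
    and "\<And>r. f r = integral {0..r} (\<lambda>s. exp (- a * min s R\<^sub>1))"
    and "\<And>x y. \<rho> x y = f (norm (x - y))"
    and "c = 1 / 10 * min 1 (1 / 2 * K * T\<^sup>2 * (1 + R / T) * exp (- R / (2 * T))) * exp (- 2 * R / T)"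
    and "M = exp (5 / 2 * (1 + R / T))"
    and "prob_space \<nu>" and "sets \<nu> = sets borel"
    and "prob_space \<eta>" and "sets \<eta> = sets borel"
  shows "kantorovich \<rho> (chain_law \<pi> \<nu> n) (chain_law \<pi> \<eta> n)
           \<le> ennreal (exp (- c * real n)) * kantorovich \<rho> \<nu> \<eta> \<and>
         wasserstein1 (chain_law \<pi> \<nu> n) (chain_law \<pi> \<eta> n)
           \<le> ennreal (M * exp (- c * real n)) * wasserstein1 \<nu> \<eta> \<and>
         (\<forall>\<epsilon>::real. 0 < \<epsilon> \<longrightarrow>
           ereal (real n) \<ge> ereal (1 / c) *
             (ereal (5 / 2 + 5 * R / (2 * T)) + eln (wasserstein1 (chain_law \<pi> \<nu> 0) \<mu> / ennreal \<epsilon>)) \<longrightarrow>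
           wasserstein1 (chain_law \<pi> \<nu> n) \<mu> \<le> ennreal \<epsilon>)"
proof -
  have K: "0 < K" and R: "0 \<le> R" using assms(5) by (auto simp: assumption_A3_def)
  have lip: "norm (gradient U x - gradient U y) \<le> L * norm (x - y)" for x y
    using assms(1,4) by (rule gradient_lipschitz)
  have L: "0 < L" using convexity_constant_le_lipschitz_constant[OF assms(5) lip] K by simp
  interpret hmc_convergence U L T K R
  proof
    show "GDERIV U x :> gradient U x" for x
      using assms(1) by (intro gderiv_gradient) (simp add: C4_def)
    show "(x - y) \<bullet> (gradient U x - gradient U y) \<ge> K * (norm (x - y))\<^sup>2" if "norm (x - y) \<ge> R" for x y
      using assms(5) that by (auto simp: assumption_A3_def)
  qed (use lip L K R assms(6,7,8) in auto)
  have R1: "R\<^sub>1 = hmc_convergence.R\<^sub>1 T R"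
    by (simp add: assms(12) R\<^sub>1_def)
  have \<rho>: "\<rho> = (\<lambda>x y. capped_dist T (hmc_convergence.R\<^sub>1 T R) (norm (x - y)))"
    using integral_capped_exp[OF T_pos R1_pos] by (simp add: fun_eq_iff assms(11,13,14) R1)
  have c: "c = rate" by (simp add: assms(15) rate_def)
  have M: "M = exp (hmc_convergence.R\<^sub>1 T R / T)"
    using T_pos by (simp add: assms(16) R\<^sub>1_def field_simps)
  have k: "5 / 2 + 5 * R / (2 * T) = hmc_convergence.R\<^sub>1 T R / T"
    using T_pos by (simp add: R\<^sub>1_def field_simps)
  show ?thesis
  proof (intro conjI allI impI)
    show "kantorovich \<rho> (chain_law \<pi> \<nu> n) (chain_law \<pi> \<eta> n)
        \<le> ennreal (exp (- c * real n)) * kantorovich \<rho> \<nu> \<eta>"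
      unfolding \<rho> c assms(9) by (rule kantorovich_chain_law)
    show "wasserstein1 (chain_law \<pi> \<nu> n) (chain_law \<pi> \<eta> n)
        \<le> ennreal (M * exp (- c * real n)) * wasserstein1 \<nu> \<eta>"
      unfolding M c assms(9) by (rule wasserstein1_chain_law)
    fix \<epsilon> :: real
    assume \<epsilon>: "0 < \<epsilon>" and n: "ereal (real n) \<ge> ereal (1 / c) *
        (ereal (5 / 2 + 5 * R / (2 * T)) + eln (wasserstein1 (chain_law \<pi> \<nu> 0) \<mu> / ennreal \<epsilon>))"
    have "wasserstein1 (chain_law \<pi> \<nu> n) \<mu>
        \<le> ennreal (exp (hmc_convergence.R\<^sub>1 T R / T) * exp (- c * real n)) * wasserstein1 (chain_law \<pi> \<nu> 0) \<mu>"
      using wasserstein1_chain_law[of \<nu> n \<mu>] chain_law_gibbs[OF assms(2), of n]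
      by (simp add: assms(9,10) c chain_law_def)
    from exponential_decay_threshold[OF _ \<epsilon> this n[unfolded k]] show "wasserstein1 (chain_law \<pi> \<nu> n) \<mu> \<le> ennreal \<epsilon>"
      using rate_pos c by simp
  qed
qed

end
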